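(* There exist absolute constants $C>0$ and $K>0$ with the following property. For every $\delta>0$ there is $Q_0=Q_0(\delta)$ such that for all real $Q\ge Q_0$ and all real $X\ge \exp(3C\log Q/\log_4 Q)$, the number of primes $q\in(Q,2Q]$ with $q\equiv 3\pmod 4$ for which $$\left|P_q(X)-\frac12\cdot\frac{X}{\log X}\right|>\delta\,\frac{X}{\log X}$$ is at most $K\,Q\exp(-C\log Q/\log_4 Q)$. (That is, the asymptotic $P_q(X)\sim \frac12\cdot\frac{X}{\log X}$ is valid for all but $\ll Q\exp(-C\log Q/\log_4 Q)$ of the primes $q\in(Q,2Q]$, $q\equiv3\pmod 4$, as $Q\to+\infty$ with $X\ge\exp(3C\log Q/\log_4Q)$.)
   Context: For a prime $q\equiv 3\pmod 4$, $P_q(X)$ is the number of rational primes $p\le X$ that split in the quadratic field $\mathbb Q(\sqrt{-q})$. $\log_k$ is the $k$-fold iterated natural logarithm. *)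

theory Defs
  imports
    Complex_Main
    "HOL-Algebra.Ideal_Product"
    "HOL-Algebra.Generated_Fields"
    "HOL-Algebra.Algebraic_Closure_Type"
    "HOL-Number_Theory.Number_Theory"
begin

definition imag_quadratic_field :: "nat \<Rightarrow> complex set" where
  "imag_quadratic_field q =
     generate_field ring_of_type_algebra {csqrt (- of_nat q)}"

definition ring_of_integers :: "complex set \<Rightarrow> complex ring" where
  "ring_of_integers K = ring_of_type_algebra\<lparr>carrier := {x \<in> K. algebraic_int x}\<rparr>"

text \<open>
  Complete splitting in a field of degree 2: exactly two distinct prime ideals lie over \<open>p\<close>, each
  to the first power. Ramified primes (\<open>P\<^sub>1 = P\<^sub>2\<close>) and inert primes are excluded.
\<close>

definition splits_in_quadratic_field :: "nat \<Rightarrow> complex set \<Rightarrow> bool" where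
  "splits_in_quadratic_field p K \<longleftrightarrow>
     (\<exists>P\<^sub>1 P\<^sub>2. primeideal P\<^sub>1 (ring_of_integers K) \<and> primeideal P\<^sub>2 (ring_of_integers K) \<and> P\<^sub>1 \<noteq> P\<^sub>2 \<and>
        cgenideal (ring_of_integers K) (of_nat p) = ideal_prod (ring_of_integers K) P\<^sub>1 P\<^sub>2)"

definition split_prime_count :: "nat \<Rightarrow> real \<Rightarrow> nat" where
  "split_prime_count q x =
     card {p :: nat. prime p \<and> real p \<le> x \<and> splits_in_quadratic_field p (imag_quadratic_field q)}"

definition iterated_ln :: "nat \<Rightarrow> real \<Rightarrow> real" where
  "iterated_ln k x = (ln ^^ k) x"

end

theory Submission
  imports Defs "HOL-Complex_Analysis.Complex_Analysis" "HOL-Real_Asymp.Real_Asymp"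
begin

text \<open>
  For \<open>p \<noteq> 2, q\<close> the prime \<open>p\<close> splits iff \<open>-q\<close> is a square modulo \<open>p\<close>, that is, by reciprocity, iff
  the Legendre symbol \<open>\<chi>\<^sub>q(p) = (p/q)\<close> is 1. With the prime number theorem (Newman's proof) the prime
  \<open>q\<close> is exceptional only if the sum of \<open>\<chi>\<^sub>q(p)\<close> over \<open>p \<le> X\<close> is at least \<open>\<delta> X / log X\<close> in modulus.
  The number of such \<open>q\<close> is bounded by the dual form of the large sieve: for distinct \<open>q\<close> and \<open>r\<close> the
  sum of \<open>\<chi>\<^sub>q \<chi>\<^sub>r\<close> over an interval is at most \<open>q r\<close>. For \<open>X \<le> Q\<^sup>8\<close> this is applied to the \<open>k\<close>-th powers of
  the prime sums with \<open>k\<close> about \<open>3 log Q / log X\<close>, which costs a factor \<open>(c log Q)\<^sup>k\<close> only; as \<open>k \<le> log\<^sub>4 Q + 1\<close>,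
  this factor is negligible. For \<open>X > Q\<^sup>8\<close> the primes are majorised by Selberg's sieve weights, which
  leaves at most \<open>132/\<delta>\<^sup>2\<close> exceptional \<open>q\<close>. One can take \<open>C = K = 1\<close>.
\<close>

section \<open>Newman's Tauberian theorem\<close>

text \<open>The large sieve counts all integers, while the primes up to X have density only 1 / log
  X, so applying it to primes loses a factor log X. Passing to k-th powers loses this k times, and
  k! more because n can be a product of k primes in that many orders. With k about 3 log Q / log X
  the two losses together are (c k log X)^k, and k log X is of size log Q as long as log X is at
  most a multiple of log Q. Beyond that range even k = 1 loses a factor log X that Q does not
  control; there the sieve weights, whose mean is of order 1 / log X, win it back. The 3 in the
  range of X reflects the trivial bound q r: at most 2Q moduli with off-diagonal sums up to (2Q)^2
  need about Q^3 integers before the diagonal dominates, so X^k has to reach Q^3. The lower limit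
  for X is what keeps k below log_4 Q + 1. Since delta is fixed, an asymptotic formula for the
  number of primes suffices, without error term; delta then enters only through Q_0.\<close>

lemma neg_one_minus: "- 1 - x = - x - (1 :: real)"
  by simp

text \<open>Comparison with the integral of t powr (-1 - x) over [n, n + 1], written as a difference
  so that tails telescope.\<close>

lemma powr_minus_one_le_telescope:
  fixes x :: real and n :: nat
  assumes "x > 0" "n \<ge> 1"
  shows "real (Suc n) powr (-1 - x) \<le> (real n powr (-x) - real (Suc n) powr (-x)) / x"
proof -
  have "\<exists>z. real n < z \<and> z < real (Suc n) \<and>
      real (Suc n) powr (-x) - real n powr (-x) = (real (Suc n) - real n) * ((-x) * z powr (-x - 1))"
    using assms by (intro MVT2) (auto intro!: derivative_eq_intros simp: powr_diff)
  then obtain z where z: "real n < z" "z < real (Suc n)"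
    and eq: "real (Suc n) powr (-x) - real n powr (-x) = (-x) * z powr (-x - 1)" by auto
  have "real (Suc n) powr (-x - 1) \<le> z powr (-x - 1)"
    using z assms by (intro powr_mono2') auto
  hence "x * real (Suc n) powr (-x - 1) \<le> x * z powr (-x - 1)"
    using assms by (intro mult_left_mono) auto
  moreover have "real n powr (-x) - real (Suc n) powr (-x) = x * z powr (-x - 1)"
    using eq by linarith
  ultimately have "x * real (Suc n) powr (-1 - x) \<le> real n powr (-x) - real (Suc n) powr (-x)"
    unfolding neg_one_minus by linarith
  thus ?thesis using pos_le_divide_eq[OF assms(1)] by (simp only: mult.commute[of x])
qed


text \<open>Integral comparison. The summand decreases for \<open>y \<le> 1\<close> and increases
  otherwise; in the increasing case the last summand \<open>N powr (y - 1)\<close> is not covered by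
  the integral, which is the origin of \<open>1 / N\<close>. It is applied with
  \<open>y = - Re z\<close> on the left half of Newman's circle.\<close>

lemma sum_powr_le:
  fixes y :: real and N :: nat
  assumes y: "y > 0" and N: "N \<ge> 1"
  shows "(\<Sum>n=1..N. real n powr (y - 1)) \<le> real N powr y * (1 / real N + 1 / y)"
proof (cases "y \<le> 1")
  case True
  have step: "real (Suc n) powr (y - 1) \<le> (real (Suc n) powr y - real n powr y) / y" if "n \<ge> 1" for n
  proof -
    have "\<exists>z. real n < z \<and> z < real (Suc n) \<and>
        real (Suc n) powr y - real n powr y = (real (Suc n) - real n) * (y * z powr (y - 1))"
      using that by (intro MVT2) (auto intro!: derivative_eq_intros simp: powr_diff)
    then obtain z where z: "real n < z" "z < real (Suc n)"
      and eq: "real (Suc n) powr y - real n powr y = y * z powr (y - 1)" by auto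
    have "real (Suc n) powr (y - 1) \<le> z powr (y - 1)"
      using z True that by (intro powr_mono2') auto
    thus ?thesis using eq y by (simp add: field_simps)
  qed
  have "(\<Sum>n=1..N. real n powr (y - 1)) \<le> real N powr y / y"
    using N
  proof (induction N rule: dec_induct)
    case base
    show ?case using True y by simp
  next
    case (step n)
    have "(\<Sum>n=1..Suc n. real n powr (y - 1)) \<le> real n powr y / y + real (Suc n) powr (y - 1)"
      using step by simp
    also have "\<dots> \<le> real (Suc n) powr y / y"
      using \<open>\<And>n. n \<ge> 1 \<Longrightarrow> _\<close>[of n] step.hyps by (simp add: diff_divide_distrib)
    finally show ?case .
  qed
  also have "\<dots> \<le> real N powr y * (1 / real N + 1 / y)"
    by (simp add: algebra_simps)
  finally show ?thesis .
next
  case False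
  have step: "real n powr (y - 1) \<le> (real (Suc n) powr y - real n powr y) / y" if "n \<ge> 1" for n
  proof -
    have "\<exists>z. real n < z \<and> z < real (Suc n) \<and>
        real (Suc n) powr y - real n powr y = (real (Suc n) - real n) * (y * z powr (y - 1))"
      using that by (intro MVT2) (auto intro!: derivative_eq_intros simp: powr_diff)
    then obtain z where z: "real n < z" "z < real (Suc n)"
      and eq: "real (Suc n) powr y - real n powr y = y * z powr (y - 1)" by auto
    have "real n powr (y - 1) \<le> z powr (y - 1)"
      using z False that by (intro powr_mono2) auto
    thus ?thesis using eq y by (simp add: field_simps)
  qed
  have "(\<Sum>n=1..N. real n powr (y - 1)) \<le> real N powr y / y + real N powr (y - 1)"
    using N
  proof (induction N rule: dec_induct)
    case base
    show ?case using y by simp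
  next
    case (step n)
    have "(\<Sum>n=1..Suc n. real n powr (y - 1)) \<le> real n powr y / y + real n powr (y - 1) + real (Suc n) powr (y - 1)"
      using step by simp
    also have "\<dots> \<le> real (Suc n) powr y / y + real (Suc n) powr (y - 1)"
      using \<open>\<And>n. n \<ge> 1 \<Longrightarrow> _\<close>[of n] step.hyps by (simp add: diff_divide_distrib)
    finally show ?case .
  qed
  also have "\<dots> = real N powr y * (1 / real N + 1 / y)"
    using N by (simp add: algebra_simps powr_diff)
  finally show ?thesis .
qed

text \<open>The telescoping majorants over N < n, n up to N + k, leave only the contribution of the
  lower end point, uniformly in k.\<close>

lemma norm_dirichlet_tail_le:
  fixes a :: "nat \<Rightarrow> complex"
  assumes bound: "\<And>n. norm (a n) \<le> M" and z: "Re z > 0" and N: "N \<ge> 1"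
    and G: "(\<lambda>n. a n * of_nat n powr (-1 - z)) sums G"
  shows "norm (G - (\<Sum>n\<le>N. a n * of_nat n powr (-1 - z))) \<le> M * real N powr (- Re z) / Re z"
proof -
  have M: "M \<ge> 0" using bound[of 0] norm_ge_zero order_trans by blast
  let ?f = "\<lambda>n. a n * of_nat n powr (-1 - z)"
  have part: "norm ((\<Sum>n\<le>N + k. ?f n) - (\<Sum>n\<le>N. ?f n))
      \<le> M * (real N powr (- Re z) - real (N + k) powr (- Re z)) / Re z" for k
  proof (induction k)
    case (Suc k)
    have "norm (?f (Suc (N + k))) \<le> M * real (Suc (N + k)) powr (-1 - Re z)"
      using bound[of "Suc (N + k)"] unfolding norm_mult
      by (subst norm_powr_real_powr) (auto intro!: mult_right_mono simp del: of_nat_Suc)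
    also have "\<dots> \<le> M * ((real (N + k) powr (- Re z) - real (Suc (N + k)) powr (- Re z)) / Re z)"
      using z N M by (intro mult_left_mono powr_minus_one_le_telescope) auto
    finally have 1: "norm (?f (Suc (N + k))) \<le> \<dots>" .
    have "norm ((\<Sum>n\<le>N + Suc k. ?f n) - (\<Sum>n\<le>N. ?f n)) \<le>
        norm ((\<Sum>n\<le>N + k. ?f n) - (\<Sum>n\<le>N. ?f n)) + norm (?f (Suc (N + k)))"
      using norm_triangle_ineq[of "(\<Sum>n\<le>N + k. ?f n) - (\<Sum>n\<le>N. ?f n)" "?f (Suc (N + k))"]
      by (simp add: algebra_simps)
    also have "\<dots> \<le> M * (real N powr (- Re z) - real (N + k) powr (- Re z)) / Re z
        + M * ((real (N + k) powr (- Re z) - real (Suc (N + k)) powr (- Re z)) / Re z)"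
      using Suc 1 by linarith
    also have "\<dots> = M * (real N powr (- Re z) - real (N + Suc k) powr (- Re z)) / Re z"
      by (simp add: algebra_simps diff_divide_distrib)
    finally show ?case .
  qed simp
  have part': "norm ((\<Sum>n\<le>N + k. ?f n) - (\<Sum>n\<le>N. ?f n)) \<le> M * real N powr (- Re z) / Re z" for k
  proof -
    have "M * (real N powr (- Re z) - real (N + k) powr (- Re z)) / Re z \<le> M * real N powr (- Re z) / Re z"
      using z M by (intro divide_right_mono mult_left_mono) auto
    with part[of k] show ?thesis by linarith
  qed
  have "(\<lambda>k. \<Sum>n\<le>k. ?f n) \<longlonglongrightarrow> G" using G by (simp add: sums_def_le)
  hence "(\<lambda>k. \<Sum>n\<le>N + k. ?f n) \<longlonglongrightarrow> G"
    using LIMSEQ_ignore_initial_segment[of _ G N] by (simp add: add.commute)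
  hence "(\<lambda>k. norm ((\<Sum>n\<le>N + k. ?f n) - (\<Sum>n\<le>N. ?f n))) \<longlonglongrightarrow> norm (G - (\<Sum>n\<le>N. ?f n))"
    by (intro tendsto_intros)
  thus ?thesis by (rule Lim_bounded[where M = 0]) (use part' in auto)
qed

lemma norm_dirichlet_partial_sum_le:
  fixes a :: "nat \<Rightarrow> complex"
  assumes bound: "\<And>n. norm (a n) \<le> M" and z: "Re z < 0" and N: "N \<ge> 1"
  shows "norm (\<Sum>n\<le>N. a n * of_nat n powr (-1 - z)) \<le> M * (real N powr (- Re z) * (1 / real N - 1 / Re z))"
proof -
  have M: "M \<ge> 0" using bound[of 0] norm_ge_zero order_trans by blast
  have "norm (\<Sum>n\<le>N. a n * of_nat n powr (-1 - z)) \<le> (\<Sum>n\<le>N. M * real n powr (- Re z - 1))"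
  proof (intro sum_norm_le)
    fix n
    have e: "-1 - Re z = - Re z - 1" by simp
    have "norm ((of_nat n :: complex) powr (-1 - z)) = real n powr (- Re z - 1)"
      unfolding e[symmetric] by (cases "n = 0") (simp_all add: norm_powr_real_powr)
    thus "norm (a n * of_nat n powr (-1 - z)) \<le> M * real n powr (- Re z - 1)"
      using bound[of n] by (simp add: norm_mult mult_right_mono)
  qed
  also have "\<dots> = M * (\<Sum>n\<le>N. real n powr (- Re z - 1))" by (simp add: sum_distrib_left)
  also have "(\<Sum>n\<le>N. real n powr (- Re z - 1)) = (\<Sum>n=1..N. real n powr (- Re z - 1))"
    by (intro sum.mono_neutral_right) (auto simp: Suc_le_eq)
  also have "M * \<dots> \<le> M * (real N powr (- Re z) * (1 / real N + 1 / (- Re z)))"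
    using sum_powr_le[of "- Re z" N] z N M by (intro mult_left_mono) auto
  finally show ?thesis by simp
qed

text \<open>Integration by parts: \<open>h * E / ln N\<close> is a primitive of \<open>h * E\<close>
  up to the term \<open>deriv h * E / ln N\<close>, and \<open>E\<close> has modulus 1 on the
  imaginary axis, so the integral is O(1 / ln N).\<close>

lemma riemann_lebesgue_linepath:
  assumes S: "open S" and h: "h holomorphic_on S" and ab: "closed_segment a b \<subseteq> S"
    and re: "Re a = 0" "Re b = 0"
  shows "(\<lambda>N. contour_integral (linepath a b) (\<lambda>z. h z * exp (z * of_real (ln (real N))))) \<longlonglongrightarrow> 0"
proof -
  let ?E = "\<lambda>N z. exp (z * of_real (ln (real N)))"
  have re0: "Re z = 0" if "z \<in> closed_segment a b" for z
    using that re by (auto simp: closed_segment_def)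
  have nE: "norm (?E N z) = 1" if "z \<in> closed_segment a b" for N z
    using re0[OF that] by simp
  have h': "deriv h holomorphic_on S" using h S by (rule holomorphic_deriv)
  have cont: "continuous_on (closed_segment a b) (deriv h)"
    using holomorphic_on_imp_continuous_on[OF h'] ab continuous_on_subset by blast
  then obtain B where B: "\<And>z. z \<in> closed_segment a b \<Longrightarrow> norm (deriv h z) \<le> B"
    using compact_imp_bounded[OF compact_continuous_image[OF cont compact_segment]]
    by (auto simp: bounded_iff)
  have B0: "B \<ge> 0" using order_trans[OF norm_ge_zero B[of a]] by simp
  define C where "C = norm (h b) + norm (h a) + B * norm (b - a)"
  have main: "norm (contour_integral (linepath a b) (\<lambda>z. h z * ?E N z)) \<le> C / ln (real N)" if N: "N \<ge> 2" for N
  proof -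
    let ?l = "of_real (ln (real N)) :: complex"
    have l0: "?l \<noteq> 0" "ln (real N) > 0" using N by auto
    have "((\<lambda>z. deriv h z * ?E N z / ?l + h z * ?E N z) has_contour_integral
        (h (pathfinish (linepath a b)) * ?E N (pathfinish (linepath a b)) / ?l
          - h (pathstart (linepath a b)) * ?E N (pathstart (linepath a b)) / ?l)) (linepath a b)"
    proof (rule contour_integral_primitive[where S = S])
      fix x assume x: "x \<in> S"
      have "(h has_field_derivative deriv h x) (at x)"
        using h S x holomorphic_derivI by blast
      hence d: "(h has_field_derivative deriv h x) (at x within S)"
        by (rule has_field_derivative_at_within)
      have "((\<lambda>z. ?E N z) has_field_derivative (?E N x * ?l)) (at x within S)"
        by (auto intro!: derivative_eq_intros)
      from DERIV_cdivide[OF DERIV_mult[OF d this], of ?l]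
      show "((\<lambda>z. h z * ?E N z / ?l) has_field_derivative (deriv h x * ?E N x / ?l + h x * ?E N x)) (at x within S)"
        using l0 by (simp add: add_divide_distrib mult.commute[of _ "h x"])
    qed (use ab in auto)
    hence i1: "((\<lambda>z. deriv h z * ?E N z / ?l + h z * ?E N z) has_contour_integral
        (h b * ?E N b / ?l - h a * ?E N a / ?l)) (linepath a b)" by simp
    have "(\<lambda>z. deriv h z * ?E N z / ?l) contour_integrable_on linepath a b"
      by (intro contour_integrable_continuous_linepath continuous_intros cont) (use l0 in auto)
    then obtain I where I: "((\<lambda>z. deriv h z * ?E N z / ?l) has_contour_integral I) (linepath a b)"
      unfolding contour_integrable_on_def by blast
    have nI: "norm I \<le> B / ln (real N) * norm (b - a)"
    proof (rule has_contour_integral_bound_linepath[OF I])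
      show "0 \<le> B / ln (real N)" using B0 l0 by simp
      fix x assume x: "x \<in> closed_segment a b"
      show "norm (deriv h x * ?E N x / ?l) \<le> B / ln (real N)"
        using B[OF x] nE[OF x, of N] l0 by (simp add: norm_mult norm_divide divide_right_mono)
    qed
    from has_contour_integral_diff[OF i1 I]
    have "contour_integral (linepath a b) (\<lambda>z. h z * ?E N z) = h b * ?E N b / ?l - h a * ?E N a / ?l - I"
      by (intro contour_integral_unique) simp
    also have "norm \<dots> \<le> norm (h b * ?E N b / ?l) + norm (h a * ?E N a / ?l) + norm I"
      by (meson norm_triangle_ineq4 add_right_mono order_trans)
    also have "\<dots> \<le> C / ln (real N)"
      using nI nE[of a N] nE[of b N] l0
      by (simp add: norm_mult norm_divide C_def add_divide_distrib)
    finally show ?thesis .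
  qed
  have lim: "(\<lambda>N. C / ln (real N)) \<longlonglongrightarrow> 0" by real_asymp
  show ?thesis
    by (rule Lim_null_comparison[OF _ lim]) (use main in \<open>auto simp: eventually_sequentially intro!: exI[of _ 2]\<close>)
qed

text \<open>
  On the circle of radius \<open>R\<close> the kernel \<open>1/z + z/R\<^sup>2\<close> is real and proportional to \<open>Re z\<close>,
  which cancels the factor \<open>1 / Re z\<close> in the bounds for Dirichlet tails and partial sums.
\<close>

lemma newman_kernel:
  assumes "norm z = R" "R > 0"
  shows "(1 + z\<^sup>2 / of_real R ^ 2) / z = of_real (2 * Re z / R ^ 2)"
proof -
  have z0: "z \<noteq> 0" using assms by auto
  have "z * cnj z = of_real (R ^ 2)"
    using complex_norm_square[of z] assms by simp
  hence "1 * of_real R ^ 2 = cnj z * z" by (simp add: mult.commute)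
  hence "1 / z = cnj z / of_real R ^ 2"
    using z0 assms by (subst frac_eq_eq) auto
  moreover have "(1 + z\<^sup>2 / of_real R ^ 2) / z = 1 / z + z / of_real R ^ 2"
    using z0 by (simp add: add_divide_distrib power2_eq_square)
  ultimately have "(1 + z\<^sup>2 / of_real R ^ 2) / z = (cnj z + z) / of_real R ^ 2"
    by (simp add: add_divide_distrib)
  also have "cnj z + z = of_real (2 * Re z)" using complex_add_cnj[of z] by (simp add: add.commute)
  finally show ?thesis by simp
qed

lemma contour_integral_part_circlepath_inverse:
  assumes "s < t" "R > 0"
  shows "((\<lambda>z. 1 / z) has_contour_integral (\<i> * of_real (t - s))) (part_circlepath 0 R s t)"
proof -
  have "((\<lambda>x::real. \<i>) has_integral (of_real (t - s) * \<i>)) {s..t}"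
    using has_integral_const_real[of "\<i>" s t] assms by (simp add: scaleR_conv_of_real)
  hence "((\<lambda>x. 1 / (0 + of_real R * cis x) * of_real R * \<i> * cis x) has_integral (\<i> * of_real (t - s))) {s..t}"
    using assms by (simp add: mult.commute)
  thus ?thesis using assms by (simp add: has_contour_integral_part_circlepath_iff)
qed

text \<open>\<open>P / z\<close> is the difference quotient of \<open>P\<close> at 0, which
  integrates to 0 over the closed circle, plus \<open>P 0 / z\<close>, which contributes i pi
  \<open>P 0\<close> on each half circle. \<open>H\<close> is subtracted on the right half only; by
  Cauchy's theorem in the convex half-plane its integral there can be moved to the diameter.\<close>

lemma newman_split:
  fixes P H :: "complex \<Rightarrow> complex"
  assumes R: "R > 0" and P: "P holomorphic_on UNIV" and H: "H holomorphic_on {z. Re z \<ge> 0}"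
  shows "2 * of_real pi * \<i> * P 0 =
      contour_integral (part_circlepath 0 R (-(pi/2)) (pi/2)) (\<lambda>z. P z / z - H z)
    + contour_integral (part_circlepath 0 R (pi/2) (3*pi/2)) (\<lambda>z. P z / z)
    - contour_integral (linepath (of_real R * \<i>) (- of_real R * \<i>)) H"
    and "(\<lambda>z. P z / z - H z) contour_integrable_on part_circlepath 0 R (-(pi/2)) (pi/2)"
    and "(\<lambda>z. P z / z) contour_integrable_on part_circlepath 0 R (pi/2) (3*pi/2)"
proof -
  define Cp where "Cp = part_circlepath 0 R (-(pi/2)) (pi/2)"
  define Cm where "Cm = part_circlepath 0 R (pi/2) (3*pi/2)"
  define L where "L = linepath (of_real R * \<i>) (- of_real R * \<i>)"
  define q where "q = (\<lambda>z. if z = 0 then deriv P 0 else (P z - P 0) / (z - 0))"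
  have q: "q holomorphic_on UNIV" unfolding q_def using P by (intro pole_lemma_open) auto
  have ends: "cis (pi/2) = \<i>" "cis (-(pi/2)) = - \<i>" "cis (3*pi/2) = - \<i>"
    using cos_3over2_pi sin_3over2_pi by (auto simp: complex_eq_iff)
  have se: "pathstart Cp = - of_real R * \<i>" "pathfinish Cp = of_real R * \<i>"
    "pathstart Cm = of_real R * \<i>" "pathfinish Cm = - of_real R * \<i>"
    unfolding Cp_def Cm_def by (simp_all add: cis_conv_exp[symmetric] ends exp_eq_polar)
  have vp: "valid_path Cp" "valid_path Cm" "valid_path L" by (simp_all add: Cp_def Cm_def L_def)
  have "(q has_contour_integral 0) (Cp +++ Cm)"
    using q convex_UNIV by (rule Cauchy_theorem_convex_simple) (auto simp: se vp)
  moreover have qi: "q contour_integrable_on Cp" "q contour_integrable_on Cm"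
    using contour_integrable_holomorphic_simple[OF q] vp by auto
  ultimately have q0: "contour_integral Cp q + contour_integral Cm q = 0"
    using contour_integral_join[OF qi vp(1,2)] contour_integral_unique by simp
  have imCp: "path_image Cp \<subseteq> {z. Re z \<ge> 0}"
  proof
    fix z assume "z \<in> path_image Cp"
    then obtain t where t: "- (pi/2) \<le> t" "t \<le> pi/2" "z = of_real R * exp (\<i> * of_real t)"
      unfolding Cp_def by (subst (asm) path_image_part_circlepath) auto
    thus "z \<in> {z. Re z \<ge> 0}" using cos_ge_zero[of t] R by (simp add: Re_exp)
  qed
  have imL: "path_image L \<subseteq> {z. Re z \<ge> 0}"
    by (auto simp: L_def closed_segment_def)
  have Hcont: "continuous_on {z. Re z \<ge> 0} H" using H by (rule holomorphic_on_imp_continuous_on)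
  have "(H has_contour_integral 0) (Cp +++ L)"
    using H
  proof (rule Cauchy_theorem_convex_simple)
    show "convex {z. Re z \<ge> 0}" by (rule convex_halfspace_Re_ge)
    show "path_image (Cp +++ L) \<subseteq> {z. 0 \<le> Re z}" using imCp imL path_image_join_subset by blast
  qed (auto simp: se vp L_def)
  moreover have Hi: "H contour_integrable_on Cp" "H contour_integrable_on L"
    unfolding Cp_def L_def
    using continuous_on_subset[OF Hcont imCp] continuous_on_subset[OF Hcont imL]
    by (auto intro!: contour_integrable_continuous_part_circlepath contour_integrable_continuous_linepath
         simp: Cp_def L_def)
  ultimately have H0: "contour_integral Cp H + contour_integral L H = 0"
    using contour_integral_join[OF Hi vp(1,3)] contour_integral_unique by simp
  have ne: "z \<noteq> 0" if "z \<in> path_image Cp \<union> path_image Cm" for z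
    using that R by (auto simp: Cp_def Cm_def path_image_part_circlepath)
  have inv: "((\<lambda>z. 1 / z) has_contour_integral (\<i> * of_real pi)) Cp"
       "((\<lambda>z. 1 / z) has_contour_integral (\<i> * of_real pi)) Cm"
    unfolding Cp_def Cm_def
    using contour_integral_part_circlepath_inverse[of "-(pi/2)" "pi/2" R]
          contour_integral_part_circlepath_inverse[of "pi/2" "3*pi/2" R] R by simp_all
  have Pz: "((\<lambda>z. P z / z) has_contour_integral (contour_integral C q + \<i> * of_real pi * P 0)) C"
    if "C = Cp \<or> C = Cm" for C
  proof -
    have "(q has_contour_integral contour_integral C q) C"
      using that qi has_contour_integral_integral by blast
    moreover have "((\<lambda>z. 1 / z) has_contour_integral (\<i> * of_real pi)) C"
      using that inv by blast
    ultimately have "((\<lambda>z. q z + 1 / z * P 0) has_contour_integral (contour_integral C q + \<i> * of_real pi * P 0)) C"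
      using has_contour_integral_add has_contour_integral_rmul by blast
    thus ?thesis
      by (rule has_contour_integral_eq) (use that ne in \<open>auto simp: q_def diff_divide_distrib\<close>)
  qed
  have iCp: "((\<lambda>z. P z / z - H z) has_contour_integral
      (contour_integral Cp q + \<i> * of_real pi * P 0 - contour_integral Cp H)) Cp"
    using has_contour_integral_diff[OF Pz[of Cp] has_contour_integral_integral[OF Hi(1)]] by simp
  show "(\<lambda>z. P z / z - H z) contour_integrable_on part_circlepath 0 R (-(pi/2)) (pi/2)"
    using iCp unfolding Cp_def by (rule has_contour_integral_integrable)
  show "(\<lambda>z. P z / z) contour_integrable_on part_circlepath 0 R (pi/2) (3*pi/2)"
    using Pz[of Cm] unfolding Cm_def by (auto intro: has_contour_integral_integrable)
  have "contour_integral Cp (\<lambda>z. P z / z - H z) + contour_integral Cm (\<lambda>z. P z / z) - contour_integral L H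
     = (contour_integral Cp q + contour_integral Cm q) + 2 * of_real pi * \<i> * P 0
       - (contour_integral Cp H + contour_integral L H)"
    using contour_integral_unique[OF iCp] contour_integral_unique[OF Pz[of Cm]]
    by (simp add: algebra_simps)
  hence "contour_integral Cp (\<lambda>z. P z / z - H z) + contour_integral Cm (\<lambda>z. P z / z) - contour_integral L H
     = 2 * of_real pi * \<i> * P 0"
    by (simp only: q0 H0) simp
  thus "2 * of_real pi * \<i> * P 0 =
      contour_integral (part_circlepath 0 R (-(pi/2)) (pi/2)) (\<lambda>z. P z / z - H z)
    + contour_integral (part_circlepath 0 R (pi/2) (3*pi/2)) (\<lambda>z. P z / z)
    - contour_integral (linepath (of_real R * \<i>) (- of_real R * \<i>)) H"
    unfolding Cp_def Cm_def L_def by (rule sym)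
qed

text \<open>
  Since \<open>G 0 = 0\<close>, the integrand built from \<open>G\<close> has no pole at 0, so it can be integrated along the
  diameter itself, where the factor \<open>N powr z\<close> makes the integral tend to 0 by Riemann-Lebesgue.
\<close>

lemma newman_zero:
  fixes a :: "nat \<Rightarrow> complex"
  assumes bound: "\<And>n. norm (a n) \<le> M"
    and S: "open S" "{z. Re z \<ge> 0} \<subseteq> S" and G: "G holomorphic_on S" "G 0 = 0"
    and series: "\<And>z. Re z > 0 \<Longrightarrow> (\<lambda>n. a n * of_nat n powr (-1 - z)) sums G z"
  shows "(\<lambda>N. \<Sum>n\<le>N. a n * of_nat n powr (-1)) \<longlonglongrightarrow> 0"
proof -
  have M: "M \<ge> 0" using bound[of 0] norm_ge_zero order_trans by blast
  define g where "g = (\<lambda>z. if z = 0 then deriv G 0 else (G z - G 0) / (z - 0))"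
  have g: "g holomorphic_on S" unfolding g_def using G S by (intro pole_lemma_open) auto
  define s where "s = (\<lambda>N z. \<Sum>n\<le>N. a n * of_nat n powr (-1 - z))"
  define seg where "seg = (\<lambda>R N. contour_integral (linepath (of_real R * \<i>) (- of_real R * \<i>))
      (\<lambda>z. g z * (1 + z\<^sup>2 / of_real R ^ 2) * exp (z * of_real (ln (real N)))))"
  \<comment> \<open>After division by 2 pi each arc contributes \<open>M / R\<close>, the right one
    from the tail and the left one from the partial sum, which adds \<open>M / N\<close>.
    \<open>E\<close> is N powr z and compensates the growth of both bounds.\<close>
  have main: "norm (s N 0) \<le> 2 * M / R + M / real N + norm (seg R N)" if R: "R > 0" and N: "N \<ge> 1" for R N
  proof -
    define E where "E = (\<lambda>z::complex. exp (z * of_real (ln (real N))))"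
    define W where "W = (\<lambda>z::complex. 1 + z\<^sup>2 / of_real R ^ 2)"
    define P where "P = (\<lambda>z. s N z * E z * W z)"
    define H where "H = (\<lambda>z. g z * W z * E z)"
    have nE: "norm (E z) = real N powr Re z" for z
      using N by (simp add: E_def powr_def mult.commute)
    have hE: "E holomorphic_on A" "W holomorphic_on A" for A
      unfolding E_def W_def using R by (auto intro!: holomorphic_intros)
    have hs: "s N holomorphic_on UNIV"
      unfolding s_def
    proof (intro holomorphic_on_sum holomorphic_on_mult holomorphic_on_const)
      fix n
      show "(\<lambda>z. complex_of_nat n powr (-1 - z)) holomorphic_on UNIV"
        by (cases "n = 0") (auto intro!: holomorphic_intros)
    qed
    have hP: "P holomorphic_on UNIV" unfolding P_def by (intro holomorphic_intros hs hE)
    have hH: "H holomorphic_on {z. Re z \<ge> 0}"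
      unfolding H_def using holomorphic_on_subset[OF g S(2)] by (intro holomorphic_intros hE)
    note sp = newman_split[OF R hP hH]
    have P0: "P 0 = s N 0" by (simp add: P_def E_def W_def)
    have kn: "norm (W z / z) = 2 * \<bar>Re z\<bar> / R ^ 2" if "norm z = R" for z
      unfolding W_def newman_kernel[OF that R] norm_of_real using R by simp
    \<comment> \<open>The end points of the arcs are excepted in both bounds, since the estimates
      for tails and partial sums need \<open>Re z\<close> different from 0.\<close>
    have b1: "norm (contour_integral (part_circlepath 0 R (-(pi/2)) (pi/2)) (\<lambda>z. P z / z - H z))
        \<le> 2 * M / R ^ 2 * R * (pi/2 - (-(pi/2)))"
    proof (rule contour_integral_bound_part_circlepath_strong[OF sp(2), where k = "{of_real R * \<i>, - of_real R * \<i>}"])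
      fix z assume z: "z \<in> path_image (part_circlepath 0 R (- (pi / 2)) (pi / 2)) - {of_real R * \<i>, - of_real R * \<i>}"
      have nz: "norm z = R" using z R in_path_image_part_circlepath[of z 0 R] by auto
      obtain t where t: "- (pi/2) \<le> t" "t \<le> pi/2" "z = of_real R * exp (\<i> * of_real t)"
        using z by (auto simp: path_image_part_circlepath)
      hence "Re z \<ge> 0" using cos_ge_zero[of t] R by (simp add: Re_exp)
      moreover have "Re z \<noteq> 0"
      proof
        assume "Re z = 0"
        hence "\<bar>Im z\<bar> = R" using nz by (simp add: cmod_def)
        thus False using z \<open>Re z = 0\<close> by (auto simp: complex_eq_iff abs_if split: if_splits)
      qed
      ultimately have re: "Re z > 0" by simp
      have z0: "z \<noteq> 0" using re by auto
      have "P z / z - H z = (s N z - G z) * E z * (W z / z)"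
        using z0 G by (simp add: P_def H_def g_def field_simps)
      also have "norm \<dots> = norm (G z - s N z) * real N powr Re z * (2 * Re z / R ^ 2)"
        unfolding norm_mult nE kn[OF nz] using re by (simp add: norm_minus_commute)
      also have "\<dots> \<le> (M * real N powr (- Re z) / Re z) * real N powr Re z * (2 * Re z / R ^ 2)"
        unfolding s_def using norm_dirichlet_tail_le[OF bound re N series[OF re]] re R
        by (intro mult_right_mono) auto
      also have "\<dots> = 2 * M / R ^ 2"
        using re R N by (simp add: powr_minus field_simps)
      finally show "norm (P z / z - H z) \<le> 2 * M / R ^ 2" .
    qed (use M R in auto)
    have b2: "norm (contour_integral (part_circlepath 0 R (pi/2) (3*pi/2)) (\<lambda>z. P z / z))
        \<le> 2 * M / R ^ 2 * (1 + R / real N) * R * (3*pi/2 - pi/2)"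
    proof (rule contour_integral_bound_part_circlepath_strong[OF sp(3), where k = "{of_real R * \<i>, - of_real R * \<i>}"])
      fix z assume z: "z \<in> path_image (part_circlepath 0 R (pi / 2) (3*pi / 2)) - {of_real R * \<i>, - of_real R * \<i>}"
      have nz: "norm z = R" using z R in_path_image_part_circlepath[of z 0 R] by auto
      obtain t where t: "pi/2 \<le> t" "t \<le> 3*pi/2" "z = of_real R * exp (\<i> * of_real t)"
        using z by (auto simp: path_image_part_circlepath)
      have "cos t = - cos (t - pi)" by simp
      moreover have "cos (t - pi) \<ge> 0" using t by (intro cos_ge_zero) auto
      ultimately have "Re z \<le> 0" using R t(3) by (simp add: Re_exp mult_nonneg_nonpos)
      moreover have "Re z \<noteq> 0"
      proof
        assume "Re z = 0"
        hence "\<bar>Im z\<bar> = R" using nz by (simp add: cmod_def)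
        thus False using z \<open>Re z = 0\<close> by (auto simp: complex_eq_iff abs_if split: if_splits)
      qed
      ultimately have re: "Re z < 0" by simp
      have reR: "- Re z \<le> R" using nz abs_Re_le_cmod[of z] by linarith
      have "P z / z = s N z * E z * (W z / z)" by (simp add: P_def)
      also have "norm \<dots> = norm (s N z) * real N powr Re z * (2 * (- Re z) / R ^ 2)"
        unfolding norm_mult nE kn[OF nz] using re by simp
      also have "\<dots> \<le> (M * (real N powr (- Re z) * (1 / real N - 1 / Re z))) * real N powr Re z * (2 * (- Re z) / R ^ 2)"
        unfolding s_def using norm_dirichlet_partial_sum_le[OF bound re N] re R
        by (intro mult_right_mono) (auto simp: divide_le_0_iff)
      also have "\<dots> = 2 * M / R ^ 2 * (1 + (- Re z) / real N)"
        using re R N by (simp add: powr_minus field_simps)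
      also have "\<dots> \<le> 2 * M / R ^ 2 * (1 + R / real N)"
        using reR M N by (intro mult_left_mono add_left_mono divide_right_mono) auto
      finally show "norm (P z / z) \<le> 2 * M / R ^ 2 * (1 + R / real N)" .
    qed (use M R in auto)
    have "2 * pi * norm (s N 0) = norm (2 * of_real pi * \<i> * P 0)"
      by (simp add: P0 norm_mult)
    also have "\<dots> \<le> 2 * M / R ^ 2 * R * (pi/2 - (-(pi/2))) + 2 * M / R ^ 2 * (1 + R / real N) * R * (3*pi/2 - pi/2)
        + norm (seg R N)"
    proof -
      have "contour_integral (linepath (of_real R * \<i>) (- of_real R * \<i>)) H = seg R N"
        by (simp add: seg_def H_def E_def W_def)
      thus ?thesis unfolding sp(1) using b1 b2
        by (intro order_trans[OF norm_triangle_ineq4] add_mono order_trans[OF norm_triangle_ineq]) auto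
    qed
    also have "\<dots> = 2 * pi * (2 * M / R + M / real N) + norm (seg R N)"
      using R N by (simp add: field_simps power2_eq_square)
    also have "\<dots> \<le> 2 * pi * (2 * M / R + M / real N) + 2 * pi * norm (seg R N)"
      using pi_ge_two mult_right_mono[of 1 "2 * pi" "norm (seg R N)"] by simp
    finally have "2 * pi * norm (s N 0) \<le> 2 * pi * (2 * M / R + M / real N + norm (seg R N))"
      by (simp add: algebra_simps)
    thus ?thesis by (subst (asm) mult_le_cancel_left_pos) auto
  qed
  have "s N 0 = (\<Sum>n\<le>N. a n * of_nat n powr (-1))" for N by (simp add: s_def)
  moreover have "(\<lambda>N. s N 0) \<longlonglongrightarrow> 0"
  proof (rule tendstoI)
    fix e :: real assume e: "e > 0"
    \<comment> \<open>\<open>R\<close> is fixed before \<open>N\<close> tends to infinity: the arcs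
      get less than \<open>e / 3\<close> independently of \<open>N\<close>, while the limit on the
      diameter is for fixed \<open>R\<close>.\<close>
    define R where "R = (6 * M + 1) / e"
    have R: "R > 0" using e M by (simp add: R_def)
    have RM: "2 * M / R < e / 3" using e M by (simp add: R_def field_simps)
    have "(\<lambda>z. g z * (1 + z\<^sup>2 / of_real R ^ 2)) holomorphic_on S"
      using R by (auto intro!: holomorphic_intros g)
    moreover have "closed_segment (of_real R * \<i>) (- of_real R * \<i>) \<subseteq> S"
      using S by (auto simp: closed_segment_def subset_iff)
    ultimately have "seg R \<longlonglongrightarrow> 0"
      unfolding seg_def using S(1) by (intro riemann_lebesgue_linepath) auto
    hence "eventually (\<lambda>N. dist (seg R N) 0 < e / 3) sequentially" using e by (intro tendstoD) auto
    moreover have "(\<lambda>N. M / real N) \<longlonglongrightarrow> 0" by real_asymp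
    hence "eventually (\<lambda>N. dist (M / real N) 0 < e / 3) sequentially" using e by (intro tendstoD) auto
    ultimately show "eventually (\<lambda>N. dist (s N 0) 0 < e) sequentially"
      using eventually_ge_at_top[of 1]
    proof eventually_elim
      case (elim N)
      have "M / real N < e / 3" using elim(2) M by (simp add: dist_real_def)
      moreover have "norm (seg R N) < e / 3" using elim(1) by (simp add: dist_norm)
      ultimately have "norm (s N 0) < e" using main[OF R elim(3)] RM by linarith
      thus ?case by (simp add: dist_norm)
    qed
  qed
  ultimately show ?thesis by simp
qed

text \<open>Changing the coefficient of index 1 reduces to the case of a sum function vanishing at 0.\<close>

theorem newman_tauberian:
  fixes a :: "nat \<Rightarrow> complex"
  assumes bound: "\<And>n. norm (a n) \<le> M"
    and S: "open S" "{z. Re z \<ge> 0} \<subseteq> S" and G: "G holomorphic_on S"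
    and series: "\<And>z. Re z > 0 \<Longrightarrow> (\<lambda>n. a n * of_nat n powr (-1 - z)) sums G z"
  shows "(\<lambda>n. a n / of_nat n) sums G 0"
proof -
  define b where "b = (\<lambda>n. a n - (if n = 1 then G 0 else 0))"
  have "(\<lambda>N. \<Sum>n\<le>N. b n * of_nat n powr (-1)) \<longlonglongrightarrow> 0"
  proof (rule newman_zero[OF _ S, where G = "\<lambda>z. G z - G 0"])
    show "norm (b n) \<le> M + norm (G 0)" for n
      unfolding b_def using norm_triangle_ineq4[of "a n" "if n = 1 then G 0 else 0"] bound[of n]
      by (auto split: if_splits intro: order_trans)
    show "(\<lambda>z. G z - G 0) holomorphic_on S" using G by (intro holomorphic_intros)
    fix z assume z: "Re z > 0"
    have "(\<lambda>n. if n = 1 then G 0 else 0) sums G 0"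
      using sums_single[of 1 "\<lambda>_. G 0"] by simp
    from sums_diff[OF series[OF z] this]
    show "(\<lambda>n. b n * of_nat n powr (-1 - z)) sums (G z - G 0)"
      by (rule sums_cong[THEN iffD1, rotated]) (auto simp: b_def algebra_simps)
  qed simp
  hence "(\<lambda>n. b n * of_nat n powr (-1)) sums 0" by (simp add: sums_def_le)
  moreover have "(\<lambda>n. if n = 1 then G 0 else 0) sums G 0"
    using sums_single[of 1 "\<lambda>_. G 0"] by simp
  ultimately have "(\<lambda>n. b n * of_nat n powr (-1) + (if n = 1 then G 0 else 0)) sums (0 + G 0)"
    by (rule sums_add)
  moreover have "b n * of_nat n powr (-1) + (if n = 1 then G 0 else 0) = a n / of_nat n" for n
  proof (cases "n = 0")
    case False
    have "complex_of_nat n powr (-1) = inverse (of_nat n)"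
      using False by (simp add: powr_minus)
    thus ?thesis by (auto simp: b_def field_simps)
  qed auto
  ultimately show ?thesis by simp
qed

section \<open>The zeta function on the line Re s = 1\<close>

text \<open>
  For \<open>Re s > 1\<close> the last two terms telescope to 0, so that the series of these terms over all \<open>n\<close>,
  with \<open>0 powr z = 0\<close>, is \<open>(s - 1) \<zeta>(s)\<close>; they are small enough for it to converge for \<open>Re s > 0\<close>.
\<close>

definition zeta_term :: "nat \<Rightarrow> complex \<Rightarrow> complex" where
  "zeta_term n s = (s - 1) * of_nat n powr (- s) - of_nat n powr (1 - s) + of_nat (Suc n) powr (1 - s)"

text \<open>\<open>zeta_term n s\<close> is the error of the first order Taylor expansion of u powr
  (1 - s) from n to n + 1, and the bound is that for the second derivative on this segment.\<close>

lemma norm_zeta_term_le: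
  assumes n: "n \<ge> 1" and s: "Re s > 0"
  shows "norm (zeta_term n s) \<le> norm s * norm (s - 1) * real n powr (- Re s - 1)"
proof -
  define S where "S = closed_segment (of_nat n :: complex) (of_nat (Suc n))"
  define f where "f = (\<lambda>i::nat. \<lambda>u::complex. if i = 0 then u powr (1 - s) else if i = 1 then (1 - s) * u powr (- s)
     else (1 - s) * (- s) * u powr (- s - 1))"
  have Sre: "\<exists>r\<ge>real n. u = of_real r" if "u \<in> S" for u
  proof -
    from that obtain t where t: "0 \<le> t" "u = (1 - of_real t) * of_nat n + of_real t * of_nat (Suc n)"
      by (auto simp: S_def closed_segment_def scaleR_conv_of_real)
    have "u = of_real (real n + t)" by (simp add: t algebra_simps)
    thus ?thesis using t by (intro exI[of _ "real n + t"]) auto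
  qed
  have nonneg: "u \<notin> \<real>\<^sub>\<le>\<^sub>0" if "u \<in> S" for u
    using Sre[OF that] n by auto
  have "norm (f 0 (of_nat (Suc n)) - (\<Sum>i\<le>1. f i (of_nat n) * (of_nat (Suc n) - of_nat n) ^ i / fact i))
      \<le> (norm s * norm (s - 1) * real n powr (- Re s - 1)) * norm (of_nat (Suc n) - of_nat n :: complex) ^ (Suc 1) / fact 1"
  proof (rule complex_Taylor[where S = S])
    show "convex S" by (simp add: S_def)
    show "of_nat n \<in> S" "of_nat (Suc n) \<in> S" by (simp_all add: S_def)
  next
    fix i x assume x: "x \<in> S" and i: "i \<le> (1::nat)"
    have "i = 0 \<or> i = 1" using i by auto
    thus "(f i has_field_derivative f (Suc i) x) (at x within S)"
    proof
      assume "i = 0"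
      have "((\<lambda>u. u powr (1 - s)) has_field_derivative (1 - s) * x powr (1 - s - 1)) (at x)"
        using nonneg[OF x] by (rule has_field_derivative_powr)
      thus ?thesis using \<open>i = 0\<close> by (auto simp: f_def intro: has_field_derivative_at_within)
    next
      assume "i = 1"
      have "((\<lambda>u. u powr (- s)) has_field_derivative (- s) * x powr (- s - 1)) (at x)"
        using nonneg[OF x] by (rule has_field_derivative_powr)
      from DERIV_cmult[OF this, of "1 - s"] show ?thesis
        using \<open>i = 1\<close> by (auto simp: f_def mult.assoc intro: has_field_derivative_at_within)
    qed
  next
    fix x assume x: "x \<in> S"
    obtain r where r: "r \<ge> real n" "x = of_real r" using Sre[OF x] by blast
    have "norm (x powr (- s - 1)) = r powr (- Re s - 1)"
      using r n by (simp add: norm_powr_real_powr)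
    also have "\<dots> \<le> real n powr (- Re s - 1)" using r n s by (intro powr_mono2') auto
    finally have "norm (s - 1) * norm s * norm (x powr (- s - 1)) \<le> norm (s - 1) * norm s * real n powr (- Re s - 1)"
      by (rule mult_left_mono) auto
    moreover have "norm (f (Suc 1) x) = norm (s - 1) * norm s * norm (x powr (- s - 1))"
      by (simp add: f_def norm_mult norm_minus_commute[of 1 s])
    ultimately show "norm (f (Suc 1) x) \<le> norm s * norm (s - 1) * real n powr (- Re s - 1)"
      by (simp only: mult.commute[of "norm s" "norm (s - 1)"])
  qed
  moreover have "f 0 (of_nat (Suc n)) - (\<Sum>i\<le>1. f i (of_nat n) * (of_nat (Suc n) - of_nat n) ^ i / fact i) = zeta_term n s"
    by (simp add: f_def zeta_term_def ring_distribs)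
  ultimately show ?thesis by simp
qed

lemma holomorphic_on_suminf:
  fixes f :: "nat \<Rightarrow> complex \<Rightarrow> complex"
  assumes A: "open A" and f: "\<And>n. f n holomorphic_on A"
    and M: "\<And>x. x \<in> A \<Longrightarrow> \<exists>d>0. \<exists>M. cball x d \<subseteq> A \<and> summable M \<and> (\<forall>n. \<forall>y\<in>cball x d. norm (f n y) \<le> M n)"
  shows "(\<lambda>s. \<Sum>n. f n s) holomorphic_on A"
proof (rule holomorphic_uniform_sequence[where f = "\<lambda>N s. \<Sum>n<N. f n s"])
  show "(\<lambda>s. \<Sum>n<N. f n s) holomorphic_on A" for N by (intro holomorphic_on_sum f)
next
  fix x assume "x \<in> A"
  from M[OF this] obtain d M where dM: "d > 0" "cball x d \<subseteq> A" "summable M"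
     "\<And>n y. y \<in> cball x d \<Longrightarrow> norm (f n y) \<le> M n" by auto
  have "uniform_limit (cball x d) (\<lambda>N s. \<Sum>n<N. f n s) (\<lambda>s. \<Sum>n. f n s) sequentially"
    using dM by (intro Weierstrass_m_test) auto
  thus "\<exists>d>0. cball x d \<subseteq> A \<and> uniform_limit (cball x d) (\<lambda>N s. \<Sum>n<N. f n s) (\<lambda>s. \<Sum>n. f n s) sequentially"
    using dM by blast
qed (fact A)

lemma norm_of_nat_powr: "norm ((of_nat n :: complex) powr s) = real n powr Re s"
  by (cases "n = 0") (auto simp: norm_powr_real_powr)

lemma holomorphic_on_of_nat_powr [holomorphic_intros]:
  assumes "f holomorphic_on A"
  shows "(\<lambda>s. (of_nat n :: complex) powr f s) holomorphic_on A"
  using assms by (cases "n = 0") (auto intro!: holomorphic_intros)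

lemma summable_ln_powr:
  fixes \<sigma> :: real
  assumes "\<sigma> > 1"
  shows "summable (\<lambda>n. ln (real n) * real n powr (-\<sigma>))"
proof (rule summable_comparison_test')
  define e where "e = (\<sigma> - 1) / 2"
  have e: "e > 0" using assms by (simp add: e_def)
  have "e - \<sigma> < -1" using assms by (simp add: e_def field_simps)
  thus "summable (\<lambda>n. 1 / e * real n powr (e - \<sigma>))"
    by (intro summable_mult) (simp add: summable_real_powr_iff)
  fix n :: nat assume n: "n \<ge> 1"
  have "ln (real n) \<le> real n powr e / e" using n e by (intro ln_powr_bound) auto
  hence "ln (real n) * real n powr (-\<sigma>) \<le> (real n powr e / e) * real n powr (-\<sigma>)"
    by (intro mult_right_mono) auto
  also have "\<dots> = 1 / e * real n powr (e - \<sigma>)"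
    using powr_add[of "real n" e "-\<sigma>"] by simp
  finally show "norm (ln (real n) * real n powr (-\<sigma>)) \<le> 1 / e * real n powr (e - \<sigma>)"
    using n by simp
qed

section \<open>The Dirichlet series of zeta and of the von Mangoldt function\<close>

definition zeta_series :: "complex \<Rightarrow> complex" where
  "zeta_series s = (\<Sum>n. of_nat n powr (-s))"

definition mangoldt_series :: "complex \<Rightarrow> complex" where
  "mangoldt_series s = (\<Sum>n. mangoldt n * of_nat n powr (-s))"

text \<open>Only meaningful for \<open>Re s > 0\<close>, where it is \<open>(s - 1) \<zeta>(s)\<close>.\<close>

definition zeta_entire :: "complex \<Rightarrow> complex" where
  "zeta_entire s = (\<Sum>n. zeta_term n s)"

lemma norm_mangoldt_le: "norm (mangoldt n :: complex) \<le> ln (real n)"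
  by (cases "n = 0") (auto simp: norm_mangoldt mangoldt_le)

lemma summable_zeta_series: "Re s > 1 \<Longrightarrow> summable (\<lambda>n. norm ((of_nat n :: complex) powr (-s)))"
  by (simp add: norm_of_nat_powr summable_real_powr_iff)

lemma summable_mangoldt_series:
  assumes "Re s > 1" shows "summable (\<lambda>n. norm (mangoldt n * (of_nat n :: complex) powr (-s)))"
proof (rule summable_comparison_test')
  show "summable (\<lambda>n. ln (real n) * real n powr (- Re s))" using assms by (rule summable_ln_powr)
  show "norm (norm (mangoldt n * (of_nat n :: complex) powr (-s))) \<le> ln (real n) * real n powr (- Re s)"
    if "n \<ge> 0" for n
    using norm_mangoldt_le[of n] by (simp add: norm_mult norm_of_nat_powr mult_right_mono del: norm_mangoldt)
qed

lemma summable_ln_series: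
  assumes "Re s > 1" shows "summable (\<lambda>n. norm (of_real (ln (real n)) * (of_nat n :: complex) powr (-s)))"
proof -
  have "norm (of_real (ln (real n)) * (of_nat n :: complex) powr (-s)) = ln (real n) * real n powr (- Re s)" for n
    by (cases "n = 0") (simp_all add: norm_mult norm_of_nat_powr)
  thus ?thesis using summable_ln_powr[OF assms] by simp
qed

lemma open_Re_gt: "open {s. Re s > c}"
  by (simp add: open_halfspace_Re_gt)

lemma cball_Re:
  assumes "Re x > c" and "y \<in> cball x ((Re x - c) / 2)"
  shows "Re y \<ge> (Re x + c) / 2"
proof -
  have "Re x - Re y \<le> (Re x - c) / 2"
    using assms(2) abs_Re_le_cmod[of "x - y"] by (simp add: dist_norm)
  thus ?thesis by (simp add: field_simps)
qed

lemma holomorphic_mangoldt_series: "mangoldt_series holomorphic_on {s. Re s > 1}"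
  unfolding mangoldt_series_def
proof (rule holomorphic_on_suminf)
  fix x assume x: "x \<in> {s. Re s > 1}"
  let ?d = "(Re x - 1) / 2" and ?\<sigma> = "(Re x + 1) / 2"
  show "\<exists>d>0. \<exists>M. cball x d \<subseteq> {s. Re s > 1} \<and> summable M \<and>
      (\<forall>n. \<forall>y\<in>cball x d. norm (mangoldt n * of_nat n powr (-y)) \<le> M n)"
  proof (intro exI[of _ ?d] exI[of _ "\<lambda>n. ln (real n) * real n powr (-?\<sigma>)"] conjI allI ballI)
    show "?d > 0" using x by simp
    show "cball x ?d \<subseteq> {s. Re s > 1}" using x cball_Re[of 1 x] by fastforce
    show "summable (\<lambda>n. ln (real n) * real n powr (-?\<sigma>))" using x by (intro summable_ln_powr) simp
    fix n y assume y: "y \<in> cball x ?d"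
    show "norm (mangoldt n * of_nat n powr (-y)) \<le> ln (real n) * real n powr (-?\<sigma>)"
    proof (cases "n = 0")
      case False
      have "real n powr (- Re y) \<le> real n powr (-?\<sigma>)"
        using cball_Re[OF _ y] x False by (intro powr_mono) auto
      thus ?thesis using norm_mangoldt_le[of n] False unfolding norm_mult norm_of_nat_powr
        by (intro mult_mono) auto
    qed simp
  qed
qed (auto intro!: holomorphic_intros simp: open_Re_gt)

lemma summable_zeta_term_bound:
  assumes "\<sigma> > 0"
  shows "summable (\<lambda>n. C * real n powr (-\<sigma> - 1) + (if n = 0 then 1 else 0))"
  using assms by (intro summable_add summable_mult)
    (auto simp: summable_real_powr_iff intro: summable_single)

lemma norm_zeta_term_le':
  assumes "Re s > 0"
  shows "norm (zeta_term n s) \<le> norm s * norm (s - 1) * real n powr (- Re s - 1) + (if n = 0 then 1 else 0)"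
  using norm_zeta_term_le[OF _ assms, of n] by (cases "n = 0") (auto simp: zeta_term_def)

text \<open>Used with c = 0 for \<open>zeta_entire\<close>, and with c = 1 for
  \<open>psi_correction\<close>, whose terms carry an additional factor of order n. The term of
  index 0 is the constant 1, because \<open>0 powr z = 0\<close>.\<close>

lemma zeta_term_locally_bounded:
  assumes x: "Re x > c" and c: "c \<ge> 0"
  shows "\<exists>C. \<forall>n. \<forall>y\<in>cball x ((Re x - c) / 2). Re y \<ge> (Re x + c) / 2 \<and>
     norm (zeta_term n y) \<le> C * real n powr (- ((Re x + c) / 2) - 1) + (if n = 0 then 1 else 0)"
proof (intro exI allI ballI conjI)
  fix n y assume y: "y \<in> cball x ((Re x - c) / 2)"
  show re: "Re y \<ge> (Re x + c) / 2" using cball_Re[OF x y] .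
  define C where "C = (norm x + Re x) * (norm x + Re x + 1)"
  have "norm (y - x) \<le> Re x" using y x c by (simp add: dist_norm norm_minus_commute)
  hence ny: "norm y \<le> norm x + Re x"
    using norm_triangle_ineq2[of y x] by linarith
  have "norm (y - 1) \<le> norm x + Re x + 1" using ny norm_triangle_ineq4[of y 1] by simp
  hence nn: "norm y * norm (y - 1) \<le> C" unfolding C_def using ny x c by (intro mult_mono) auto
  have pw: "real n powr (- Re y - 1) \<le> real n powr (- ((Re x + c) / 2) - 1)"
  proof (cases "n = 0")
    case False thus ?thesis using re by (intro powr_mono) auto
  qed simp
  have "norm (zeta_term n y) \<le> norm y * norm (y - 1) * real n powr (- Re y - 1) + (if n = 0 then 1 else 0)"
    using re x c by (intro norm_zeta_term_le') auto
  also have "\<dots> \<le> C * real n powr (- ((Re x + c) / 2) - 1) + (if n = 0 then 1 else 0)"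
    using nn pw order_trans[OF _ nn, of 0] by (intro add_right_mono mult_mono) auto
  finally show "norm (zeta_term n y) \<le> ((norm x + Re x) * (norm x + Re x + 1)) * real n powr (- ((Re x + c) / 2) - 1) + (if n = 0 then 1 else 0)"
    by (simp only: C_def)
qed

lemma holomorphic_zeta_term: "zeta_term n holomorphic_on A"
  unfolding zeta_term_def by (intro holomorphic_intros)

lemma holomorphic_zeta_entire: "zeta_entire holomorphic_on {s. Re s > 0}"
  unfolding zeta_entire_def
proof (rule holomorphic_on_suminf)
  fix x assume x: "x \<in> {s. Re s > 0}"
  hence "Re x > 0" by simp
  from zeta_term_locally_bounded[of 0, OF this order_refl, unfolded diff_0_right add_0_right] obtain C where C: "\<forall>n. \<forall>y\<in>cball x (Re x / 2). Re y \<ge> Re x / 2 \<and>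
     norm (zeta_term n y) \<le> C * real n powr (- (Re x / 2) - 1) + (if n = 0 then 1 else 0)" by blast
  show "\<exists>d>0. \<exists>M. cball x d \<subseteq> {s. Re s > 0} \<and> summable M \<and>
      (\<forall>n. \<forall>y\<in>cball x d. norm (zeta_term n y) \<le> M n)"
  proof (intro exI[of _ "Re x / 2"] exI[of _ "\<lambda>n. C * real n powr (- (Re x / 2) - 1) + (if n = 0 then 1 else 0)"] conjI allI ballI)
    show "Re x / 2 > 0" using x by simp
    show "cball x (Re x / 2) \<subseteq> {s. Re s > 0}"
    proof
      fix y assume "y \<in> cball x (Re x / 2)"
      hence "Re y \<ge> Re x / 2" using C by blast
      thus "y \<in> {s. Re s > 0}" using x by simp
    qed
    show "summable (\<lambda>n. C * real n powr (- (Re x / 2) - 1) + (if n = 0 then 1 else 0))"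
      using x by (intro summable_zeta_term_bound) simp
  qed (use C in blast)
qed (auto intro!: holomorphic_zeta_term simp: open_Re_gt)

lemma tendsto_of_nat_powr_neg:
  assumes "Re s < 0"
  shows "(\<lambda>n. (of_nat n :: complex) powr s) \<longlonglongrightarrow> 0"
proof (rule tendsto_norm_zero_cancel)
  have "(\<lambda>n. real n powr Re s) \<longlonglongrightarrow> 0"
    using tendsto_neg_powr[OF assms filterlim_real_sequentially] by simp
  thus "(\<lambda>n. norm ((of_nat n :: complex) powr s)) \<longlonglongrightarrow> 0" by (simp add: norm_of_nat_powr)
qed

lemma zeta_entire_eq:
  assumes s: "Re s > 1"
  shows "zeta_entire s = (s - 1) * zeta_series s"
proof -
  have "(\<lambda>n. of_nat n powr (-s)) sums zeta_series s"
    unfolding zeta_series_def using summable_norm_cancel[OF summable_zeta_series[OF s]] by (rule summable_sums)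
  hence 1: "(\<lambda>n. (s - 1) * of_nat n powr (-s)) sums ((s - 1) * zeta_series s)" by (rule sums_mult)
  have "(\<lambda>n. of_nat n powr (1 - s)) \<longlonglongrightarrow> 0" using s by (intro tendsto_of_nat_powr_neg) auto
  from sums_add[OF 1 telescope_sums[OF this]]
  have "(\<lambda>n. zeta_term n s) sums ((s - 1) * zeta_series s)"
    by (simp add: zeta_term_def algebra_simps)
  thus ?thesis unfolding zeta_entire_def by (rule sums_unique[symmetric])
qed

lemma zeta_entire_1: "zeta_entire 1 = 1"
proof -
  have "zeta_term n 1 = (if n = 0 then 1 else 0)" for n
    by (cases "n = 0") (auto simp: zeta_term_def simp del: of_nat_Suc)
  thus ?thesis using sums_unique[OF sums_single[of 0 "\<lambda>_. 1::complex"]] by (simp add: zeta_entire_def)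
qed

lemma deriv_zeta_series:
  assumes s: "Re s > 1"
  shows "(zeta_series has_field_derivative - (\<Sum>n. of_real (ln (real n)) * of_nat n powr (-s))) (at s)"
proof -
  let ?S = "{s. Re s > 1}"
  have "\<exists>g g'. \<forall>x\<in>?S. (\<lambda>n. (of_nat n :: complex) powr (-x)) sums g x \<and>
      (\<lambda>n. - (of_real (ln (real n)) * of_nat n powr (-x))) sums g' x \<and> (g has_field_derivative g' x) (at x)"
  proof (rule series_and_derivative_comparison_local)
    fix n x assume "x \<in> ?S"
    show "((\<lambda>x. (of_nat n :: complex) powr (-x)) has_field_derivative - (of_real (ln (real n)) * of_nat n powr (-x))) (at x)"
    proof (cases "n = 0")
      case False
      hence "((\<lambda>z. (of_nat n :: complex) powr z) has_field_derivative
          of_real (ln (real n)) * of_nat n powr (-x)) (at (-x))"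
        using has_field_derivative_powr_right[of "of_nat n" "-x"] by (simp add: Ln_of_nat)
      from DERIV_chain2[OF this DERIV_minus[OF DERIV_ident]] show ?thesis by simp
    qed simp
  next
    fix x assume x: "x \<in> ?S"
    let ?d = "(Re x - 1) / 2" and ?\<sigma> = "(Re x + 1) / 2"
    have "norm ((of_nat n :: complex) powr (-y)) \<le> real n powr (-?\<sigma>)" if "y \<in> ball x ?d" for n y
    proof (cases "n = 0")
      case False
      thus ?thesis using cball_Re[of 1 x y] x that unfolding norm_of_nat_powr by (intro powr_mono) auto
    qed simp
    thus "\<exists>d h. 0 < d \<and> summable h \<and> (\<forall>\<^sub>F n in sequentially. \<forall>y\<in>ball x d \<inter> ?S. norm ((of_nat n :: complex) powr (-y)) \<le> h n)"
      using x by (intro exI[of _ ?d] exI[of _ "\<lambda>n. real n powr (-?\<sigma>)"]) (auto simp: summable_real_powr_iff)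
  qed (simp add: open_Re_gt)
  then obtain g g' where g: "\<forall>x\<in>?S. (\<lambda>n. (of_nat n :: complex) powr (-x)) sums g x \<and>
      (\<lambda>n. - (of_real (ln (real n)) * of_nat n powr (-x))) sums g' x \<and> (g has_field_derivative g' x) (at x)"
    by blast
  have gz: "g x = zeta_series x" if "x \<in> ?S" for x
    unfolding zeta_series_def by (rule sums_unique) (use g that in blast)
  have "(g has_field_derivative g' s) (at s)" using g s by simp
  hence "(zeta_series has_field_derivative g' s) (at s)"
    by (rule has_field_derivative_transform_within_open[where S = ?S]) (use s gz in \<open>auto simp: open_Re_gt\<close>)
  moreover have "(\<lambda>n. of_real (ln (real n)) * of_nat n powr (-s)) sums (- g' s)"
    using sums_minus[of _ "g' s"] g s by fastforce
  hence "(\<Sum>n. of_real (ln (real n)) * of_nat n powr (-s)) = - g' s"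
    by (rule sums_unique[symmetric])
  hence "g' s = - (\<Sum>n. of_real (ln (real n)) * of_nat n powr (-s))" by simp
  ultimately show ?thesis by simp
qed

text \<open>The von Mangoldt function sums to ln n over the divisors of n; by absolute convergence
  the product can be rearranged, grouping the pairs (d, k) by n = d k. Index 0 is removed first,
  since it has infinitely many divisors.\<close>

lemma zeta_times_mangoldt:
  assumes s: "Re s > 1"
  shows "mangoldt_series s * zeta_series s = (\<Sum>n. of_real (ln (real n)) * of_nat n powr (-s))"
proof -
  define f where "f = (\<lambda>n. mangoldt n * (of_nat n :: complex) powr (-s))"
  define g where "g = (\<lambda>n. (of_nat n :: complex) powr (-s))"
  define l where "l = (\<lambda>n. of_real (ln (real n)) * (of_nat n :: complex) powr (-s))"
  define A where "A = ({0<..} :: nat set)"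
  have restrict: "(h has_sum S) A" if "summable (\<lambda>n. norm (h n))" "S = (\<Sum>n. h n)" "h 0 = 0" for h and S :: complex
  proof -
    have "(h has_sum S) UNIV"
      using norm_summable_imp_has_sum[OF that(1)] summable_sums[OF summable_norm_cancel[OF that(1)]] that(2) by simp
    moreover have "(h has_sum S) UNIV \<longleftrightarrow> (h has_sum S) A"
    proof (rule has_sum_cong_neutral)
      fix x assume "x \<in> UNIV - A"
      hence "x = 0" by (simp add: A_def)
      thus "h x = 0" using that(3) by simp
    qed auto
    ultimately show ?thesis by simp
  qed
  have hf: "(f has_sum mangoldt_series s) A"
    using summable_mangoldt_series[OF s] by (intro restrict) (auto simp: f_def mangoldt_series_def)
  have hg: "(g has_sum zeta_series s) A"
    using summable_zeta_series[OF s] by (intro restrict) (auto simp: g_def zeta_series_def)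
  have hl: "(l has_sum (\<Sum>n. l n)) A"
    using summable_ln_series[OF s] by (intro restrict) (auto simp: l_def)
  have sf: "(\<lambda>n. norm (f n)) summable_on A"
  proof (rule summable_on_subset_banach[OF norm_summable_imp_summable_on subset_UNIV])
    show "summable (\<lambda>n. norm (norm (f n)))"
      using summable_mangoldt_series[OF s] by (simp add: f_def)
  qed
  have sg: "(\<lambda>n. norm (g n)) summable_on A"
  proof (rule summable_on_subset_banach[OF norm_summable_imp_summable_on subset_UNIV])
    show "summable (\<lambda>n. norm (norm (g n)))"
      using summable_zeta_series[OF s] by (simp add: g_def)
  qed
  have "(\<lambda>x. norm (case x of (d, k) \<Rightarrow> f d * g k)) summable_on A \<times> A"
  proof (subst Infinite_Sum.abs_summable_on_Sigma_iff, intro conjI ballI)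
    fix x
    show "(\<lambda>y. norm (case (x, y) of (d, k) \<Rightarrow> f d * g k)) summable_on A"
      using summable_on_cmult_right[OF sg, of "norm (f x)"] by (simp add: norm_mult)
    have "(\<lambda>x. norm (f x) * (\<Sum>\<^sub>\<infinity>y\<in>A. norm (g y))) summable_on A"
      using sf by (rule summable_on_cmult_left)
    hence "(\<lambda>x. \<Sum>\<^sub>\<infinity>y\<in>A. norm (f x * g y)) summable_on A"
      by (simp add: norm_mult infsum_cmult_right')
    thus "(\<lambda>x. norm (\<Sum>\<^sub>\<infinity>y\<in>A. norm (case (x, y) of (d, k) \<Rightarrow> f d * g k))) summable_on A"
      by (simp add: infsum_nonneg)
  qed
  hence sfg: "(\<lambda>(d, k). f d * g k) summable_on A \<times> A" by (rule Infinite_Sum.abs_summable_summable)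
  have "((\<lambda>(d, k). f d * g k) has_sum (mangoldt_series s * zeta_series s)) (A \<times> A)"
  proof (rule has_sum_SigmaI[OF _ _ sfg])
    show "((\<lambda>y. case (x, y) of (d, k) \<Rightarrow> f d * g k) has_sum (f x * zeta_series s)) A" for x
      using has_sum_cmult_right[OF hg, of "f x"] by simp
    show "((\<lambda>x. f x * zeta_series s) has_sum (mangoldt_series s * zeta_series s)) A"
      using has_sum_cmult_left[OF hf] .
  qed
  moreover have bij: "bij_betw (\<lambda>(n, d). (d, n div d)) (Sigma A (\<lambda>n. {d. d dvd n})) (A \<times> A)"
    by (rule bij_betwI[where g = "\<lambda>(d, k). (d * k, d)"]) (auto simp: A_def dvd_div_eq_0_iff gr0_conv_Suc dest: dvd_pos_nat)
  ultimately have "((\<lambda>x. (\<lambda>(d, k). f d * g k) ((\<lambda>(n, d). (d, n div d)) x)) has_sum (mangoldt_series s * zeta_series s))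
      (Sigma A (\<lambda>n. {d. d dvd n}))"
    using has_sum_reindex_bij_betw[OF bij] by blast
  hence "((\<lambda>n. \<Sum>d | d dvd n. f d * g (n div d)) has_sum (mangoldt_series s * zeta_series s)) A"
  proof (rule has_sum_SigmaD)
    fix n assume "n \<in> A"
    hence "finite {d. d dvd n}" by (simp add: A_def)
    from has_sum_finite[OF this, of "\<lambda>d. f d * g (n div d)"]
    show "((\<lambda>y. case case (n, y) of (n, d) \<Rightarrow> (d, n div d) of (d, k) \<Rightarrow> f d * g k) has_sum (\<Sum>d | d dvd n. f d * g (n div d))) {d. d dvd n}"
      by simp
  qed
  moreover have "(\<Sum>d | d dvd n. f d * g (n div d)) = l n" if n: "n \<in> A" for n
  proof -
    have "f d * g (n div d) = mangoldt d * of_nat n powr (-s)" if dn: "d dvd n" for d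
    proof -
      obtain k where k: "n = d * k" using dn by (rule dvdE)
      hence "d > 0" using n by (auto simp: A_def)
      hence "(of_nat n :: complex) powr (-s) = of_nat d powr (-s) * of_nat k powr (-s)"
        unfolding k of_nat_mult by (intro powr_times_real) auto
      moreover have "n div d = k" using k \<open>d > 0\<close> by simp
      ultimately show ?thesis by (simp add: f_def g_def)
    qed
    hence "(\<Sum>d | d dvd n. f d * g (n div d)) = (\<Sum>d | d dvd n. mangoldt d) * of_nat n powr (-s)"
      by (simp add: sum_distrib_right)
    thus ?thesis using n mangoldt_sum[of n, where 'a = complex] by (simp add: l_def A_def)
  qed
  ultimately have "(l has_sum (mangoldt_series s * zeta_series s)) A"
    by (simp cong: has_sum_cong)
  hence "mangoldt_series s * zeta_series s = (\<Sum>n. l n)" using hl by (rule has_sum_unique)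
  thus ?thesis by (simp add: l_def)
qed

text \<open>The identity for zeta'/zeta multiplied by \<open>(s - 1) * zeta_entire s\<close>. In
  this form it holds at possible zeros as well, so that it can be used to exclude them.\<close>

lemma deriv_zeta_entire:
  assumes s: "Re s > 1"
  shows "(s - 1) * deriv zeta_entire s = zeta_entire s * (1 - (s - 1) * mangoldt_series s)"
proof -
  have d: "(zeta_series has_field_derivative - (mangoldt_series s * zeta_series s)) (at s)"
    using deriv_zeta_series[OF s] zeta_times_mangoldt[OF s] by simp
  have "((\<lambda>s. (s - 1) * zeta_series s) has_field_derivative
      (zeta_series s + (s - 1) * (- (mangoldt_series s * zeta_series s)))) (at s)"
    by (rule derivative_eq_intros d refl)+ simp
  hence "(zeta_entire has_field_derivative
      (zeta_series s + (s - 1) * (- (mangoldt_series s * zeta_series s)))) (at s)"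
    by (rule has_field_derivative_transform_within_open[where S = "{s. Re s > 1}"])
       (use s in \<open>auto simp: open_Re_gt zeta_entire_eq\<close>)
  hence dd: "deriv zeta_entire s = zeta_series s + (s - 1) * (- (mangoldt_series s * zeta_series s))"
    by (rule DERIV_imp_deriv)
  show ?thesis unfolding dd zeta_entire_eq[OF s] by (simp add: algebra_simps)
qed

text \<open>\<open>m\<close> is the order of vanishing of \<open>f\<close> at \<open>z0\<close>, and
  the limit is the residue of the logarithmic derivative. The point \<open>w\<close> ensures that
  \<open>f\<close> is not identically zero.\<close>

lemma tendsto_logderiv:
  assumes f: "f holomorphic_on S" "open S" "connected S" and z0: "z0 \<in> S" and w: "w \<in> S" "f w \<noteq> 0"
  obtains m :: nat where "((\<lambda>z. (z - z0) * deriv f z / f z) \<longlongrightarrow> of_nat m) (at z0)"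
    "f z0 = 0 \<longrightarrow> m > 0" "eventually (\<lambda>z. f z \<noteq> 0) (at z0)"
proof -
  define n where "n = nat (zorder f z0)"
  define p where "p = zor_poly f z0"
  have z: "(if f z0 = 0 then 0 < zorder f z0 else zorder f z0 = 0) \<and>
     (\<exists>r>0. cball z0 r \<subseteq> S \<and> zor_poly f z0 holomorphic_on cball z0 r \<and>
            (\<forall>w\<in>cball z0 r. f w = zor_poly f z0 w * (w - z0) ^ nat (zorder f z0) \<and> zor_poly f z0 w \<noteq> 0))"
    by (rule zorder_exist_zero[OF f z0]) (use w in blast)
  then obtain r where r: "r > 0" and p: "p holomorphic_on cball z0 r"
    and fp: "\<And>w. w \<in> cball z0 r \<Longrightarrow> f w = p w * (w - z0) ^ n" "\<And>w. w \<in> cball z0 r \<Longrightarrow> p w \<noteq> 0"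
    unfolding n_def p_def by blast
  have p': "p holomorphic_on ball z0 r" using p by (rule holomorphic_on_subset) auto
  have ev: "eventually (\<lambda>z. z \<in> ball z0 r \<and> z \<noteq> z0) (at z0)"
    using r by (auto simp: eventually_at dist_commute intro!: exI[of _ r])
  have eq: "(z - z0) * deriv p z / p z + of_nat n = (z - z0) * deriv f z / f z" if "z \<in> ball z0 r \<and> z \<noteq> z0" for z
  proof -
    have pz: "(p has_field_derivative deriv p z) (at z)"
      using p' that holomorphic_derivI[of p "ball z0 r" z UNIV] by auto
    have "((\<lambda>w. (w - z0) ^ n) has_field_derivative of_nat n * (z - z0) ^ (n - 1)) (at z)"
      by (auto intro!: derivative_eq_intros)
    from DERIV_mult[OF pz this]
    have "(f has_field_derivative (deriv p z * (z - z0) ^ n + of_nat n * (z - z0) ^ (n - 1) * p z)) (at z)"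
      by (rule has_field_derivative_transform_within_open[where S = "ball z0 r"]) (use that fp(1) in auto)
    hence d: "deriv f z = deriv p z * (z - z0) ^ n + of_nat n * (z - z0) ^ (n - 1) * p z"
      by (rule DERIV_imp_deriv)
    have "(z - z0) * (of_nat n * (z - z0) ^ (n - 1) * p z) = of_nat n * (z - z0) ^ n * p z"
      by (cases n) auto
    hence "(z - z0) * deriv f z = (z - z0) * deriv p z * (z - z0) ^ n + of_nat n * (z - z0) ^ n * p z"
      unfolding d by (simp add: distrib_left)
    thus ?thesis using fp[of z] that by (simp add: add_divide_distrib)
  qed
  have "isCont (deriv p) z0"
    using holomorphic_deriv[OF p'] r holomorphic_on_imp_continuous_on[THEN continuous_on_interior] by force
  moreover have "isCont p z0"
    using p' r holomorphic_on_imp_continuous_on[THEN continuous_on_interior] by force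
  ultimately have "((\<lambda>z. (z - z0) * deriv p z / p z + of_nat n) \<longlongrightarrow> (z0 - z0) * deriv p z0 / p z0 + of_nat n) (at z0)"
    using fp(2)[of z0] r by (intro tendsto_intros) (auto simp: isCont_def)
  hence "((\<lambda>z. (z - z0) * deriv f z / f z) \<longlongrightarrow> of_nat n) (at z0)"
    using Lim_transform_eventually[OF _ eventually_mono[OF ev eq]] by simp
  moreover have "f z0 = 0 \<longrightarrow> n > 0" using z by (auto simp: n_def split: if_splits)
  moreover have "eventually (\<lambda>z. f z \<noteq> 0) (at z0)"
    using ev by (rule eventually_mono) (use fp in auto)
  ultimately show ?thesis using that by blast
qed

lemma zeta_entire_logderiv:
  assumes "Re z0 > 0"
  obtains m :: nat where "((\<lambda>z. (z - z0) * deriv zeta_entire z / zeta_entire z) \<longlongrightarrow> of_nat m) (at z0)"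
    "zeta_entire z0 = 0 \<longrightarrow> m > 0" "eventually (\<lambda>z. zeta_entire z \<noteq> 0) (at z0)"
proof -
  have "connected {s. Re s > 0}" by (intro convex_connected convex_halfspace_Re_gt)
  from tendsto_logderiv[OF holomorphic_zeta_entire open_Re_gt this, of z0 1] assms that
  show ?thesis by (auto simp: zeta_entire_1)
qed

text \<open>At a zero the logarithmic derivative would have a positive residue, but nearby it equals
  1 / (s - 1) minus the von Mangoldt series, which is continuous for Re s > 1. No Euler product is
  involved.\<close>

lemma zeta_entire_nonzero_gt_1:
  assumes s: "Re s0 > 1"
  shows "zeta_entire s0 \<noteq> 0"
proof
  assume 0: "zeta_entire s0 = 0"
  have "Re s0 > 0" using s by simp
  from zeta_entire_logderiv[OF this] obtain m :: nat where
    m: "((\<lambda>z. (z - s0) * deriv zeta_entire z / zeta_entire z) \<longlongrightarrow> of_nat m) (at s0)"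
    "m > 0" "eventually (\<lambda>z. zeta_entire z \<noteq> 0) (at s0)" using 0 by metis
  have s1: "s0 \<noteq> 1" using s by auto
  have "isCont mangoldt_series s0"
    using holomorphic_on_imp_continuous_on[OF holomorphic_mangoldt_series] s open_Re_gt[of 1]
    by (auto simp: continuous_on_eq_continuous_at)
  hence "((\<lambda>z. (z - s0) * (1 / (z - 1) - mangoldt_series z)) \<longlongrightarrow> (s0 - s0) * (1 / (s0 - 1) - mangoldt_series s0)) (at s0)"
    using s1 by (intro tendsto_intros) (auto simp: isCont_def)
  moreover have "eventually (\<lambda>z. z \<in> {s. Re s > 1} - {1}) (at s0)"
    using s s1 by (intro eventually_at_in_open') (auto intro!: open_delete open_Re_gt)
  hence "eventually (\<lambda>z. (z - s0) * (1 / (z - 1) - mangoldt_series z) = (z - s0) * deriv zeta_entire z / zeta_entire z) (at s0)"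
    using m(3)
  proof eventually_elim
    case (elim z)
    have "deriv zeta_entire z = zeta_entire z * (1 / (z - 1) - mangoldt_series z)"
    proof -
      have alg: "w \<noteq> 0 \<Longrightarrow> w * d = Z * (1 - w * D) \<Longrightarrow> d = Z * (1 / w - D)" for w d Z D :: complex
        by (simp add: field_simps)
      have "z - 1 \<noteq> 0" using elim by auto
      thus ?thesis using elim by (intro alg deriv_zeta_entire) auto
    qed
    thus ?case using elim by simp
  qed
  ultimately have "((\<lambda>z. (z - s0) * deriv zeta_entire z / zeta_entire z) \<longlongrightarrow> 0) (at s0)"
    using Lim_transform_eventually by fastforce
  with m(1) have "of_nat m = (0::complex)" by (rule tendsto_unique[OF at_neq_bot])
  thus False using m(2) by simp
qed

lemma mangoldt_series_eq:
  assumes s: "Re s > 1"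
  shows "mangoldt_series s = 1 / (s - 1) - deriv zeta_entire s / zeta_entire s"
proof -
  have "s - 1 \<noteq> 0" using s by auto
  thus ?thesis using deriv_zeta_entire[OF s] zeta_entire_nonzero_gt_1[OF s] by (simp add: field_simps)
qed

text \<open>The limit is the residue of the von Mangoldt series at 1 + it: 1 for the pole of zeta at
  t = 0, minus the order \<open>m\<close> of the zero of \<open>zeta_entire\<close>.\<close>

lemma mangoldt_series_near_line:
  fixes t :: real
  obtains m :: nat where "((\<lambda>e. Re (of_real e * mangoldt_series (1 + \<i> * of_real t + of_real e))) \<longlongrightarrow> (if t = 0 then 1 else 0) - real m) (at_right 0)"
     "zeta_entire (1 + \<i> * of_real t) = 0 \<longrightarrow> m > 0" "t = 0 \<longrightarrow> m = 0"
proof -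
  define s0 where "s0 = 1 + \<i> * of_real t"
  have "Re s0 > 0" by (simp add: s0_def)
  from zeta_entire_logderiv[OF this] obtain m :: nat where
    m: "((\<lambda>z. (z - s0) * deriv zeta_entire z / zeta_entire z) \<longlongrightarrow> of_nat m) (at s0)"
    "zeta_entire s0 = 0 \<longrightarrow> m > 0" by blast
  have fl: "filterlim (\<lambda>e::real. s0 + of_real e) (at s0) (at_right 0)"
  proof (rule filterlim_atI)
    have "((\<lambda>e::real. s0 + of_real e) \<longlongrightarrow> s0 + of_real 0) (at_right 0)" by (intro tendsto_intros)
    thus "((\<lambda>e::real. s0 + of_real e) \<longlongrightarrow> s0) (at_right 0)" by simp
    show "\<forall>\<^sub>F e in at_right (0::real). s0 + complex_of_real e \<noteq> s0"
      by (auto simp: eventually_at_right_less intro: eventually_mono[OF eventually_at_right_less])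
  qed
  have A: "((\<lambda>e. of_real e * (deriv zeta_entire (s0 + of_real e) / zeta_entire (s0 + of_real e))) \<longlongrightarrow> of_nat m) (at_right 0)"
    using filterlim_compose[OF m(1) fl] by (simp add: add_diff_eq)
  have B: "((\<lambda>e::real. of_real e * (1 / (s0 + of_real e - 1))) \<longlongrightarrow> (if t = 0 then 1 else 0 :: complex)) (at_right 0)"
  proof (cases "t = 0")
    case True
    have "\<forall>\<^sub>F e in at_right (0::real). 1 = of_real e * (1 / (s0 + of_real e - 1))"
      using eventually_at_right_less[of "0::real"] by eventually_elim (auto simp: s0_def True)
    from Lim_transform_eventually[OF tendsto_const this] show ?thesis using True by simp
  next
    case False
    have "((\<lambda>e::real. of_real e * (1 / (s0 + of_real e - 1))) \<longlongrightarrow> of_real 0 * (1 / (s0 + of_real 0 - 1))) (at_right 0)"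
      using False by (intro tendsto_intros) (auto simp: s0_def)
    thus ?thesis using False by simp
  qed
  have "((\<lambda>e::real. of_real e * (1 / (s0 + of_real e - 1)) - of_real e * (deriv zeta_entire (s0 + of_real e) / zeta_entire (s0 + of_real e)))
     \<longlongrightarrow> (if t = 0 then 1 else 0) - of_nat m) (at_right 0)"
    by (intro tendsto_diff A B)
  moreover have "\<forall>\<^sub>F e in at_right (0::real). of_real e * (1 / (s0 + of_real e - 1)) - of_real e * (deriv zeta_entire (s0 + of_real e) / zeta_entire (s0 + of_real e))
      = of_real e * mangoldt_series (s0 + of_real e)"
    using eventually_at_right_less[of "0::real"]
    by eventually_elim (simp add: mangoldt_series_eq s0_def right_diff_distrib)
  ultimately have C: "((\<lambda>e. of_real e * mangoldt_series (s0 + of_real e)) \<longlongrightarrow> (if t = 0 then 1 else 0) - of_nat m) (at_right 0)"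
    by (rule Lim_transform_eventually)
  have "t = 0 \<longrightarrow> m = 0"
  proof
    assume t: "t = 0"
    have "s0 = 1" by (simp add: s0_def t)
    have "open {s. Re s > 0}" by (rule open_Re_gt)
    have "isCont (deriv zeta_entire) s0" "isCont zeta_entire s0"
      using holomorphic_on_imp_continuous_on[OF holomorphic_zeta_entire]
        holomorphic_on_imp_continuous_on[OF holomorphic_deriv[OF holomorphic_zeta_entire open_Re_gt]] open_Re_gt[of 0]
      by (auto simp: continuous_on_eq_continuous_at s0_def)
    hence "((\<lambda>z. (z - s0) * deriv zeta_entire z / zeta_entire z) \<longlongrightarrow> (s0 - s0) * deriv zeta_entire s0 / zeta_entire s0) (at s0)"
      using \<open>s0 = 1\<close> zeta_entire_1 by (intro tendsto_intros) (auto simp: isCont_def)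
    from tendsto_unique[OF at_neq_bot m(1) this] show "m = 0" by simp
  qed
  moreover have "((\<lambda>e. Re (of_real e * mangoldt_series (s0 + of_real e))) \<longlongrightarrow> Re ((if t = 0 then 1 else 0) - of_nat m)) (at_right 0)"
    by (intro tendsto_Re C)
  hence "((\<lambda>e. Re (of_real e * mangoldt_series (s0 + of_real e))) \<longlongrightarrow> (if t = 0 then 1 else 0) - real m) (at_right 0)"
    by (cases "t = 0") auto
  ultimately show ?thesis using that m(2) unfolding s0_def by blast
qed

text \<open>The inequality of de la Vallee Poussin: termwise, 3 + 4 cos a + cos 2a = 2 (1 + cos
  a)^2.\<close>

lemma mangoldt_series_341:
  fixes e t :: real
  assumes e: "e > 0"
  shows "3 * Re (mangoldt_series (1 + of_real e)) + 4 * Re (mangoldt_series (1 + \<i> * of_real t + of_real e))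
     + Re (mangoldt_series (1 + \<i> * of_real (2 * t) + of_real e)) \<ge> 0"
proof -
  define T where "T = (\<lambda>t n. mangoldt n * real n powr (-(1 + e)) * cos (t * ln (real n)))"
  have sums: "T u sums Re (mangoldt_series (1 + \<i> * of_real u + of_real e))" for u :: real
  proof -
    let ?s = "1 + \<i> * of_real u + of_real e :: complex"
    have "Re ?s > 1" using e by simp
    hence "(\<lambda>n. mangoldt n * of_nat n powr (- ?s)) sums mangoldt_series ?s"
      unfolding mangoldt_series_def by (intro summable_sums summable_norm_cancel[OF summable_mangoldt_series])
    hence "(\<lambda>n. Re (mangoldt n * of_nat n powr (- ?s))) sums Re (mangoldt_series ?s)"
      by (rule sums_Re)
    moreover have "Re (mangoldt n * of_nat n powr (- ?s)) = T u n" for n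
    proof (cases "n = 0")
      case False
      have "Re ((of_nat n :: complex) powr (- ?s)) = real n powr (-(1 + e)) * cos (u * ln (real n))"
        using False by (simp add: powr_def Re_exp Ln_of_nat mult.commute)
      thus ?thesis
        by (simp only: times_complex.sel Re_mangoldt Im_mangoldt T_def)
    qed (simp add: T_def)
    ultimately show ?thesis by simp
  qed
  have S: "(\<lambda>n. 3 * T 0 n + 4 * T t n + T (2 * t) n) sums
    (3 * Re (mangoldt_series (1 + of_real e)) + 4 * Re (mangoldt_series (1 + \<i> * of_real t + of_real e))
     + Re (mangoldt_series (1 + \<i> * of_real (2 * t) + of_real e)))"
    using sums[of 0] by (intro sums_add sums_mult sums) simp_all
  have "3 * T 0 n + 4 * T t n + T (2 * t) n \<ge> 0" for n
  proof -
    define c where "c = cos (t * ln (real n))"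
    define a where "a = mangoldt n * real n powr (-(1 + e))"
    have c2: "cos (2 * t * ln (real n)) = 2 * c ^ 2 - 1"
      unfolding c_def using cos_double_cos[of "t * ln (real n)"] by (simp add: mult.assoc)
    have "T 0 n = a" by (simp add: T_def a_def)
    moreover have "T t n = a * c" unfolding T_def a_def c_def ..
    moreover have "T (2 * t) n = a * (2 * c ^ 2 - 1)" unfolding T_def a_def c2 ..
    ultimately have "3 * T 0 n + 4 * T t n + T (2 * t) n = a * (2 * (1 + c) ^ 2)"
      by (simp add: power2_eq_square algebra_simps)
    thus ?thesis by (simp add: a_def mangoldt_nonneg)
  qed
  thus ?thesis by (rule sums_le[OF _ sums_zero S])
qed

text \<open>Multiplying the 3-4-1 inequality by e and letting e tend to 0 gives
  \<open>3 - 4 * m1 - m2 \<ge> 0\<close> for the orders at 1 + it and 1 + 2it, which is impossible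
  if \<open>m1 \<ge> 1\<close>.\<close>

theorem zeta_entire_nonzero:
  assumes s: "Re s \<ge> 1"
  shows "zeta_entire s \<noteq> 0"
proof (cases "Re s > 1")
  case False
  define t where "t = Im s"
  have st: "s = 1 + \<i> * of_real t" using False s by (simp add: complex_eq_iff t_def)
  show ?thesis
  proof
    assume 0: "zeta_entire s = 0"
    hence t0: "t \<noteq> 0" using zeta_entire_1 by (auto simp: st)
    obtain m0 where m0: "((\<lambda>e. Re (of_real e * mangoldt_series (1 + \<i> * of_real 0 + of_real e))) \<longlongrightarrow> 1 - real m0) (at_right 0)" "m0 = 0"
      by (rule mangoldt_series_near_line[of 0]) auto
    obtain m1 where m1: "((\<lambda>e. Re (of_real e * mangoldt_series (1 + \<i> * of_real t + of_real e))) \<longlongrightarrow> 0 - real m1) (at_right 0)" "m1 > 0"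
      by (rule mangoldt_series_near_line[of t]) (use t0 0 st in auto)
    obtain m2 where m2: "((\<lambda>e. Re (of_real e * mangoldt_series (1 + \<i> * of_real (2 * t) + of_real e))) \<longlongrightarrow> 0 - real m2) (at_right 0)"
      by (rule mangoldt_series_near_line[of "2 * t"]) (use t0 in auto)
    have lim: "((\<lambda>e. 3 * Re (of_real e * mangoldt_series (1 + \<i> * of_real 0 + of_real e))
        + 4 * Re (of_real e * mangoldt_series (1 + \<i> * of_real t + of_real e))
        + Re (of_real e * mangoldt_series (1 + \<i> * of_real (2 * t) + of_real e)))
       \<longlongrightarrow> 3 * (1 - real m0) + 4 * (0 - real m1) + (0 - real m2)) (at_right 0)"
      by (intro tendsto_intros m0 m1 m2)
    have "\<forall>\<^sub>F e in at_right (0::real). 0 \<le> 3 * Re (of_real e * mangoldt_series (1 + \<i> * of_real 0 + of_real e))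
        + 4 * Re (of_real e * mangoldt_series (1 + \<i> * of_real t + of_real e))
        + Re (of_real e * mangoldt_series (1 + \<i> * of_real (2 * t) + of_real e))"
      using eventually_at_right_less[of "0::real"]
    proof eventually_elim
      case (elim e)
      have "0 \<le> e * (3 * Re (mangoldt_series (1 + of_real e)) + 4 * Re (mangoldt_series (1 + \<i> * of_real t + of_real e))
         + Re (mangoldt_series (1 + \<i> * of_real (2 * t) + of_real e)))"
        using elim mangoldt_series_341[OF elim, of t] by (intro mult_nonneg_nonneg) auto
      thus ?case by (simp add: algebra_simps)
    qed
    from tendsto_lowerbound[OF lim this]
    have "0 \<le> 3 * (1 - real m0) + 4 * (0 - real m1) + (0 - real m2)" by simp
    thus False using m0(2) m1(2) by simp
  qed
qed (use zeta_entire_nonzero_gt_1 in auto)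

section \<open>The prime number theorem\<close>

definition chebyshev_psi :: "nat \<Rightarrow> real" where
  "chebyshev_psi n = (\<Sum>k\<le>n. mangoldt k)"

lemma chebyshev_psi_0: "chebyshev_psi 0 = 0"
  and chebyshev_psi_Suc: "chebyshev_psi (Suc n) = chebyshev_psi n + mangoldt (Suc n)"
  by (simp_all add: chebyshev_psi_def)

lemma chebyshev_psi_nonneg: "chebyshev_psi n \<ge> 0"
  unfolding chebyshev_psi_def by (intro sum_nonneg mangoldt_nonneg)

lemma chebyshev_psi_mono: "m \<le> n \<Longrightarrow> chebyshev_psi m \<le> chebyshev_psi n"
  unfolding chebyshev_psi_def by (intro sum_mono2 mangoldt_nonneg) auto

text \<open>From n to n + 1 the quotient \<open>n div d\<close> grows by one exactly for the
  divisors d of n + 1, whose weights add up to ln (n + 1).\<close>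

lemma ln_fact_eq_sum_mangoldt: "ln (fact n) = (\<Sum>d=1..n. mangoldt d * real (n div d))"
proof (induction n)
  case (Suc n)
  have "(\<Sum>d=1..Suc n. mangoldt d * real (Suc n div d)) =
      (\<Sum>d=1..Suc n. mangoldt d * real (n div d) + (if d dvd Suc n then mangoldt d else 0))"
    by (intro sum.cong refl) (auto simp: div_Suc dvd_eq_mod_eq_0 algebra_simps)
  also have "\<dots> = (\<Sum>d=1..n. mangoldt d * real (n div d)) + (\<Sum>d\<in>{1..Suc n}. if d dvd Suc n then mangoldt d else 0)"
    by (simp add: sum.distrib)
  also have "(\<Sum>d\<in>{1..Suc n}. if d dvd Suc n then mangoldt d else 0) = (\<Sum>d | d dvd Suc n. mangoldt d)"
    by (intro sum.mono_neutral_cong_right) (auto simp: Suc_le_eq intro!: Nat.gr0I dvd_imp_le)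
  also have "\<dots> = ln (real (Suc n))"
    using mangoldt_sum[of "Suc n", where 'a = real] by simp
  also have "(\<Sum>d=1..n. mangoldt d * real (n div d)) + ln (real (Suc n)) = ln (fact (Suc n))"
    unfolding fact_Suc Suc.IH[symmetric] by (subst ln_mult) (auto simp: algebra_simps)
  finally show ?case by simp
qed simp

text \<open>Chebyshev's argument: in the logarithm of the central binomial coefficient d has the
  coefficient \<open>2 * n div d - 2 * (n div d)\<close>, which is never negative and is at least 1
  for n < d, d up to 2n.\<close>

lemma chebyshev_psi_double: "chebyshev_psi (2 * n) - chebyshev_psi n \<le> 2 * ln 2 * real n"
proof -
  have "chebyshev_psi (2 * n) - chebyshev_psi n = (\<Sum>d=n+1..2*n. mangoldt d)"
  proof -
    have "{..2 * n} = {..n} \<union> {n+1..2*n}" by auto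
    thus ?thesis unfolding chebyshev_psi_def by (simp add: sum.union_disjoint)
  qed
  also have "\<dots> \<le> (\<Sum>d=n+1..2*n. mangoldt d * (real (2 * n div d) - 2 * real (n div d)))"
  proof (intro sum_mono)
    fix d assume d: "d \<in> {n+1..2*n}"
    have "2 * n div d \<ge> 1" using d div_greater_zero_iff[of "2*n" d] by simp
    moreover have "n div d = 0" using d by simp
    ultimately show "mangoldt d \<le> mangoldt d * (real (2 * n div d) - 2 * real (n div d))"
      using mult_left_mono[of 1 "real (2 * n div d)" "mangoldt d"] by (simp add: mangoldt_nonneg)
  qed
  also have "\<dots> \<le> (\<Sum>d=1..2*n. mangoldt d * (real (2 * n div d) - 2 * real (n div d)))"
  proof (intro sum_mono2)
    fix d assume "d \<in> {1..2*n} - {n+1..2*n}"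
    have "2 * (n div d) \<le> 2 * n div d"
      by (metis div_times_less_eq_dividend mult.commute mult.left_commute less_eq_div_iff_mult_less_eq mult_le_mono2 div_by_0 mult_0_right bot_nat_0.not_eq_extremum le0)
    hence "2 * real (n div d) \<le> real (2 * n div d)" by linarith
    thus "0 \<le> mangoldt d * (real (2 * n div d) - 2 * real (n div d))"
      by (intro mult_nonneg_nonneg mangoldt_nonneg) auto
  qed auto
  also have "\<dots> = ln (fact (2 * n)) - 2 * ln (fact n)"
  proof -
    have "(\<Sum>d=1..2*n. mangoldt d * real (n div d)) = (\<Sum>d=1..n. mangoldt d * real (n div d))"
      by (intro sum.mono_neutral_right) auto
    moreover have "(\<Sum>d=1..2*n. mangoldt d * (real (2 * n div d) - 2 * real (n div d)))
        = (\<Sum>d=1..2*n. mangoldt d * real (2 * n div d)) - 2 * (\<Sum>d=1..2*n. mangoldt d * real (n div d))"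
      by (simp add: sum_subtractf sum_distrib_left algebra_simps)
    ultimately show ?thesis unfolding ln_fact_eq_sum_mangoldt by simp
  qed
  also have "\<dots> = ln (real (2 * n choose n))"
  proof -
    have "real (2 * n choose n) = fact (2 * n) / (fact n * fact n)"
      by (subst binomial_fact) auto
    thus ?thesis by (simp add: ln_div ln_mult)
  qed
  also have "\<dots> \<le> ln (2 ^ (2 * n))"
  proof -
    have "real (2 * n choose n) \<le> 2 ^ (2 * n)"
      using binomial_le_pow2[of "2 * n" n] by (metis of_nat_le_iff of_nat_power of_nat_numeral)
    thus ?thesis by (subst ln_le_cancel_iff) auto
  qed
  also have "\<dots> = 2 * ln 2 * real n" by (simp add: ln_realpow)
  finally show ?thesis .
qed

text \<open>Halving n gives psi(2m) at most 6 m ln 2 out of the 8 m ln 2 allowed, and the slack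
  absorbs the one additional term (2m + 1) ln 2 for odd n. The linear bound provides the bounded
  coefficients that the Tauberian theorem asks for.\<close>

lemma chebyshev_psi_le: "chebyshev_psi n \<le> 4 * ln 2 * real n"
proof (induction n rule: less_induct)
  case (less n)
  show ?case
  proof (cases "n = 0")
    case False
    define m where "m = n div 2"
    have IH: "chebyshev_psi m \<le> 4 * ln 2 * real m" using less[of m] False by (simp add: m_def)
    hence 1: "chebyshev_psi (2 * m) \<le> 6 * ln 2 * real m" using chebyshev_psi_double[of m] by simp
    show ?thesis
    proof (cases "even n")
      case True
      hence n: "n = 2 * m" by (simp add: m_def)
      have "0 \<le> ln 2 * real m" by simp
      hence "6 * ln 2 * real m \<le> 4 * ln 2 * real n" unfolding n of_nat_mult by linarith
      thus ?thesis using 1 unfolding n by linarith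
    next
      case False
      hence n: "n = Suc (2 * m)" by (simp add: m_def)
      have "mangoldt (Suc (2 * m)) \<le> ln (real (Suc (2 * m)))" by (rule mangoldt_le) simp
      also have "\<dots> \<le> ln (2 ^ (2 * m + 1))"
      proof -
        have "Suc (2 * m) \<le> 2 ^ (2 * m + 1)" using less_exp[of "2 * m + 1"] by simp
        hence "real (Suc (2 * m)) \<le> 2 ^ (2 * m + 1)" by (metis of_nat_le_iff of_nat_power of_nat_numeral)
        thus ?thesis by (subst ln_le_cancel_iff) auto
      qed
      also have "\<dots> = (2 * real m + 1) * ln 2" by (subst ln_realpow) (auto simp: algebra_simps)
      finally have "mangoldt (Suc (2 * m)) \<le> (2 * real m + 1) * ln 2" .
      moreover have "(2 * real m + 1) * ln 2 + 6 * ln 2 * real m \<le> 4 * ln 2 * real n"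
        by (simp add: n algebra_simps)
      ultimately show ?thesis using 1 unfolding n chebyshev_psi_Suc by linarith
    qed
  qed (simp add: chebyshev_psi_0)
qed

text \<open>
  The error made in partial summation when the differences \<open>n powr -s - (n + 1) powr -s\<close> are replaced
  by \<open>s * n powr (-s - 1)\<close>. It is holomorphic beyond the line \<open>Re s = 1\<close>.
\<close>

definition psi_correction :: "complex \<Rightarrow> complex" where
  "psi_correction s = (\<Sum>n. of_real (chebyshev_psi n) * zeta_term n (s + 1))"

lemma psi_zeta_term_locally_bounded:
  assumes x: "Re x > 0"
  shows "\<exists>M. summable M \<and> (\<forall>n. \<forall>y\<in>cball x (Re x / 2). Re y > 0 \<and>
     norm (of_real (chebyshev_psi n) * zeta_term n (y + 1)) \<le> M n)"
proof -
  have "Re (x + 1) > 1" using x by simp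
  moreover have "(Re (x + 1) - 1) / 2 = Re x / 2" "(Re (x + 1) + 1) / 2 = Re x / 2 + 1"
    by (simp_all add: field_simps)
  ultimately obtain C where C:
    "\<forall>n. \<forall>y\<in>cball (x + 1) (Re x / 2). Re y \<ge> Re x / 2 + 1 \<and>
      norm (zeta_term n y) \<le> C * real n powr (- (Re x / 2 + 1) - 1) + (if n = 0 then 1 else 0)"
    using zeta_term_locally_bounded[of 1 "x + 1"] by (simp only: zero_le_one) blast
  define M where "M = (\<lambda>n. 4 * ln 2 * C * real n powr (- (Re x / 2) - 1))"
  have "summable M" unfolding M_def using x by (intro summable_mult) (simp add: summable_real_powr_iff)
  moreover have "Re y > 0 \<and> norm (of_real (chebyshev_psi n) * zeta_term n (y + 1)) \<le> M n"
    if "y \<in> cball x (Re x / 2)" for n y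
  proof
    have y: "y + 1 \<in> cball (x + 1) (Re x / 2)" using that by (simp add: dist_norm)
    show "Re y > 0" using C y x by fastforce
    show "norm (of_real (chebyshev_psi n) * zeta_term n (y + 1)) \<le> M n"
    proof (cases "n = 0")
      case False
      have zt: "norm (zeta_term n (y + 1)) \<le> C * real n powr (- (Re x / 2 + 1) - 1)"
        using C[rule_format, OF y, of n] False by simp
      have "norm (of_real (chebyshev_psi n) * zeta_term n (y + 1)) \<le> (4 * ln 2 * real n) * (C * real n powr (- (Re x / 2 + 1) - 1))"
        unfolding norm_mult using zt chebyshev_psi_le[of n] chebyshev_psi_nonneg[of n]
        by (intro mult_mono) auto
      also have "real n powr (- (Re x / 2 + 1) - 1) = real n powr (- (Re x / 2) - 1) / real n"
      proof -
        have e: "- (Re x / 2 + 1) - 1 = (- (Re x / 2) - 1) - 1" by simp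
        show ?thesis by (subst e, subst powr_diff) simp
      qed
      finally show ?thesis using False by (simp add: M_def)
    qed (simp add: chebyshev_psi_0 M_def)
  qed
  ultimately show ?thesis by blast
qed

lemma holomorphic_psi_correction: "psi_correction holomorphic_on {s. Re s > 0}"
  unfolding psi_correction_def
proof (rule holomorphic_on_suminf)
  fix x assume x: "x \<in> {s. Re s > 0}"
  hence "Re x > 0" by simp
  from psi_zeta_term_locally_bounded[OF this] obtain M where M: "summable M"
    "\<And>n y. y \<in> cball x (Re x / 2) \<Longrightarrow> Re y > 0 \<and> norm (of_real (chebyshev_psi n) * zeta_term n (y + 1)) \<le> M n" by blast
  show "\<exists>d>0. \<exists>M. cball x d \<subseteq> {s. Re s > 0} \<and> summable M \<and>
      (\<forall>n. \<forall>y\<in>cball x d. norm (of_real (chebyshev_psi n) * zeta_term n (y + 1)) \<le> M n)"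
  proof (intro exI[of _ "Re x / 2"] exI[of _ M] conjI allI ballI)
    show "cball x (Re x / 2) \<subseteq> {s. Re s > 0}" using M(2) by blast
  qed (use M x in auto)
next
  show "(\<lambda>s. of_real (chebyshev_psi n) * zeta_term n (s + 1)) holomorphic_on {s. Re s > 0}" for n
    unfolding zeta_term_def by (intro holomorphic_intros)
qed (rule open_Re_gt)

lemma sums_psi_correction:
  assumes s: "Re s > 0"
  shows "(\<lambda>n. of_real (chebyshev_psi n) * zeta_term n (s + 1)) sums psi_correction s"
proof -
  from psi_zeta_term_locally_bounded[OF s] obtain M where M: "summable M"
    "\<And>n y. y \<in> cball s (Re s / 2) \<Longrightarrow> norm (of_real (chebyshev_psi n) * zeta_term n (y + 1)) \<le> M n" by blast
  have "summable (\<lambda>n. of_real (chebyshev_psi n) * zeta_term n (s + 1))"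
    using M(2)[of s] s by (intro summable_comparison_test'[OF M(1)]) auto
  thus ?thesis unfolding psi_correction_def by (rule summable_sums)
qed

text \<open>Summation by parts; the boundary term is O(N powr (1 - Re s)) by the linear bound for
  psi.\<close>

lemma sums_psi_difference:
  assumes s: "Re s > 1"
  shows "(\<lambda>n. of_real (chebyshev_psi n) * (of_nat n powr (-s) - of_nat (Suc n) powr (-s))) sums mangoldt_series s"
proof -
  have part: "(\<Sum>n\<le>N. of_real (chebyshev_psi n) * (of_nat n powr (-s) - of_nat (Suc n) powr (-s)))
     = (\<Sum>n\<le>N. mangoldt n * of_nat n powr (-s)) - of_real (chebyshev_psi N) * of_nat (Suc N) powr (-s)" for N
  proof (induction N)
    case (Suc N)
    thus ?case by (simp add: chebyshev_psi_Suc of_real_mangoldt algebra_simps del: of_nat_Suc)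
  qed (simp add: chebyshev_psi_0)
  have "(\<lambda>n. mangoldt n * of_nat n powr (-s)) sums mangoldt_series s"
    unfolding mangoldt_series_def by (intro summable_sums summable_norm_cancel[OF summable_mangoldt_series] s)
  hence 1: "(\<lambda>N. \<Sum>n\<le>N. mangoldt n * of_nat n powr (-s)) \<longlonglongrightarrow> mangoldt_series s" by (simp add: sums_def_le)
  have 2: "(\<lambda>N. of_real (chebyshev_psi N) * (of_nat (Suc N) :: complex) powr (-s)) \<longlonglongrightarrow> 0"
  proof (rule Lim_null_comparison)
    show "eventually (\<lambda>N. norm (of_real (chebyshev_psi N) * (of_nat (Suc N) :: complex) powr (-s)) \<le> 4 * ln 2 * real (Suc N) powr (1 - Re s)) sequentially"
    proof (rule always_eventually, rule allI)
      fix N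
      have "norm (of_real (chebyshev_psi N) * (of_nat (Suc N) :: complex) powr (-s)) \<le> (4 * ln 2 * real (Suc N)) * real (Suc N) powr (- Re s)"
        unfolding norm_mult norm_of_nat_powr norm_of_real using chebyshev_psi_le[of N] chebyshev_psi_nonneg[of N]
        by (intro mult_mono) (auto simp: algebra_simps intro: order_trans)
      also have "\<dots> = 4 * ln 2 * real (Suc N) powr (1 - Re s)"
        using powr_add[of "real (Suc N)" 1 "- Re s"] by (simp del: of_nat_Suc)
      finally show "norm (of_real (chebyshev_psi N) * (of_nat (Suc N) :: complex) powr (-s)) \<le> 4 * ln 2 * real (Suc N) powr (1 - Re s)" .
    qed
    have "(\<lambda>N. real (Suc N) powr (1 - Re s)) \<longlonglongrightarrow> 0"
      using s by (intro tendsto_neg_powr filterlim_compose[OF filterlim_real_sequentially filterlim_Suc]) auto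
    from tendsto_mult_right_zero[OF this] show "(\<lambda>N. 4 * ln 2 * real (Suc N) powr (1 - Re s)) \<longlonglongrightarrow> 0" by simp
  qed
  show ?thesis using tendsto_diff[OF 1 2] unfolding sums_def_le part by simp
qed

text \<open>Adding \<open>psi_correction\<close> turns the differences into
  \<open>s * n powr (-s-1)\<close>, and division by s leaves the coefficients psi(n) / n.
  Subtracting zeta makes them (psi(n) - n) / n and removes the pole at 1.\<close>

lemma sums_psi_minus_id:
  assumes s: "Re s > 1"
  shows "(\<lambda>n. of_real ((chebyshev_psi n - real n) / real n) * of_nat n powr (-s)) sums
     ((mangoldt_series s + psi_correction s) / s - zeta_series s)"
proof -
  have s0: "s \<noteq> 0" using s by auto
  have "Re s > 0" using s by simp
  note sums_add[OF sums_psi_difference[OF s] sums_psi_correction[OF this]]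
  moreover have "of_real (chebyshev_psi n) * (of_nat n powr (-s) - of_nat (Suc n) powr (-s))
      + of_real (chebyshev_psi n) * zeta_term n (s + 1) = of_real (chebyshev_psi n) * (s * of_nat n powr (-s-1))" for n
  proof -
    have "-(s + 1) = -s-1" "1 - (s + 1) = -s" by simp_all
    thus ?thesis by (simp only: zeta_term_def) (simp add: ring_distribs del: of_nat_Suc)
  qed
  ultimately have "(\<lambda>n. of_real (chebyshev_psi n) * (s * of_nat n powr (-s-1))) sums (mangoldt_series s + psi_correction s)"
    by (simp only:)
  hence 1: "(\<lambda>n. of_real (chebyshev_psi n) * (s * of_nat n powr (-s-1)) / s) sums ((mangoldt_series s + psi_correction s) / s)"
    by (rule sums_divide)
  have 2: "(\<lambda>n. of_nat n powr (-s)) sums zeta_series s"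
    unfolding zeta_series_def by (intro summable_sums summable_norm_cancel[OF summable_zeta_series] s)
  have "of_real (chebyshev_psi n) * (s * of_nat n powr (-s-1)) / s - of_nat n powr (-s)
      = of_real ((chebyshev_psi n - real n) / real n) * of_nat n powr (-s)" for n
  proof (cases "n = 0")
    case False
    have "(of_nat n :: complex) powr (-s-1) = of_nat n powr (-s) / of_nat n"
      using False by (simp add: powr_diff)
    thus ?thesis using s0 False by (simp add: field_simps)
  qed simp
  thus ?thesis using sums_diff[OF 1 2] by simp
qed

lemma summable_psi_minus_id: "summable (\<lambda>n. (chebyshev_psi n - real n) / real n ^ 2)"
proof -
  define Y where "Y = (\<lambda>s. if s = 1 then deriv zeta_entire 1 else (zeta_entire s - zeta_entire 1) / (s - 1))"
  \<comment> \<open>The continuation of the sum function across Re s = 1. Its two poles cancel: 1 /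
    ((s - 1) s) = 1 / (s - 1) - 1 / s, while \<open>zeta_series s = 1 / (s - 1) + Y s\<close>
    because \<open>zeta_entire 1 = 1\<close>.\<close>
  define F where "F = (\<lambda>s. - 1 / s - deriv zeta_entire s / (zeta_entire s * s) - Y s + psi_correction s / s)"
  define S where "S = {s. Re s > 0} \<inter> {s. zeta_entire s \<noteq> 0}"
  have Sopen: "open S"
  proof -
    have "S = {s. Re s > 0} \<inter> zeta_entire -` (- {0})" by (auto simp: S_def)
    thus ?thesis
      using continuous_open_preimage[OF holomorphic_on_imp_continuous_on[OF holomorphic_zeta_entire] open_Re_gt, of "- {0}"]
      by (simp add: open_Compl)
  qed
  have Y: "Y holomorphic_on {s. Re s > 0}"
    unfolding Y_def using holomorphic_zeta_entire open_Re_gt by (rule pole_lemma_open)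
  have F: "F holomorphic_on S"
    unfolding F_def
    by (intro holomorphic_intros holomorphic_on_subset[OF holomorphic_zeta_entire]
        holomorphic_on_subset[OF holomorphic_deriv[OF holomorphic_zeta_entire open_Re_gt]]
        holomorphic_on_subset[OF Y] holomorphic_on_subset[OF holomorphic_psi_correction]) (auto simp: S_def)
  have "(\<lambda>n. (of_real ((chebyshev_psi n - real n) / real n) :: complex) / of_nat n) sums F (1 + 0)"
  proof (rule newman_tauberian[where S = "(\<lambda>s. s - 1) ` S" and G = "\<lambda>z. F (1 + z)" and M = "4 * ln 2 + 1"])
    fix n
    show "norm (of_real ((chebyshev_psi n - real n) / real n) :: complex) \<le> 4 * ln 2 + 1"
    proof (cases "n = 0")
      case False
      have "\<bar>chebyshev_psi n - real n\<bar> \<le> (4 * ln 2 + 1) * real n"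
        using chebyshev_psi_le[of n] chebyshev_psi_nonneg[of n] by (simp add: abs_le_iff algebra_simps)
      thus ?thesis using False unfolding norm_of_real by (simp add: abs_divide pos_divide_le_eq)
    qed simp
  next
    have "(\<lambda>s. s - 1) ` S = (\<lambda>s. 1 + s) -` S"
    proof (intro Set.set_eqI iffI)
      fix x assume "x \<in> (\<lambda>s. 1 + s) -` S"
      thus "x \<in> (\<lambda>s. s - 1) ` S" by (intro image_eqI[of _ _ "1 + x"]) auto
    qed auto
    thus "open ((\<lambda>s. s - 1) ` S)" using Sopen by (auto intro!: open_vimage continuous_intros)
    show "{z. Re z \<ge> 0} \<subseteq> (\<lambda>s. s - 1) ` S"
    proof
      fix z :: complex assume "z \<in> {z. Re z \<ge> 0}"
      hence "1 + z \<in> S" using zeta_entire_nonzero[of "1 + z"] by (simp add: S_def)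
      thus "z \<in> (\<lambda>s. s - 1) ` S" by (rule rev_image_eqI) simp
    qed
    have "(F \<circ> (\<lambda>z. 1 + z)) holomorphic_on (\<lambda>s. s - 1) ` S"
      by (rule holomorphic_on_compose[OF _ holomorphic_on_subset[OF F]]) (auto intro!: holomorphic_intros)
    thus "(\<lambda>z. F (1 + z)) holomorphic_on (\<lambda>s. s - 1) ` S" by (simp add: o_def)
  next
    fix z :: complex assume z: "Re z > 0"
    define s where "s = 1 + z"
    have s: "Re s > 1" using z by (simp add: s_def)
    have s1: "s \<noteq> 1" "s \<noteq> 0" "s - 1 \<noteq> 0" using s by auto
    have "(mangoldt_series s + psi_correction s) / s - zeta_series s = F s"
    proof -
      have z: "zeta_series s = zeta_entire s / (s - 1)" using zeta_entire_eq[OF s] s1 by simp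
      have e: "1 / (s - 1) / s = 1 / (s - 1) - 1 / s" using s1 by (simp add: field_simps)
      have "(mangoldt_series s + psi_correction s) / s - zeta_series s =
         1 / (s - 1) / s - deriv zeta_entire s / zeta_entire s / s + psi_correction s / s - zeta_entire s / (s - 1)"
        unfolding mangoldt_series_eq[OF s] z by (simp add: add_divide_distrib diff_divide_distrib)
      also have "\<dots> = F s" unfolding e F_def Y_def using s1 zeta_entire_1
        by (simp add: diff_divide_distrib)
      finally show ?thesis .
    qed
    moreover have "- s = -1 - z" by (simp add: s_def)
    ultimately show "(\<lambda>n. of_real ((chebyshev_psi n - real n) / real n) * of_nat n powr (-1 - z)) sums F (1 + z)"
      using sums_psi_minus_id[OF s] unfolding s_def by metis
  qed
  hence "(\<lambda>n. Re (of_real ((chebyshev_psi n - real n) / real n) / of_nat n)) sums Re (F (1 + 0))"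
    by (rule sums_Re)
  moreover have "Re (of_real ((chebyshev_psi n - real n) / real n) / of_nat n) = (chebyshev_psi n - real n) / real n ^ 2" for n
  proof -
    have "(of_real ((chebyshev_psi n - real n) / real n) / of_nat n :: complex) = of_real ((chebyshev_psi n - real n) / real n ^ 2)"
      by (simp add: power2_eq_square)
    thus ?thesis by (simp only: Re_complex_of_real)
  qed
  ultimately have "(\<lambda>n. (chebyshev_psi n - real n) / real n ^ 2) sums Re (F (1 + 0))"
    by (simp only:)
  thus ?thesis by (rule sums_summable)
qed

text \<open>Monotonicity: an excess of e N at N persists as e N / 2 up to (1 + e / 2) N. There each
  term of the convergent series is at least e / (8 N), and there are at least e N / 4 of them once
  \<open>e * N \<ge> 4\<close>, so a block with sum at least e^2 / 32 would violate Cauchy's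
  criterion.\<close>

lemma psi_upper:
  assumes e: "0 < e" "e < 1"
  shows "eventually (\<lambda>N. chebyshev_psi N < (1 + e) * real N) sequentially"
proof -
  let ?b = "\<lambda>n. (chebyshev_psi n - real n) / real n ^ 2"
  obtain N0 where N0: "\<And>m n. m \<ge> N0 \<Longrightarrow> norm (sum ?b {m..<n}) < e ^ 2 / 32"
    using summable_psi_minus_id[unfolded summable_Cauchy, rule_format, of "e ^ 2 / 32"] e by auto
  show ?thesis
    unfolding eventually_sequentially
  proof (intro exI[of _ "max N0 (nat \<lceil>4 / e\<rceil> + 1)"] allI impI)
    fix N assume "max N0 (nat \<lceil>4 / e\<rceil> + 1) \<le> N"
    hence N: "N \<ge> N0" "real N \<ge> 4 / e" "N \<ge> 1" by linarith+
    show "chebyshev_psi N < (1 + e) * real N"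
    proof (rule ccontr)
      assume "\<not> ?thesis"
      hence big: "chebyshev_psi N \<ge> (1 + e) * real N" by simp
      define k where "k = nat \<lfloor>e * real N / 2\<rfloor>"
      have k: "real k \<le> e * real N / 2" "real k > e * real N / 2 - 1"
        using e N by (auto simp: k_def) linarith+
      have eN: "e * real N \<ge> 4" using N e by (simp add: field_simps)
      have kk: "real k \<ge> e * real N / 4" using k eN by linarith
      have "e / (8 * real N) \<le> ?b n" if n: "n \<in> {N..<N + k}" for n
      proof -
        have n1: "real n \<le> (1 + e / 2) * real N" using n k(1) by (simp add: algebra_simps)
        have n2: "real n \<le> 2 * real N"
          using n1 e mult_right_mono[of "1 + e / 2" 2 "real N"] by simp
        have n0: "real n > 0" using n N by simp
        have "e / (8 * real N) = (e * real N / 2) / (2 * real N) ^ 2"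
          using N by (simp add: power2_eq_square)
        also have "\<dots> \<le> (e * real N / 2) / real n ^ 2"
          using n2 n0 e N by (intro divide_left_mono power_mono) auto
        also have "\<dots> \<le> ?b n"
        proof (intro divide_right_mono)
          have "chebyshev_psi N \<le> chebyshev_psi n" using n by (intro chebyshev_psi_mono) simp
          thus "e * real N / 2 \<le> chebyshev_psi n - real n" using big n1 by (simp add: algebra_simps)
        qed simp
        finally show ?thesis .
      qed
      hence "sum ?b {N..<N + k} \<ge> (\<Sum>n\<in>{N..<N + k}. e / (8 * real N))" by (rule sum_mono)
      also have "(\<Sum>n\<in>{N..<N + k}. e / (8 * real N)) = real k * (e / (8 * real N))" by simp
      also have "real k * (e / (8 * real N)) \<ge> (e * real N / 4) * (e / (8 * real N))"
        using kk e by (intro mult_right_mono) auto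
      also have "(e * real N / 4) * (e / (8 * real N)) = e ^ 2 / 32"
        using N by (simp add: power2_eq_square)
      finally show False using N0[OF N(1), of "N + k"] by simp
    qed
  qed
qed

text \<open>The mirror image, with the block just below N. As its length k is at most N / 2, the
  condition \<open>N \<ge> 2 * N0 + 2\<close> keeps the block above \<open>N0\<close>; its
  denominators are at most N^2, hence the better constant 8.\<close>

lemma psi_lower:
  assumes e: "0 < e" "e < 1"
  shows "eventually (\<lambda>N. chebyshev_psi N > (1 - e) * real N) sequentially"
proof -
  let ?b = "\<lambda>n. (chebyshev_psi n - real n) / real n ^ 2"
  obtain N0 where N0: "\<And>m n. m \<ge> N0 \<Longrightarrow> norm (sum ?b {m..<n}) < e ^ 2 / 8"
    using summable_psi_minus_id[unfolded summable_Cauchy, rule_format, of "e ^ 2 / 8"] e by auto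
  show ?thesis
    unfolding eventually_sequentially
  proof (intro exI[of _ "max (2 * N0 + 2) (nat \<lceil>4 / e\<rceil> + 1)"] allI impI)
    fix N assume "max (2 * N0 + 2) (nat \<lceil>4 / e\<rceil> + 1) \<le> N"
    hence N: "N \<ge> 2 * N0 + 2" "real N \<ge> 4 / e" by linarith+
    show "chebyshev_psi N > (1 - e) * real N"
    proof (rule ccontr)
      assume "\<not> ?thesis"
      hence small: "chebyshev_psi N \<le> (1 - e) * real N" by simp
      define k where "k = nat \<lfloor>e * real N / 2\<rfloor>"
      have k: "real k \<le> e * real N / 2" "real k > e * real N / 2 - 1"
        using e N by (auto simp: k_def) linarith+
      have eN: "e * real N \<ge> 4" using N e by (simp add: field_simps)
      have kk: "real k \<ge> e * real N / 4" using k eN by linarith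
      have "real k \<le> real N / 2" using k(1) e mult_right_mono[of e 1 "real N"] by simp
      hence kN: "2 * k \<le> N" by linarith
      have "?b n \<le> - (e / (2 * real N))" if n: "n \<in> {N - k..<N}" for n
      proof -
        have nk: "N - k \<le> n" using n by simp
        hence "real N - real k \<le> real n" by linarith
        hence n1: "real n \<ge> (1 - e / 2) * real N" using k(1) by (simp add: algebra_simps)
        have "n > 0" using nk N(1) kN by linarith
        hence n0: "real n > 0" by simp
        have nN: "real n \<le> real N" using n by simp
        have "e / (2 * real N) = (e * real N / 2) / real N ^ 2"
          using N by (simp add: power2_eq_square)
        also have "\<dots> \<le> (e * real N / 2) / real n ^ 2"
          using nN n0 e N by (intro divide_left_mono power_mono) auto
        also have "\<dots> \<le> (real n - chebyshev_psi n) / real n ^ 2"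
        proof (intro divide_right_mono)
          have "chebyshev_psi n \<le> chebyshev_psi N" using n by (intro chebyshev_psi_mono) simp
          thus "e * real N / 2 \<le> real n - chebyshev_psi n" using small n1 by (simp add: algebra_simps)
        qed simp
        also have "\<dots> = - ?b n" by (simp add: diff_divide_distrib)
        finally show ?thesis by simp
      qed
      hence "sum ?b {N - k..<N} \<le> (\<Sum>n\<in>{N - k..<N}. - (e / (2 * real N)))" by (rule sum_mono)
      also have "(\<Sum>n\<in>{N - k..<N}. - (e / (2 * real N))) = - (real k * (e / (2 * real N)))" using kN by simp
      also have "real k * (e / (2 * real N)) \<ge> (e * real N / 4) * (e / (2 * real N))"
        using kk e by (intro mult_right_mono) auto
      hence "- (real k * (e / (2 * real N))) \<le> - ((e * real N / 4) * (e / (2 * real N)))" by simp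
      also have "(e * real N / 4) * (e / (2 * real N)) = e ^ 2 / 8"
        using N by (simp add: power2_eq_square)
      moreover have "N - k \<ge> N0" using N(1) kN by linarith
      ultimately show False using N0[of "N - k" N] by simp
    qed
  qed
qed

theorem psi_asymptotics: "(\<lambda>N. chebyshev_psi N / real N) \<longlonglongrightarrow> 1"
proof (rule tendstoI)
  fix e :: real assume "e > 0"
  define e' where "e' = min e (1 / 2)"
  have e': "0 < e'" "e' < 1" "e' \<le> e" using \<open>e > 0\<close> by (auto simp: e'_def)
  show "eventually (\<lambda>N. dist (chebyshev_psi N / real N) 1 < e) sequentially"
    using psi_upper[OF e'(1,2)] psi_lower[OF e'(1,2)] eventually_gt_at_top[of 0]
  proof eventually_elim
    case (elim N)
    have "chebyshev_psi N / real N < 1 + e'" "chebyshev_psi N / real N > 1 - e'"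
      using elim by (simp_all add: pos_divide_less_eq pos_less_divide_eq)
    thus ?case using e' by (simp add: dist_real_def abs_less_iff)
  qed
qed

section \<open>From Chebyshev's psi to the number of primes\<close>

definition prime_count :: "real \<Rightarrow> nat" where
  "prime_count x = card {p. prime p \<and> real p \<le> x}"

lemma finite_primes_le: "finite {p :: nat. prime p \<and> real p \<le> x}"
  by (rule finite_subset[of _ "{..nat \<lfloor>x\<rfloor>}"]) (auto simp: le_nat_floor)

text \<open>A prime p has at most ln n / ln p powers up to n, each of weight ln p, so it contributes
  at most ln n to psi(n).\<close>

lemma chebyshev_psi_le_prime_count:
  assumes n: "n \<ge> 1"
  shows "chebyshev_psi n \<le> real (prime_count (real n)) * ln (real n)"
proof -
  define P where "P = {p. prime p \<and> real p \<le> real n}"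
  define S where "S = {k. k \<le> n \<and> primepow k}"
  have fin: "finite S" "finite P" using finite_primes_le[of "real n"] by (auto simp: S_def P_def)
  have "chebyshev_psi n = (\<Sum>k\<in>S. ln (real (aprimedivisor k)))"
    unfolding chebyshev_psi_def S_def mangoldt_def
    by (intro sum.mono_neutral_cong_right) auto
  also have "\<dots> = (\<Sum>p\<in>P. \<Sum>k\<in>{k\<in>S. aprimedivisor k = p}. ln (real (aprimedivisor k)))"
  proof (rule sum.group[symmetric, OF fin])
    show "aprimedivisor ` S \<subseteq> P"
    proof
      fix p assume "p \<in> aprimedivisor ` S"
      then obtain k where k: "k \<le> n" "primepow k" "p = aprimedivisor k" by (auto simp: S_def)
      have "k > 1" using k primepow_gt_Suc_0 by auto
      hence "prime p" "p \<le> k" using k aprimedivisor_nat(1)[of k] aprimedivisor_le_nat[of k] by auto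
      thus "p \<in> P" using k by (simp add: P_def)
    qed
  qed
  also have "\<dots> \<le> (\<Sum>p\<in>P. ln (real n))"
  proof (rule sum_mono)
    fix p assume p: "p \<in> P"
    have pp: "prime p" "p \<le> n" "p > 1" using p prime_gt_1_nat[of p] by (auto simp: P_def)
    have lnp: "ln (real p) > 0" using pp by simp
    define J where "J = nat \<lfloor>ln (real n) / ln (real p)\<rfloor>"
    have "{k\<in>S. aprimedivisor k = p} \<subseteq> (\<lambda>j. p ^ j) ` {1..J}"
    proof
      fix k assume "k \<in> {k\<in>S. aprimedivisor k = p}"
      hence k: "k \<le> n" "primepow k" "aprimedivisor k = p" by (auto simp: S_def)
      define j where "j = multiplicity p k"
      have kj: "k = p ^ j" using primepow_decompose[OF k(2)] k(3) by (simp add: j_def)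
      have "k > 1" using k primepow_gt_Suc_0 by auto
      hence j1: "j \<ge> 1" using kj by (cases j) auto
      have "real p ^ j \<le> real n" using k kj by (metis of_nat_le_iff of_nat_power)
      hence "ln (real p ^ j) \<le> ln (real n)" using pp by (subst ln_le_cancel_iff) auto
      hence "real j * ln (real p) \<le> ln (real n)" using pp by (simp add: ln_realpow)
      hence "real j \<le> ln (real n) / ln (real p)" using lnp by (simp add: pos_le_divide_eq)
      hence "j \<le> J" unfolding J_def by (simp add: le_nat_floor)
      thus "k \<in> (\<lambda>j. p ^ j) ` {1..J}" using kj j1 by auto
    qed
    hence "card {k\<in>S. aprimedivisor k = p} \<le> card ((\<lambda>j. p ^ j) ` {1..J})" by (intro card_mono) auto
    also have "\<dots> \<le> J" using card_image_le[of "{1..J}" "\<lambda>j. p ^ j"] by simp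
    finally have c: "card {k\<in>S. aprimedivisor k = p} \<le> J" .
    have "(\<Sum>k\<in>{k\<in>S. aprimedivisor k = p}. ln (real (aprimedivisor k))) = real (card {k\<in>S. aprimedivisor k = p}) * ln (real p)"
      by simp
    also have "\<dots> \<le> real J * ln (real p)" using c lnp by (intro mult_right_mono) auto
    also have "\<dots> \<le> (ln (real n) / ln (real p)) * ln (real p)"
      using lnp n by (intro mult_right_mono) (auto simp: J_def)
    finally show "(\<Sum>k\<in>{k\<in>S. aprimedivisor k = p}. ln (real (aprimedivisor k))) \<le> ln (real n)"
      using lnp by simp
  qed
  also have "\<dots> = real (prime_count (real n)) * ln (real n)" by (simp add: P_def prime_count_def)
  finally show ?thesis .
qed

text \<open>Primes above n powr a have weight at least a ln n in psi(n); the others are counted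
  trivially.\<close>

lemma prime_count_le_chebyshev_psi:
  assumes n: "n \<ge> 2" and a: "0 < a" "a < 1"
  shows "real (prime_count (real n)) \<le> chebyshev_psi n / (a * ln (real n)) + real n powr a"
proof -
  define P where "P = {p. prime p \<and> real p \<le> real n}"
  define S where "S = {p. prime p \<and> real p \<le> real n powr a}"
  have fin: "finite P" "finite S" unfolding P_def S_def by (rule finite_primes_le)+
  have "card S \<le> card {1..nat \<lfloor>real n powr a\<rfloor>}"
    by (rule card_mono) (auto simp: S_def le_nat_floor Suc_le_eq prime_gt_0_nat)
  also have "real \<dots> \<le> real n powr a" by simp
  finally have cS: "real (card S) \<le> real n powr a" by simp
  have "card P \<le> card (P - S) + card S"
    using card_Un_le[of "P - S" S] card_mono[of "(P - S) \<union> S" P] fin by auto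
  hence cP: "real (card P) \<le> real (card (P - S)) + real n powr a" using cS by linarith
  have "real (card (P - S)) * (a * ln (real n)) = (\<Sum>p\<in>P - S. a * ln (real n))" by simp
  also have "\<dots> \<le> (\<Sum>p\<in>P - S. mangoldt p)"
  proof (rule sum_mono)
    fix p assume p: "p \<in> P - S"
    hence "real p > real n powr a" "prime p" by (auto simp: P_def S_def)
    hence "ln (real n powr a) \<le> ln (real p)" using n by (subst ln_le_cancel_iff) (auto simp: prime_gt_0_nat)
    thus "a * ln (real n) \<le> mangoldt p" using n \<open>prime p\<close> by (simp add: mangoldt_prime ln_powr)
  qed
  also have "\<dots> \<le> chebyshev_psi n"
    unfolding chebyshev_psi_def by (intro sum_mono2 mangoldt_nonneg) (auto simp: P_def)
  finally have "real (card (P - S)) \<le> chebyshev_psi n / (a * ln (real n))"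
    using n a by (subst pos_le_divide_eq) auto
  thus ?thesis using cP by (simp add: prime_count_def P_def)
qed

lemma prime_count_floor:
  assumes "x \<ge> 0"
  shows "prime_count x = prime_count (real (nat \<lfloor>x\<rfloor>))"
proof -
  have "real p \<le> x \<longleftrightarrow> real p \<le> real (nat \<lfloor>x\<rfloor>)" for p
  proof -
    have "real p \<le> x \<longleftrightarrow> int p \<le> \<lfloor>x\<rfloor>" by (simp add: le_floor_iff)
    also have "\<dots> \<longleftrightarrow> p \<le> nat \<lfloor>x\<rfloor>" using assms by (simp add: le_nat_iff)
    finally show ?thesis by (simp only: of_nat_le_iff)
  qed
  thus ?thesis by (simp only: prime_count_def)
qed

theorem prime_number_theorem_nat: "(\<lambda>n. real (prime_count (real n)) * ln (real n) / real n) \<longlonglongrightarrow> 1"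
proof (rule tendstoI)
  fix e :: real assume e: "e > 0"
  \<comment> \<open>Then 1 / a = 1 + e / 4 leaves room below 1 + e, and a < 1 makes the share of the
    small primes tend to 0.\<close>
  define a where "a = 1 / (1 + e / 4)"
  have a: "0 < a" "a < 1" using e by (auto simp: a_def)
  have "(\<lambda>n. chebyshev_psi n / real n * (1 / a) + real n powr (a - 1) * ln (real n)) \<longlonglongrightarrow> 1 * (1 / a) + 0"
    using a by (intro tendsto_intros psi_asymptotics) real_asymp
  hence 1: "eventually (\<lambda>n. chebyshev_psi n / real n * (1 / a) + real n powr (a - 1) * ln (real n) < 1 + e) sequentially"
    using e by (intro order_tendstoD(2)) (auto simp: a_def)
  have 2: "eventually (\<lambda>n. chebyshev_psi n / real n > 1 - e) sequentially"
    using psi_asymptotics e by (intro order_tendstoD(1)) auto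
  show "eventually (\<lambda>n. dist (real (prime_count (real n)) * ln (real n) / real n) 1 < e) sequentially"
    using 1 2 eventually_ge_at_top[of 2]
  proof eventually_elim
    case (elim n)
    have l: "ln (real n) > 0" using elim(3) by simp
    have "chebyshev_psi n / real n \<le> real (prime_count (real n)) * ln (real n) / real n"
      using chebyshev_psi_le_prime_count[of n] elim(3) by (intro divide_right_mono) auto
    moreover have "real (prime_count (real n)) * (ln (real n) / real n) \<le>
       (chebyshev_psi n / (a * ln (real n)) + real n powr a) * (ln (real n) / real n)"
      using prime_count_le_chebyshev_psi[OF elim(3) a] l by (intro mult_right_mono) auto
    moreover have "(chebyshev_psi n / (a * ln (real n)) + real n powr a) * (ln (real n) / real n)
       = chebyshev_psi n / real n * (1 / a) + real n powr (a - 1) * ln (real n)"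
    proof -
      have "real n powr a * (ln (real n) / real n) = real n powr (a - 1) * ln (real n)"
        using elim(3) by (simp add: powr_diff)
      moreover have "chebyshev_psi n / (a * ln (real n)) * (ln (real n) / real n) = chebyshev_psi n / real n * (1 / a)"
        using l by simp
      ultimately show ?thesis by (simp only: distrib_right)
    qed
    moreover have "real (prime_count (real n)) * (ln (real n) / real n) = real (prime_count (real n)) * ln (real n) / real n"
      by simp
    ultimately have "real (prime_count (real n)) * ln (real n) / real n < 1 + e"
      "real (prime_count (real n)) * ln (real n) / real n > 1 - e" using elim(1,2) by linarith+
    thus ?case unfolding dist_real_def abs_less_iff by linarith
  qed
qed

theorem prime_number_theorem: "((\<lambda>x. real (prime_count x) * ln x / x) \<longlongrightarrow> 1) at_top"
proof -
  have fl: "filterlim (\<lambda>x::real. nat \<lfloor>x\<rfloor>) at_top at_top"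
    by (intro filterlim_compose[OF filterlim_nat_sequentially] filterlim_floor_sequentially)
  have "((\<lambda>x::real. real (prime_count (real (nat \<lfloor>x\<rfloor>))) * ln (real (nat \<lfloor>x\<rfloor>)) / real (nat \<lfloor>x\<rfloor>)) \<longlongrightarrow> 1) at_top"
    by (rule filterlim_compose[OF prime_number_theorem_nat fl])
  moreover have "((\<lambda>x::real. (ln x / ln (real (nat \<lfloor>x\<rfloor>))) * (real (nat \<lfloor>x\<rfloor>) / x)) \<longlongrightarrow> 1) at_top"
    by real_asymp
  ultimately have "((\<lambda>x. (real (prime_count (real (nat \<lfloor>x\<rfloor>))) * ln (real (nat \<lfloor>x\<rfloor>)) / real (nat \<lfloor>x\<rfloor>)) *
     ((ln x / ln (real (nat \<lfloor>x\<rfloor>))) * (real (nat \<lfloor>x\<rfloor>) / x))) \<longlongrightarrow> 1 * 1) at_top" by (rule tendsto_mult)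
  moreover have "eventually (\<lambda>x. (real (prime_count (real (nat \<lfloor>x\<rfloor>))) * ln (real (nat \<lfloor>x\<rfloor>)) / real (nat \<lfloor>x\<rfloor>)) *
     ((ln x / ln (real (nat \<lfloor>x\<rfloor>))) * (real (nat \<lfloor>x\<rfloor>) / x)) = real (prime_count x) * ln x / x) at_top"
    using eventually_ge_at_top[of 2]
  proof eventually_elim
    case (elim x)
    have "nat \<lfloor>x\<rfloor> \<ge> 2" using elim by (simp add: le_nat_floor)
    hence "real (nat \<lfloor>x\<rfloor>) > 1" by linarith
    define m where "m = real (nat \<lfloor>x\<rfloor>)"
    have "m > 1" using \<open>real (nat \<lfloor>x\<rfloor>) > 1\<close> by (simp add: m_def)
    hence "ln m \<noteq> 0" "m \<noteq> 0" using ln_gt_zero[of m] by auto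
    moreover have "prime_count x = prime_count m" unfolding m_def using elim by (intro prime_count_floor) simp
    ultimately show ?case unfolding m_def[symmetric] by simp
  qed
  ultimately show ?thesis using Lim_transform_eventually by fastforce
qed

section \<open>Splitting of primes\<close>

lemma csqrt_neg_of_nat: "csqrt (- of_nat q) = \<i> * of_real (sqrt (real q))"
  by (subst csqrt_of_real_nonpos) auto

lemma csqrt_neg_of_nat_square: "csqrt (- of_nat q) * csqrt (- of_nat q) = - of_nat q"
  using power2_csqrt[of "- of_nat q"] by (simp only: power2_eq_square)

lemma ring_of_type_algebra_sel:
  "carrier (ring_of_type_algebra :: complex ring) = UNIV"
  "x \<otimes>\<^bsub>ring_of_type_algebra\<^esub> y = x * (y :: complex)"
  "x \<oplus>\<^bsub>ring_of_type_algebra\<^esub> y = x + (y :: complex)"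
  "\<one>\<^bsub>ring_of_type_algebra\<^esub> = (1 :: complex)"
  "\<zero>\<^bsub>ring_of_type_algebra\<^esub> = (0 :: complex)"
  by (simp_all add: ring_of_type_algebra_def)

lemma ring_of_type_algebra_inv:
  "\<ominus>\<^bsub>ring_of_type_algebra\<^esub> x = - (x :: complex)"
  "x \<noteq> 0 \<Longrightarrow> inv\<^bsub>ring_of_type_algebra\<^esub> x = inverse (x :: complex)"
proof -
  interpret field "ring_of_type_algebra :: complex ring" by (rule field_from_type_algebra)
  show "\<ominus>\<^bsub>ring_of_type_algebra\<^esub> x = - x"
    by (rule minus_equality) (simp_all add: ring_of_type_algebra_sel)
  show "inv\<^bsub>ring_of_type_algebra\<^esub> x = inverse x" if "x \<noteq> 0"
    by (rule comm_inv_char) (use that in \<open>simp_all add: ring_of_type_algebra_sel\<close>)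
qed

lemma imag_quadratic_field_eq:
  "imag_quadratic_field q = {of_rat r + of_rat s * csqrt (- of_nat q) | r s. True}" (is "_ = ?K")
proof (rule subset_antisym)
  let ?R = "ring_of_type_algebra :: complex ring" and ?t = "csqrt (- of_nat q)"
  have sq: "?t * ?t = of_rat (- of_nat q)" unfolding csqrt_neg_of_nat_square by (simp add: of_rat_minus)
  show "imag_quadratic_field q \<subseteq> ?K"
  proof
    fix x assume "x \<in> imag_quadratic_field q"
    thus "x \<in> ?K" unfolding imag_quadratic_field_def
    proof (induction rule: generate_field.induct)
      case one
      have "(1 :: complex) = of_rat 1 + of_rat 0 * ?t" by simp
      thus ?case unfolding ring_of_type_algebra_sel by blast
    next
      case (incl h)
      hence "h = of_rat 0 + of_rat 1 * ?t" by simp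
      thus ?case by blast
    next
      case (a_inv h)
      then obtain r s where "h = of_rat r + of_rat s * ?t" by blast
      hence "- h = of_rat (- r) + of_rat (- s) * ?t" by (simp add: of_rat_minus)
      thus ?case unfolding ring_of_type_algebra_inv by blast
    next
      case (m_inv h)
      then obtain r s where h: "h = of_rat r + of_rat s * ?t" by blast
      have h0: "h \<noteq> 0" using m_inv by (simp add: ring_of_type_algebra_sel)
      define n where "n = r * r + of_nat q * s * s"
      have n: "h * (of_rat r - of_rat s * ?t) = of_rat n"
      proof -
        have "h * (of_rat r - of_rat s * ?t) = of_rat r * of_rat r - of_rat s * of_rat s * (?t * ?t)"
          by (simp add: h algebra_simps)
        thus ?thesis unfolding sq by (simp add: n_def of_rat_add of_rat_mult of_rat_minus mult_ac)
      qed
      have "n \<noteq> 0"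
      proof
        assume "n = 0"
        moreover have "r * r \<ge> 0" "of_nat q * s * s \<ge> 0"
          using mult_nonneg_nonneg[of "of_nat q" "s * s"] by (auto simp: mult.assoc)
        ultimately have "r = 0" "of_nat q * s * s = 0" unfolding n_def
          by (smt (verit) add_nonneg_eq_0_iff mult_eq_0_iff)+
        hence "h = 0" using h by (auto simp: csqrt_neg_of_nat)
        thus False using h0 by simp
      qed
      have "inverse h = of_rat (r / n) + of_rat (- s / n) * ?t"
      proof (rule inverse_unique)
        have "h * (of_rat (r / n) + of_rat (- s / n) * ?t) = (h * (of_rat r - of_rat s * ?t)) / of_rat n"
        proof -
          have "h * (R / N + (- S / N) * t) = h * (R - S * t) / N" for R S N t
            by (simp add: ring_distribs diff_divide_distrib)
          thus ?thesis by (simp only: of_rat_divide of_rat_minus)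
        qed
        thus "h * (of_rat (r / n) + of_rat (- s / n) * ?t) = 1" unfolding n using \<open>n \<noteq> 0\<close> by simp
      qed
      thus ?case unfolding ring_of_type_algebra_inv(2)[OF h0] by blast
    next
      case (eng_add x y)
      then obtain r s r' s' where "x = of_rat r + of_rat s * ?t" "y = of_rat r' + of_rat s' * ?t" by blast
      hence "x + y = of_rat (r + r') + of_rat (s + s') * ?t" by (simp add: of_rat_add algebra_simps)
      thus ?case unfolding ring_of_type_algebra_sel by blast
    next
      case (eng_mult x y)
      then obtain r s r' s' where xy: "x = of_rat r + of_rat s * ?t" "y = of_rat r' + of_rat s' * ?t" by blast
      have "x * y = of_rat r * of_rat r' + of_rat s * of_rat s' * (?t * ?t) + (of_rat r * of_rat s' + of_rat s * of_rat r') * ?t"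
        by (simp add: xy algebra_simps)
      hence "x * y = of_rat (r * r' - of_nat q * s * s') + of_rat (r * s' + s * r') * ?t"
        unfolding sq by (simp add: of_rat_add of_rat_mult of_rat_minus of_rat_diff algebra_simps)
      thus ?case unfolding ring_of_type_algebra_sel by blast
    qed
  qed
  show "?K \<subseteq> imag_quadratic_field q"
  proof
    let ?G = "generate_field ?R {?t}"
    note G = generate_field.intros[where R = ?R and H = "{?t}", unfolded ring_of_type_algebra_sel ring_of_type_algebra_inv(1)]
    have G0: "0 \<in> ?G" using G(5)[OF G(1) G(3)[OF G(1)]] by simp
    have nat: "of_nat n \<in> ?G" for n
      by (induction n) (use G0 G(1) G(5) in auto)
    have int: "of_int k \<in> ?G" for k
      by (cases k rule: int_cases2) (use nat G(3) in auto)
    have rat: "of_rat r \<in> ?G" for r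
    proof -
      obtain a b where r: "r = Rat.Fract a b" "b > 0" using Rat_cases by blast
      have "inverse (of_int b) \<in> ?G"
        using G(4)[OF int[of b]] r ring_of_type_algebra_inv(2)[of "of_int b"] by auto
      from G(6)[OF int[of a] this] show ?thesis using r by (simp add: of_rat_rat field_simps)
    qed
    fix x assume "x \<in> ?K"
    then obtain r s where "x = of_rat r + of_rat s * ?t" by blast
    moreover have "?t \<in> ?G" by (rule G(2)) simp
    ultimately show "x \<in> imag_quadratic_field q"
      unfolding imag_quadratic_field_def using G(5)[OF rat[of r] G(6)[OF rat[of s]]] by blast
  qed
qed

text \<open>If t is the reduced denominator of r, then \<open>t ^ n\<close> divides \<open>D\<close>
  for every n. The exponent n = |D| already forces t = 1, since 2 ^ |D| exceeds |D|.\<close>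

lemma rat_int_of_bounded_denominator:
  fixes r :: rat and D :: int
  assumes D: "D \<noteq> 0" and r: "\<And>n. r ^ n * of_int D \<in> \<int>"
  shows "r \<in> \<int>"
proof -
  obtain s t where st: "r = of_int s / of_int t" "t > 0" "coprime s t"
  proof -
    obtain s t where q: "quotient_of r = (s, t)" by force
    show ?thesis using that quotient_of_div[OF q] quotient_of_denom_pos[OF q] quotient_of_coprime[OF q] by blast
  qed
  have "t ^ n dvd D" for n
  proof -
    obtain k where "r ^ n * of_int D = of_int k" using r[of n] by (auto elim: Ints_cases)
    hence "of_int s ^ n * of_int D = (of_int k * of_int t ^ n :: rat)"
      using st by (simp add: power_divide field_simps)
    hence "(of_int (s ^ n * D) :: rat) = of_int (k * t ^ n)" by simp
    hence "s ^ n * D = k * t ^ n" by (simp only: of_int_eq_iff)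
    hence "t ^ n dvd s ^ n * D" by simp
    moreover have "coprime (t ^ n) (s ^ n)" using st by (simp add: coprime_commute)
    ultimately show ?thesis by (simp add: coprime_dvd_mult_right_iff)
  qed
  hence "t ^ nat \<bar>D\<bar> \<le> \<bar>D\<bar>" using D by (meson abs_ge_zero dvd_abs_iff zdvd_imp_le zero_less_abs_iff)
  have "t < 2"
  proof (rule ccontr)
    assume "\<not> t < 2"
    hence "2 ^ nat \<bar>D\<bar> \<le> t ^ nat \<bar>D\<bar>" by (intro power_mono) auto
    moreover have "int (nat \<bar>D\<bar>) < 2 ^ nat \<bar>D\<bar>" by (metis of_nat_less_two_power)
    ultimately show False using \<open>t ^ nat \<bar>D\<bar> \<le> \<bar>D\<bar>\<close> by simp
  qed
  hence "t = 1" using st by simp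
  thus ?thesis using st by simp
qed

section \<open>The ring of integers of the field\<close>

definition quad_lattice :: "nat \<Rightarrow> complex set" where
  "quad_lattice q = {of_int u + of_int v * csqrt (- of_nat q) | u v. True}"

lemma quad_latticeI: "x = of_int u + of_int v * csqrt (- of_nat q) \<Longrightarrow> x \<in> quad_lattice q"
  unfolding quad_lattice_def by blast

lemma quad_lattice_of_int: "of_int k \<in> quad_lattice q"
  by (rule quad_latticeI[of _ k 0]) simp

lemma quad_lattice_add: "x \<in> quad_lattice q \<Longrightarrow> y \<in> quad_lattice q \<Longrightarrow> x + y \<in> quad_lattice q"
proof -
  assume "x \<in> quad_lattice q" "y \<in> quad_lattice q"
  then obtain u v u' v' where "x = of_int u + of_int v * csqrt (- of_nat q)" "y = of_int u' + of_int v' * csqrt (- of_nat q)"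
    unfolding quad_lattice_def by blast
  thus ?thesis by (intro quad_latticeI[of _ "u + u'" "v + v'"]) (simp add: algebra_simps)
qed

lemma quad_lattice_mult: "x \<in> quad_lattice q \<Longrightarrow> y \<in> quad_lattice q \<Longrightarrow> x * y \<in> quad_lattice q"
proof -
  assume "x \<in> quad_lattice q" "y \<in> quad_lattice q"
  then obtain u v u' v' where xy: "x = of_int u + of_int v * csqrt (- of_nat q)" "y = of_int u' + of_int v' * csqrt (- of_nat q)"
    unfolding quad_lattice_def by blast
  have "x * y = of_int u * of_int u' + of_int v * of_int v' * (csqrt (- of_nat q) * csqrt (- of_nat q))
     + (of_int u * of_int v' + of_int v * of_int u') * csqrt (- of_nat q)" by (simp add: xy algebra_simps)
  thus ?thesis unfolding csqrt_neg_of_nat_square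
    by (intro quad_latticeI[of _ "u * u' - int q * v * v'" "u * v' + v * u'"]) (simp add: algebra_simps)
qed

lemma quad_lattice_power: "x \<in> quad_lattice q \<Longrightarrow> x ^ n \<in> quad_lattice q"
  by (induction n) (auto intro: quad_lattice_mult quad_lattice_of_int[of 1, simplified])

lemma quad_lattice_sum: "(\<And>i. i \<in> A \<Longrightarrow> f i \<in> quad_lattice q) \<Longrightarrow> sum f A \<in> quad_lattice q"
  by (induction A rule: infinite_finite_induct)
     (auto intro: quad_lattice_add quad_lattice_of_int[of 0, simplified])

lemma norm_quad_lattice:
  "(cmod (of_real a + of_real b * csqrt (- of_nat q)))\<^sup>2 = a\<^sup>2 + real q * b\<^sup>2"
  unfolding csqrt_neg_of_nat by (simp add: cmod_power2 power_mult_distrib)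

lemma quad_lattice_norm: "x \<in> quad_lattice q \<Longrightarrow> (cmod x)\<^sup>2 \<in> \<int>"
proof -
  assume "x \<in> quad_lattice q"
  then obtain u v where x: "x = of_int u + of_int v * csqrt (- of_nat q)" unfolding quad_lattice_def by blast
  have "(cmod x)\<^sup>2 = of_int (u\<^sup>2 + int q * v\<^sup>2)"
    using norm_quad_lattice[of "of_int u" "of_int v" q] by (simp add: x)
  thus ?thesis by (simp only: Ints_of_int)
qed

text \<open>
  That the norm and the trace of an integer \<open>x\<close> of the field are rational integers is derived, without
  using that algebraic integers form a ring, from a common denominator of all powers of \<open>x\<close>, and
  likewise of \<open>x + 1\<close>.
\<close>

lemma algebraic_int_powers_bounded_denominator:
  assumes x: "algebraic_int x" and d: "d > 0" "of_int d * x \<in> quad_lattice q"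
  shows "\<exists>D :: int. D \<noteq> 0 \<and> (\<forall>n. of_int D * x ^ n \<in> quad_lattice q)"
proof -
  obtain p where p: "lead_coeff p = 1" "\<And>i. coeff p i \<in> \<int>" "poly p x = 0"
    using x by (auto elim: algebraic_int.cases)
  define m where "m = degree p"
  have rel: "x ^ m = - (\<Sum>i<m. coeff p i * x ^ i)"
  proof -
    have "0 = (\<Sum>i\<le>m. coeff p i * x ^ i)" using p(3) by (simp add: poly_altdef m_def)
    also have "\<dots> = (\<Sum>i<m. coeff p i * x ^ i) + x ^ m"
      using p(1) by (simp add: m_def lessThan_Suc_atMost[symmetric])
    finally show ?thesis by (simp add: eq_neg_iff_add_eq_0 add.commute)
  qed
  \<comment> \<open>For n < m the factor \<open>d ^ n\<close> clears the denominators. From m on,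
    the monic equation expresses x^n by lower powers with integer coefficients, so no further
    denominator arises.\<close>
  have "of_int (d ^ m) * x ^ n \<in> quad_lattice q" for n
  proof (induction n rule: less_induct)
    case (less n)
    show ?case
    proof (cases "n < m")
      case True
      have "of_int (d ^ m) * x ^ n = of_int (d ^ (m - n)) * (of_int d * x) ^ n"
        using True by (simp add: power_mult_distrib mult.assoc[symmetric] power_add[symmetric])
      thus ?thesis using quad_lattice_mult[OF quad_lattice_of_int[of "d ^ (m - n)"] quad_lattice_power[OF d(2), of n]] by simp
    next
      case False
      have "of_int (d ^ m) * x ^ n = of_int (d ^ m) * x ^ (n - m) * x ^ m"
        using False by (simp add: mult.assoc power_add[symmetric])
      also have "\<dots> = (\<Sum>i<m. - coeff p i * (of_int (d ^ m) * x ^ (n - m + i)))"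
        unfolding rel by (simp add: sum_distrib_left power_add sum_negf mult_ac)
      also have "\<dots> \<in> quad_lattice q"
      proof (rule quad_lattice_sum)
        fix i assume "i \<in> {..<m}"
        hence "of_int (d ^ m) * x ^ (n - m + i) \<in> quad_lattice q" using False by (intro less) auto
        moreover have "- coeff p i \<in> \<int>" using p(2) by auto
        ultimately show "- coeff p i * (of_int (d ^ m) * x ^ (n - m + i)) \<in> quad_lattice q"
          by (metis Ints_cases quad_lattice_mult quad_lattice_of_int)
      qed
      finally show ?thesis .
    qed
  qed
  thus ?thesis using d(1) by (intro exI[of _ "d ^ m"]) auto
qed

lemma complex_of_real_of_rat: "complex_of_real (of_rat r) = of_rat r"
  by (cases r) (simp add: of_rat_rat)

text \<open>The norm of \<open>D * x ^ n\<close> is \<open>D^2 * r ^ n\<close> and is an integer for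
  all n, so the powers of r have a common denominator.\<close>

lemma norm_int_of_bounded_powers:
  assumes D: "D \<noteq> 0" "\<And>n. of_int D * x ^ n \<in> quad_lattice q" and r: "(cmod x)\<^sup>2 = of_rat r"
  shows "r \<in> \<int>"
proof (rule rat_int_of_bounded_denominator[of "D\<^sup>2"])
  fix n
  have "(cmod (of_int D * x ^ n))\<^sup>2 = of_rat (r ^ n * of_int (D\<^sup>2))"
    by (simp add: norm_mult norm_power power_mult_distrib of_rat_mult of_rat_power r[symmetric] power_mult[symmetric] mult.commute)
  moreover have "(cmod (of_int D * x ^ n))\<^sup>2 \<in> \<int>" by (rule quad_lattice_norm[OF D(2)])
  ultimately obtain k where "of_rat (r ^ n * of_int (D\<^sup>2)) = (of_int k :: real)" by (auto elim: Ints_cases)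
  hence "of_rat (r ^ n * of_int (D\<^sup>2)) = (of_rat (of_int k) :: real)" by simp
  hence "r ^ n * of_int (D\<^sup>2) = of_int k" by (simp only: of_rat_eq_iff)
  thus "r ^ n * of_int (D\<^sup>2) \<in> \<int>" by simp
qed (use D in auto)

text \<open>In lowest terms s / t the square of t divides q s^2, hence the squarefree number q. This
  yields that 2s is integral once q (2s)^2 is.\<close>

lemma rat_int_of_prime_times_square:
  fixes b :: rat
  assumes q: "prime q" and b: "of_nat q * b\<^sup>2 \<in> \<int>"
  shows "b \<in> \<int>"
proof -
  obtain s t where st: "b = of_int s / of_int t" "t > 0" "coprime s t"
  proof -
    obtain s t where q: "quotient_of b = (s, t)" by force
    show ?thesis using that quotient_of_div[OF q] quotient_of_denom_pos[OF q] quotient_of_coprime[OF q] by blast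
  qed
  obtain k where "of_nat q * b\<^sup>2 = of_int k" using b by (auto elim: Ints_cases)
  hence "of_nat q * of_int s ^ 2 = (of_int k * of_int t ^ 2 :: rat)"
    using st by (simp add: power_divide field_simps)
  hence "(of_int (int q * s ^ 2) :: rat) = of_int (k * t ^ 2)" by simp
  hence "int q * s ^ 2 = k * t ^ 2" by (simp only: of_int_eq_iff)
  hence "t ^ 2 dvd s ^ 2 * int q" by (metis dvd_triv_right mult.commute)
  moreover have "coprime (t ^ 2) (s ^ 2)" using st by (simp add: coprime_commute)
  ultimately have "t ^ 2 dvd int q" by (simp add: coprime_dvd_mult_right_iff)
  moreover have "squarefree (int q)" using q by (intro squarefree_prime) auto
  ultimately have "t dvd 1" unfolding squarefree_def by blast
  hence "t = 1" using st by simp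
  thus ?thesis using st by simp
qed

definition quad_int :: "nat \<Rightarrow> int \<Rightarrow> int \<Rightarrow> complex" where
  "quad_int q a b = (of_int a + of_int b * csqrt (- of_nat q)) / 2"

text \<open>For q = 3 modulo 4 this is Z[(1 + sqrt(-q)) / 2]. The common denominator 2 with a parity
  condition replaces a Z-basis.\<close>

definition quad_ints :: "nat \<Rightarrow> complex set" where
  "quad_ints q = {quad_int q a b | a b. even (a - b)}"

text \<open>A quarter of the left-hand expression is the norm of \<open>quad_int q a b\<close>.
  Modulo 4 the expression is a^2 - b^2.\<close>

lemma quadratic_integer_parity:
  assumes "q mod 4 = 3"
  shows "4 dvd a\<^sup>2 + int q * b\<^sup>2 \<longleftrightarrow> even (a - b)"
proof -
  have q: "int q mod 4 = 3" using assms by presburger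
  have sq: "x\<^sup>2 mod 4 = (if even x then 0 else 1)" for x :: int
  proof (cases "even x")
    case False
    then obtain k where "x = 2 * k + 1" by (elim oddE)
    hence "x\<^sup>2 = 4 * (k * k + k) + 1" by (simp add: power2_eq_square algebra_simps)
    thus ?thesis using False by presburger
  qed (auto elim!: evenE simp: power2_eq_square)
  have "(a\<^sup>2 + int q * b\<^sup>2) mod 4 = (a\<^sup>2 mod 4 + (int q mod 4) * (b\<^sup>2 mod 4)) mod 4"
  proof -
    have "(int q * b\<^sup>2) mod 4 = ((int q mod 4) * (b\<^sup>2 mod 4)) mod 4" by (rule mod_mult_eq[symmetric])
    hence "(a\<^sup>2 mod 4 + (int q * b\<^sup>2) mod 4) mod 4 = (a\<^sup>2 mod 4 + (int q mod 4) * (b\<^sup>2 mod 4)) mod 4"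
      by (simp only: mod_add_right_eq)
    thus ?thesis by (simp only: mod_add_eq)
  qed
  also have "\<dots> = (if even a then (if even b then 0 else 3) else (if even b then 1 else 0))"
    unfolding q sq by simp
  finally have m: "(a\<^sup>2 + int q * b\<^sup>2) mod 4 = (if even a then (if even b then 0 else 3) else (if even b then 1 else 0))" .
  show ?thesis unfolding dvd_eq_mod_eq_0[of 4] m by simp
qed

lemma algebraic_ints_of_field:
  assumes q: "prime q" "q mod 4 = 3"
  shows "{x \<in> imag_quadratic_field q. algebraic_int x} = quad_ints q"
proof (rule subset_antisym; rule subsetI)
  let ?t = "csqrt (- of_nat q)"
  fix x assume "x \<in> quad_ints q"
  then obtain a b where x: "x = quad_int q a b" and ab: "even (a - b)" by (auto simp: quad_ints_def)
  have "x = of_rat (of_int a / 2) + of_rat (of_int b / 2) * ?t"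
    by (simp add: x quad_int_def of_rat_divide add_divide_distrib)
  hence "x \<in> imag_quadratic_field q" unfolding imag_quadratic_field_eq by blast
  moreover have "algebraic_int x"
  proof -
    have "4 dvd a\<^sup>2 + int q * b\<^sup>2" using quadratic_integer_parity[OF q(2), of a b] ab by blast
    then obtain k where k: "a\<^sup>2 + int q * b\<^sup>2 = 4 * k" by (elim dvdE)
    define p where "p = [:of_int k, - of_int a, 1 :: complex:]"
    have "4 * poly p x = 4 * of_int k - of_int (a\<^sup>2) + of_int (b\<^sup>2) * (?t * ?t)"
      by (simp add: p_def x quad_int_def field_simps power2_eq_square)
    also have "\<dots> = of_int (4 * k - a\<^sup>2 - int q * b\<^sup>2)" unfolding csqrt_neg_of_nat_square by simp
    also have "4 * k - a\<^sup>2 - int q * b\<^sup>2 = 0" using k by simp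
    finally have "poly p x = 0" by simp
    moreover have "lead_coeff p = 1" "\<forall>i. coeff p i \<in> \<int>"
      by (auto simp: p_def coeff_pCons split: nat.splits)
    ultimately show ?thesis using algebraic_int.intros by blast
  qed
  ultimately show "x \<in> {x \<in> imag_quadratic_field q. algebraic_int x}" by simp
next
  let ?t = "csqrt (- of_nat q)"
  fix x assume "x \<in> {x \<in> imag_quadratic_field q. algebraic_int x}"
  hence "x \<in> imag_quadratic_field q" and alg: "algebraic_int x" by auto
  then obtain r s where x: "x = of_rat r + of_rat s * ?t" unfolding imag_quadratic_field_eq by blast
  obtain u v d where d: "d > 0" "r = of_int u / of_int d" "s = of_int v / of_int d"
  proof -
    obtain a b where 1: "r = of_int a / of_int b" "b > 0" using quotient_of_div quotient_of_denom_pos by (metis surj_pair)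
    obtain a' b' where 2: "s = of_int a' / of_int b'" "b' > 0" using quotient_of_div quotient_of_denom_pos by (metis surj_pair)
    show ?thesis by (rule that[of "b * b'" "a * b'" "a' * b"]) (use 1 2 in auto)
  qed
  have "of_int d * x \<in> quad_lattice q"
  proof (rule quad_latticeI[of _ u v])
    have "of_int d * x = of_rat (of_int d * r) + of_rat (of_int d * s) * ?t"
      by (simp add: x of_rat_mult ring_distribs del: csqrt_minus)
    also have "of_int d * r = of_int u" using d by simp
    also have "of_int d * s = of_int v" using d by simp
    finally show "of_int d * x = of_int u + of_int v * ?t" by (simp only: of_rat_of_int_eq)
  qed
  from algebraic_int_powers_bounded_denominator[OF alg d(1) this] obtain D :: int where
    D: "D \<noteq> 0" "\<And>n. of_int D * x ^ n \<in> quad_lattice q" by blast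
  have D1: "of_int D * (x + 1) ^ n \<in> quad_lattice q" for n
  proof -
    have "of_int D * (x + 1) ^ n = (\<Sum>k\<le>n. of_int (int (n choose k)) * (of_int D * x ^ k))"
      by (simp add: binomial_ring sum_distrib_left mult_ac)
    also have "\<dots> \<in> quad_lattice q" by (intro quad_lattice_sum quad_lattice_mult quad_lattice_of_int D)
    finally show ?thesis .
  qed
  have nx: "(cmod x)\<^sup>2 = of_rat (r\<^sup>2 + of_nat q * s\<^sup>2)"
    using norm_quad_lattice[of "of_rat r" "of_rat s" q, unfolded complex_of_real_of_rat]
    by (simp add: x of_rat_add of_rat_mult of_rat_power)
  have nx1: "(cmod (x + 1))\<^sup>2 = of_rat ((r + 1)\<^sup>2 + of_nat q * s\<^sup>2)"
    using norm_quad_lattice[of "of_rat (r + 1)" "of_rat s" q, unfolded complex_of_real_of_rat]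
    by (simp add: x of_rat_add of_rat_mult of_rat_power add_ac)
  obtain n0 where n0: "r\<^sup>2 + of_nat q * s\<^sup>2 = of_int n0"
    using norm_int_of_bounded_powers[OF D nx] by (auto elim: Ints_cases)
  obtain n1 where n1: "(r + 1)\<^sup>2 + of_nat q * s\<^sup>2 = of_int n1"
    using norm_int_of_bounded_powers[OF D(1) D1 nx1] by (auto elim: Ints_cases)
  \<comment> \<open>This is |x + 1|^2 - |x|^2 - 1, the trace 2r of x.\<close>
  define a where "a = n1 - n0 - 1"
  have "(r + 1)\<^sup>2 = r\<^sup>2 + 2 * r + 1" by (simp add: power2_eq_square algebra_simps)
  hence a: "2 * r = of_int a" using n0 n1 by (simp add: a_def)
  have "of_nat q * (2 * s)\<^sup>2 = 4 * (r\<^sup>2 + of_nat q * s\<^sup>2) - (2 * r)\<^sup>2"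
    by (simp add: power_mult_distrib distrib_left mult.left_commute)
  also have "\<dots> = of_int (4 * n0 - a\<^sup>2)" unfolding n0 a by simp
  finally have nn: "of_nat q * (2 * s)\<^sup>2 = of_int (4 * n0 - a\<^sup>2)" .
  hence "of_nat q * (2 * s)\<^sup>2 \<in> \<int>" by (simp only: Ints_of_int)
  hence "2 * s \<in> \<int>" by (rule rat_int_of_prime_times_square[OF q(1)])
  then obtain b where b: "2 * s = of_int b" by (elim Ints_cases)
  have "(of_int (int q * b\<^sup>2) :: rat) = of_int (4 * n0 - a\<^sup>2)" using nn b by simp
  hence "int q * b\<^sup>2 = 4 * n0 - a\<^sup>2" by (simp only: of_int_eq_iff)
  hence "4 dvd a\<^sup>2 + int q * b\<^sup>2" by simp
  hence "even (a - b)" using quadratic_integer_parity[OF q(2)] by blast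
  moreover have rs: "r = of_int a / 2" "s = of_int b / 2" using a b by (simp_all add: field_simps)
  have "x = quad_int q a b" unfolding x rs quad_int_def by (simp add: of_rat_divide add_divide_distrib)
  ultimately show "x \<in> quad_ints q" unfolding quad_ints_def by blast
qed

lemma quad_int_add: "quad_int q a b + quad_int q a' b' = quad_int q (a + a') (b + b')"
  by (simp add: quad_int_def field_simps)

lemma quad_int_minus: "- quad_int q a b = quad_int q (- a) (- b)"
  by (simp add: quad_int_def field_simps)

lemma quad_int_mult:
  assumes "2 * A = a * a' - int q * b * b'" "2 * B = a * b' + b * a'"
  shows "quad_int q a b * quad_int q a' b' = quad_int q A B"
proof -
  let ?t = "csqrt (- of_nat q)"
  have "4 * (quad_int q a b * quad_int q a' b') = of_int a * of_int a' + of_int b * of_int b' * (?t * ?t)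
      + (of_int a * of_int b' + of_int b * of_int a') * ?t"
    by (simp add: quad_int_def algebra_simps)
  also have "\<dots> = of_int (a * a' - int q * b * b') + of_int (a * b' + b * a') * ?t"
    unfolding csqrt_neg_of_nat_square by (simp add: algebra_simps)
  also have "\<dots> = 4 * quad_int q A B" unfolding assms[symmetric] by (simp add: quad_int_def)
  finally show ?thesis by simp
qed

lemma quad_int_eq_iff:
  assumes "q > 0"
  shows "quad_int q a b = quad_int q a' b' \<longleftrightarrow> a = a' \<and> b = b'"
proof
  assume "quad_int q a b = quad_int q a' b'"
  hence "of_int a + of_int b * (\<i> * of_real (sqrt (real q))) = of_int a' + of_int b' * (\<i> * complex_of_real (sqrt (real q)))"
    by (simp add: quad_int_def csqrt_neg_of_nat)
  hence "real_of_int a = real_of_int a'" "real_of_int b * sqrt (real q) = real_of_int b' * sqrt (real q)"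
    by (simp_all add: complex_eq_iff)
  thus "a = a' \<and> b = b'" using assms by simp
qed simp

lemma quad_int_of_int: "quad_int q (2 * k) 0 = of_int k"
  by (simp add: quad_int_def)

section \<open>Ideals above an odd rational prime\<close>

locale quad_ring =
  fixes q :: nat
  assumes q: "prime q" "q mod 4 = 3"
begin

abbreviation R where "R \<equiv> ring_of_integers (imag_quadratic_field q)"

lemma q_pos: "q > 0" using q by (simp add: prime_gt_0_nat)

lemma R_sel: "carrier R = quad_ints q" "x \<otimes>\<^bsub>R\<^esub> y = x * y" "x \<oplus>\<^bsub>R\<^esub> y = x + y" "\<one>\<^bsub>R\<^esub> = 1" "\<zero>\<^bsub>R\<^esub> = 0"
  unfolding ring_of_integers_def using algebraic_ints_of_field[OF q]
  by (simp_all add: ring_of_type_algebra_def)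

lemma quad_intsI: "even (a - b) \<Longrightarrow> quad_int q a b \<in> quad_ints q"
  unfolding quad_ints_def by blast

lemma quad_intsE:
  assumes "x \<in> quad_ints q" obtains a b where "x = quad_int q a b" "even (a - b)"
  using assms unfolding quad_ints_def by blast

text \<open>The parity of A - B comes from the multiplicativity of the norm: A^2 + q B^2 is 4 times
  the product of the two integral norms.\<close>

lemma quad_int_mult_ex:
  assumes "even (a - b)" "even (a' - b')"
  obtains A B where "2 * A = a * a' - int q * b * b'" "2 * B = a * b' + b * a'" "even (A - B)"
    "quad_int q a b * quad_int q a' b' = quad_int q A B"
proof -
  have oq: "odd (int q)" using q(2) by presburger
  have "even (a * a' - int q * b * b')" "even (a * b' + b * a')" using assms oq by auto
  then obtain A B where AB: "a * a' - int q * b * b' = 2 * A" "a * b' + b * a' = 2 * B" by (elim evenE)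
  have "4 dvd a\<^sup>2 + int q * b\<^sup>2" "4 dvd a'\<^sup>2 + int q * b'\<^sup>2"
    using quadratic_integer_parity[OF q(2)] assms by blast+
  then obtain k l where kl: "a\<^sup>2 + int q * b\<^sup>2 = 4 * k" "a'\<^sup>2 + int q * b'\<^sup>2 = 4 * l" by (elim dvdE)
  have "4 * (A\<^sup>2 + int q * B\<^sup>2) = (2 * A)\<^sup>2 + int q * (2 * B)\<^sup>2" by (simp add: power2_eq_square)
  also have "\<dots> = (a\<^sup>2 + int q * b\<^sup>2) * (a'\<^sup>2 + int q * b'\<^sup>2)"
    unfolding AB[symmetric] by (simp add: power2_eq_square algebra_simps)
  also have "\<dots> = 4 * (4 * (k * l))" unfolding kl by simp
  finally have "A\<^sup>2 + int q * B\<^sup>2 = 4 * (k * l)" by (simp only: mult_left_cancel[of "4 :: int"] zero_neq_numeral)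
  hence "4 dvd A\<^sup>2 + int q * B\<^sup>2" by simp
  hence "even (A - B)" using quadratic_integer_parity[OF q(2)] by blast
  thus ?thesis using that[of A B] AB quad_int_mult[of A a a' q b b' B] by simp
qed

lemma quad_ints_add: "x \<in> quad_ints q \<Longrightarrow> y \<in> quad_ints q \<Longrightarrow> x + y \<in> quad_ints q"
  by (elim quad_intsE) (auto simp: quad_int_add intro!: quad_intsI)

lemma quad_ints_minus: "x \<in> quad_ints q \<Longrightarrow> - x \<in> quad_ints q"
  by (elim quad_intsE) (auto simp: quad_int_minus intro!: quad_intsI)

lemma quad_ints_mult: "x \<in> quad_ints q \<Longrightarrow> y \<in> quad_ints q \<Longrightarrow> x * y \<in> quad_ints q"
proof (elim quad_intsE)
  fix a b a' b' assume "even (a - b)" "even (a' - b')" "x = quad_int q a b" "y = quad_int q a' b'"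
  thus ?thesis using quad_int_mult_ex[of a b a' b'] quad_intsI by metis
qed

lemma quad_ints_of_int: "of_int k \<in> quad_ints q"
  using quad_intsI[of "2 * k" 0] quad_int_of_int[of q k] by simp

lemma R_cring: "cring R"
proof (rule cringI)
  show "abelian_group R"
  proof (rule abelian_groupI; unfold R_sel)
    fix x assume "x \<in> quad_ints q"
    thus "\<exists>y\<in>quad_ints q. y + x = 0" by (intro bexI[of _ "- x"] quad_ints_minus) auto
  qed (use quad_ints_add quad_ints_of_int[of 0] in auto)
  show "comm_monoid R"
    by (rule comm_monoidI; unfold R_sel)
       (use quad_ints_mult quad_ints_of_int[of 1] in auto)
qed (auto simp: R_sel algebra_simps)

sublocale R: cring R by (rule R_cring)

lemma R_a_inv: "x \<in> quad_ints q \<Longrightarrow> \<ominus>\<^bsub>R\<^esub> x = - x"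
  by (rule R.minus_equality) (auto simp: R_sel quad_ints_minus)

lemma R_idealI:
  assumes "I \<subseteq> quad_ints q" "0 \<in> I" "\<And>x y. x \<in> I \<Longrightarrow> y \<in> I \<Longrightarrow> x + y \<in> I"
    and "\<And>x y. x \<in> I \<Longrightarrow> y \<in> quad_ints q \<Longrightarrow> y * x \<in> I"
  shows "ideal I R"
proof (rule idealI)
  show "subgroup I (add_monoid R)"
  proof (rule subgroup.intro)
    show "I \<subseteq> carrier (add_monoid R)" using assms(1) by (simp add: R_sel)
    show "x \<otimes>\<^bsub>add_monoid R\<^esub> y \<in> I" if "x \<in> I" "y \<in> I" for x y
      using assms(3)[OF that] by (simp add: R_sel)
    show "\<one>\<^bsub>add_monoid R\<^esub> \<in> I" using assms(2) by (simp add: R_sel)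
    show "inv\<^bsub>add_monoid R\<^esub> x \<in> I" if "x \<in> I" for x
    proof -
      have "inv\<^bsub>add_monoid R\<^esub> x = - x" using R_a_inv[of x] that assms(1) by (auto simp: a_inv_def)
      thus ?thesis using assms(4)[OF that quad_ints_of_int[of "-1"]] by simp
    qed
  qed
qed (use assms(4) in \<open>auto simp: R_sel mult.commute R.ring_axioms\<close>)

lemma principal_ideal_eq: "cgenideal R (of_nat p) = {x * of_nat p | x. x \<in> quad_ints q}"
  by (simp add: cgenideal_def R_sel)

lemma principal_ideal_iff:
  assumes p: "odd p" and ab: "even (a - b)"
  shows "quad_int q a b \<in> cgenideal R (of_nat p) \<longleftrightarrow> int p dvd a \<and> int p dvd b"
proof
  assume "quad_int q a b \<in> cgenideal R (of_nat p)"
  then obtain x where "x \<in> quad_ints q" "quad_int q a b = x * of_nat p" unfolding principal_ideal_eq by blast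
  then obtain c d where "x = quad_int q c d" by (elim quad_intsE)
  hence "quad_int q a b = quad_int q c d * of_nat p" using \<open>quad_int q a b = x * of_nat p\<close> by simp
  also have "\<dots> = quad_int q (int p * c) (int p * d)" by (simp add: quad_int_def algebra_simps)
  finally show "int p dvd a \<and> int p dvd b" using quad_int_eq_iff[OF q_pos] by simp
next
  assume "int p dvd a \<and> int p dvd b"
  then obtain c d where cd: "a = int p * c" "b = int p * d" by (elim conjE dvdE)
  hence "even (c - d)" using ab p by (simp flip: right_diff_distrib)
  moreover have "quad_int q a b = quad_int q c d * of_nat p" by (simp add: cd quad_int_def algebra_simps)
  ultimately show "quad_int q a b \<in> cgenideal R (of_nat p)" unfolding principal_ideal_eq using quad_intsI by blast
qed

text \<open>
  The kernel of the reduction \<open>\<sqrt>-q \<mapsto> c\<close> into the field with \<open>p\<close> elements, when \<open>c\<^sup>2 = -q\<close> modulo \<open>p\<close>.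
\<close>

definition residue_ideal :: "nat \<Rightarrow> int \<Rightarrow> complex set" where
  "residue_ideal p c = {quad_int q a b | a b. even (a - b) \<and> int p dvd a + b * c}"

lemma residue_ideal_iff: "quad_int q a b \<in> residue_ideal p c \<longleftrightarrow> even (a - b) \<and> int p dvd a + b * c"
  unfolding residue_ideal_def using quad_int_eq_iff[OF q_pos] by auto

text \<open>The reduction sending sqrt(-q) to c is multiplicative modulo p because c^2 = -q there.
  The factor 2 coming from the halves is invertible as p is odd.\<close>

lemma residue_ideal_mult:
  assumes p: "odd p" and c: "int p dvd c\<^sup>2 + int q"
    and AB: "2 * A = a * a' - int q * b * b'" "2 * B = a * b' + b * a'"
  shows "int p dvd A + B * c \<longleftrightarrow> int p dvd (a + b * c) * (a' + b' * c)"
proof -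
  have "2 * (A + B * c) = (2 * A) + (2 * B) * c" by (simp add: algebra_simps)
  also have "\<dots> = (a + b * c) * (a' + b' * c) - b * b' * (c\<^sup>2 + int q)"
    unfolding AB by (simp add: power2_eq_square algebra_simps)
  finally have eq: "2 * (A + B * c) = (a + b * c) * (a' + b' * c) - b * b' * (c\<^sup>2 + int q)" .
  have "coprime (int p) 2" using p by simp
  hence "int p dvd A + B * c \<longleftrightarrow> int p dvd 2 * (A + B * c)" by (rule coprime_dvd_mult_right_iff[symmetric])
  also have "\<dots> \<longleftrightarrow> int p dvd (a + b * c) * (a' + b' * c)"
    unfolding eq using c by (metis dvd_mult dvd_diff dvd_add diff_add_cancel)
  finally show ?thesis .
qed

lemma residue_ideal_prime:
  assumes p: "prime p" "odd p" and c: "int p dvd c\<^sup>2 + int q"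
  shows "primeideal (residue_ideal p c) R"
proof (rule primeidealI)
  show "ideal (residue_ideal p c) R"
  proof (rule R_idealI)
    show "residue_ideal p c \<subseteq> quad_ints q" by (auto simp: residue_ideal_def quad_ints_def)
    show "0 \<in> residue_ideal p c" using residue_ideal_iff[of 0 0 p c] by (simp add: quad_int_def)
    show "x + y \<in> residue_ideal p c" if m: "x \<in> residue_ideal p c" "y \<in> residue_ideal p c" for x y
    proof -
      obtain a b a' b' where xy: "x = quad_int q a b" "even (a - b)" "int p dvd a + b * c"
        "y = quad_int q a' b'" "even (a' - b')" "int p dvd a' + b' * c"
        using m unfolding residue_ideal_def by blast
      have "(a + a') + (b + b') * c = (a + b * c) + (a' + b' * c)" by (simp add: algebra_simps)
      hence "int p dvd (a + a') + (b + b') * c" using xy by (metis dvd_add)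
      thus ?thesis using xy by (simp add: quad_int_add residue_ideal_iff)
    qed
    show "y * x \<in> residue_ideal p c" if m: "x \<in> residue_ideal p c" "y \<in> quad_ints q" for x y
    proof -
      obtain a b a' b' where xy: "x = quad_int q a b" "even (a - b)" "int p dvd a + b * c"
        "y = quad_int q a' b'" "even (a' - b')"
        using m unfolding residue_ideal_def quad_ints_def by blast
      obtain A B where AB: "2 * A = a' * a - int q * b' * b" "2 * B = a' * b + b' * a" "even (A - B)"
        "quad_int q a' b' * quad_int q a b = quad_int q A B"
        using quad_int_mult_ex[OF xy(5,2)] by blast
      have "int p dvd A + B * c" using residue_ideal_mult[OF p(2) c AB(1,2)] xy(3) by simp
      thus ?thesis using AB xy by (simp add: residue_ideal_iff)
    qed
  qed
  show "cring R" by (rule R_cring)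
  \<comment> \<open>\<open>quad_int q 2 0\<close> is the number 1, whose numerator 2 is not
    divisible by p.\<close>
  have "quad_int q 2 0 \<in> quad_ints q" by (intro quad_intsI) simp
  moreover have "p \<noteq> 2" using p(2) by auto
  hence "\<not> int p dvd 2" using zdvd_imp_le[of "int p" 2] prime_gt_1_nat[OF p(1)] by auto
  hence "quad_int q 2 0 \<notin> residue_ideal p c" by (simp add: residue_ideal_iff)
  ultimately show "carrier R \<noteq> residue_ideal p c" by (auto simp: R_sel)
next
  fix x y assume "x \<in> carrier R" "y \<in> carrier R" "x \<otimes>\<^bsub>R\<^esub> y \<in> residue_ideal p c"
  hence xy: "x \<in> quad_ints q" "y \<in> quad_ints q" "x * y \<in> residue_ideal p c" by (simp_all add: R_sel)
  obtain a b where x: "x = quad_int q a b" "even (a - b)" using xy(1) by (rule quad_intsE)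
  obtain a' b' where y: "y = quad_int q a' b'" "even (a' - b')" using xy(2) by (rule quad_intsE)
  obtain A B where AB: "2 * A = a * a' - int q * b * b'" "2 * B = a * b' + b * a'" "even (A - B)"
    "quad_int q a b * quad_int q a' b' = quad_int q A B"
    using quad_int_mult_ex[OF x(2) y(2)] by blast
  have "int p dvd (a + b * c) * (a' + b' * c)"
    using xy(3) residue_ideal_mult[OF p(2) c AB(1,2)] by (simp add: x y AB(4) residue_ideal_iff)
  hence "int p dvd a + b * c \<or> int p dvd a' + b' * c" using p(1) by (simp add: prime_dvd_mult_iff)
  thus "x \<in> residue_ideal p c \<or> y \<in> residue_ideal p c" using x y by (simp add: residue_ideal_iff)
qed

lemma root_not_dvd:
  assumes p: "prime p" "p \<noteq> q" and c: "int p dvd c\<^sup>2 + int q"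
  shows "\<not> int p dvd c"
proof
  assume "int p dvd c"
  hence "int p dvd int q" using c by (simp add: power2_eq_square dvd_add_right_iff)
  hence "p dvd q" by simp
  thus False using p q primes_dvd_imp_eq by blast
qed

text \<open>A product of generators lies in both ideals, so p divides A + B c and A - B c, hence A
  and B. Conversely the product ideal contains p^2 and p (c + sqrt(-q)) + p (c - sqrt(-q)) = 2 c p,
  and a Bezout combination of p and 2c produces p itself.\<close>

lemma ideal_prod_residue_ideals:
  assumes p: "prime p" "odd p" "p \<noteq> q" and c: "int p dvd c\<^sup>2 + int q"
  shows "ideal_prod R (residue_ideal p c) (residue_ideal p (- c)) = cgenideal R (of_nat p)"
proof -
  have c': "int p dvd (- c)\<^sup>2 + int q" using c by simp
  have pc: "\<not> int p dvd c" by (rule root_not_dvd[OF p(1,3) c])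
  have pp: "prime (int p)" using p by simp
  note id = residue_ideal_prime[OF p(1,2) c] residue_ideal_prime[OF p(1,2) c']
  have ideals: "ideal (residue_ideal p c) R" "ideal (residue_ideal p (- c)) R"
    using id by (simp_all add: primeideal.axioms(1))
  have prod_ideal: "ideal (ideal_prod R (residue_ideal p c) (residue_ideal p (- c))) R"
    by (rule R.ideal_prod_is_ideal[OF ideals])
  have pideal: "ideal (cgenideal R (of_nat p)) R"
    using quad_ints_of_int[of "int p"] by (intro R.cgenideal_ideal) (simp add: R_sel)
  show ?thesis
  proof (rule subset_antisym; rule subsetI)
    fix x assume "x \<in> ideal_prod R (residue_ideal p c) (residue_ideal p (- c))"
    thus "x \<in> cgenideal R (of_nat p)"
    proof (induction rule: ideal_prod.induct)
      case (prod x y)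
      obtain a b a' b' where xy: "x = quad_int q a b" "even (a - b)" "int p dvd a + b * c"
        "y = quad_int q a' b'" "even (a' - b')" "int p dvd a' + b' * (- c)"
        using prod unfolding residue_ideal_def by blast
      obtain A B where AB: "2 * A = a * a' - int q * b * b'" "2 * B = a * b' + b * a'" "even (A - B)"
        "quad_int q a b * quad_int q a' b' = quad_int q A B"
        using quad_int_mult_ex[OF xy(2,5)] by blast
      have 1: "int p dvd A + B * c" using residue_ideal_mult[OF p(2) c AB(1,2)] xy(3) by simp
      have 2: "int p dvd A + B * (- c)" using residue_ideal_mult[OF p(2) c' AB(1,2)] xy(6) by simp
      have "int p dvd (A + B * c) + (A + B * (- c))" "int p dvd (A + B * c) - (A + B * (- c))"
        using 1 2 by (rule dvd_add, intro dvd_diff 1 2)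
      hence "int p dvd 2 * A" "int p dvd 2 * (B * c)" by (simp_all add: algebra_simps)
      moreover have "coprime (int p) 2" using p by simp
      ultimately have "int p dvd A" "int p dvd B * c" using coprime_dvd_mult_right_iff by blast+
      hence "int p dvd A" "int p dvd B" using pp pc by (simp_all add: prime_dvd_mult_iff)
      thus ?case unfolding R_sel xy AB(4) using principal_ideal_iff[OF p(2) AB(3)] by simp
    next
      case (sum x y)
      thus ?case using additive_subgroup.a_closed[OF ideal.axioms(1)[OF pideal]] by blast
    qed
  next
    let ?I = "ideal_prod R (residue_ideal p c) (residue_ideal p (- c))"
    have add: "x + y \<in> ?I" if "x \<in> ?I" "y \<in> ?I" for x y
      using additive_subgroup.a_closed[OF ideal.axioms(1)[OF prod_ideal] that] by (simp add: R_sel)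
    have mul: "y * x \<in> ?I" if "x \<in> ?I" "y \<in> quad_ints q" for x y
      using ideal.I_l_closed[OF prod_ideal that(1)] that(2) by (simp add: R_sel)
    have m: "x * y \<in> ?I" if "x \<in> residue_ideal p c" "y \<in> residue_ideal p (- c)" for x y
      using ideal_prod.prod[OF that, of R] by (simp add: R_sel)
    have pin: "quad_int q (2 * int p) 0 \<in> residue_ideal p c'" for c'
      by (simp add: residue_ideal_iff)
    have "quad_int q (2 * c) (- 2) \<in> residue_ideal p c" "quad_int q (2 * c) 2 \<in> residue_ideal p (- c)"
      by (simp_all add: residue_ideal_iff)
    from m[OF pin pin] m[OF pin this(2)] m[OF this(1) pin]
    have I: "of_nat p * of_nat p \<in> ?I" "of_nat p * quad_int q (2 * c) 2 \<in> ?I" "quad_int q (2 * c) (- 2) * of_nat p \<in> ?I"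
      by (simp_all add: quad_int_of_int)
    have "of_nat p * quad_int q (2 * c) 2 + quad_int q (2 * c) (- 2) * of_nat p \<in> ?I" by (intro add I)
    also have "of_nat p * quad_int q (2 * c) 2 + quad_int q (2 * c) (- 2) * of_nat p = of_int (2 * c) * of_nat p"
      by (simp add: quad_int_def algebra_simps)
    finally have I2: "of_int (2 * c) * of_nat p \<in> ?I" .
    have "coprime (int p) c" using pp pc by (rule prime_imp_coprime)
    hence "coprime (int p) (2 * c)" using p by (simp add: coprime_mult_right_iff)
    then obtain u v where uv: "u * int p + v * (2 * c) = 1" using bezout_int[of "int p" "2 * c"] by auto
    have "of_int u * (of_nat p * of_nat p) + of_int v * (of_int (2 * c) * of_nat p) \<in> ?I"
      by (intro add mul quad_ints_of_int I I2)
    also have "of_int u * (of_nat p * of_nat p) + of_int v * (of_int (2 * c) * of_nat p) = of_int (u * int p + v * (2 * c)) * (of_nat p :: complex)"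
      by (simp add: algebra_simps)
    finally have pI: "of_nat p \<in> ?I" unfolding uv by simp
    fix x assume "x \<in> cgenideal R (of_nat p)"
    thus "x \<in> ?I" unfolding principal_ideal_eq using mul[OF pI] by blast
  qed
qed

text \<open>If p did not divide b, an inverse u of b modulo p would give (u a)^2 = -q modulo
  p.\<close>

lemma inert_dvd_norm:
  assumes p: "prime p" and nonres: "\<nexists>c. int p dvd c\<^sup>2 + int q" and dvd: "int p dvd a\<^sup>2 + int q * b\<^sup>2"
  shows "int p dvd a \<and> int p dvd b"
proof -
  have pp: "prime (int p)" using p by simp
  have b: "int p dvd b"
  proof (rule ccontr)
    assume "\<not> int p dvd b"
    with pp have "coprime (int p) b" by (rule prime_imp_coprime)
    then obtain u v where "u * int p + v * b = 1" using bezout_int[of "int p" b] by auto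
    then obtain u v where uv: "u * b + v * int p = 1" by (metis add.commute)
    have "(u * a)\<^sup>2 + int q = u\<^sup>2 * (a\<^sup>2 + int q * b\<^sup>2) + int q * (1 - (u * b)\<^sup>2)"
      by (simp add: power2_eq_square algebra_simps)
    also have "1 - (u * b)\<^sup>2 = v * int p * (1 + u * b)"
    proof -
      have e: "v * int p = 1 - u * b" using uv by simp
      show ?thesis unfolding e by (simp add: power2_eq_square algebra_simps)
    qed
    finally have "int p dvd (u * a)\<^sup>2 + int q" using dvd by simp
    thus False using nonres by blast
  qed
  hence "int p dvd a\<^sup>2" using dvd by (simp add: power2_eq_square dvd_add_left_iff)
  thus ?thesis using b pp by (simp add: prime_dvd_power_iff)
qed

text \<open>If -q is not a square modulo p, then (p) is prime: by multiplicativity p divides the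
  norm of one of the factors, and therefore both of its coordinates.\<close>

lemma inert_principal_prime:
  assumes p: "prime p" "odd p" and nonres: "\<nexists>c. int p dvd c\<^sup>2 + int q"
    and xy: "x \<in> quad_ints q" "y \<in> quad_ints q" "x * y \<in> cgenideal R (of_nat p)"
  shows "x \<in> cgenideal R (of_nat p) \<or> y \<in> cgenideal R (of_nat p)"
proof -
  obtain a b where x: "x = quad_int q a b" "even (a - b)" using xy(1) by (rule quad_intsE)
  obtain a' b' where y: "y = quad_int q a' b'" "even (a' - b')" using xy(2) by (rule quad_intsE)
  obtain A B where AB: "2 * A = a * a' - int q * b * b'" "2 * B = a * b' + b * a'" "even (A - B)"
    "quad_int q a b * quad_int q a' b' = quad_int q A B"
    using quad_int_mult_ex[OF x(2) y(2)] by blast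
  have "int p dvd A" "int p dvd B" using xy(3) principal_ideal_iff[OF p(2) AB(3)] by (auto simp: x y AB(4))
  moreover have "(a\<^sup>2 + int q * b\<^sup>2) * (a'\<^sup>2 + int q * b'\<^sup>2) = (2 * A)\<^sup>2 + int q * (2 * B)\<^sup>2"
    unfolding AB by (simp add: power2_eq_square algebra_simps)
  ultimately have "int p dvd (a\<^sup>2 + int q * b\<^sup>2) * (a'\<^sup>2 + int q * b'\<^sup>2)"
    by (simp add: power2_eq_square)
  hence "int p dvd a\<^sup>2 + int q * b\<^sup>2 \<or> int p dvd a'\<^sup>2 + int q * b'\<^sup>2"
    using p by (simp add: prime_dvd_mult_iff)
  thus ?thesis using inert_dvd_norm[OF p(1) nonres] principal_ideal_iff[OF p(2)] x y by metis
qed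

text \<open>I contained in (p) implies I J contained in p J. This permits cancelling p, since p in p
  J means 1 in J.\<close>

lemma ideal_prod_subset_scaled:
  assumes I: "\<And>x. x \<in> I \<Longrightarrow> \<exists>w\<in>quad_ints q. x = w * of_nat p" and J: "ideal J R"
    and x: "x \<in> ideal_prod R I J"
  shows "\<exists>w\<in>J. x = w * of_nat p"
  using x
proof (induction rule: ideal_prod.induct)
  case (prod i j)
  obtain w where "w \<in> quad_ints q" "i = w * of_nat p" using I[OF prod(1)] by blast
  moreover have "w * j \<in> J" using ideal.I_l_closed[OF J prod(2)] \<open>w \<in> quad_ints q\<close> by (simp add: R_sel)
  ultimately show ?case by (intro bexI[of _ "w * j"]) (auto simp: R_sel)
next
  case (sum s t)
  then obtain v w where "v \<in> J" "w \<in> J" "s = v * of_nat p" "t = w * of_nat p" by blast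
  moreover have "v + w \<in> J"
    using additive_subgroup.a_closed[OF ideal.axioms(1)[OF J] \<open>v \<in> J\<close> \<open>w \<in> J\<close>] by (simp add: R_sel)
  ultimately show ?case by (intro bexI[of _ "v + w"]) (auto simp: R_sel algebra_simps)
qed

lemma one_in_ideal:
  assumes "ideal J R" "1 \<in> J"
  shows "J = carrier R"
proof
  show "J \<subseteq> carrier R" using additive_subgroup.a_subset[OF ideal.axioms(1)[OF assms(1)]] .
  show "carrier R \<subseteq> J" using ideal.I_l_closed[OF assms] by (auto simp: R_sel)
qed

text \<open>For a square -q the two residue ideals at c and -c are distinct with product (p).
  Otherwise (p) is prime, so a factorisation (p) = P1 P2 has one factor inside (p), and cancelling p
  makes the other the whole ring.\<close>

theorem splits_iff:
  assumes p: "prime p" "odd p" "p \<noteq> q"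
  shows "splits_in_quadratic_field p (imag_quadratic_field q) \<longleftrightarrow> (\<exists>c. int p dvd c\<^sup>2 + int q)"
proof
  assume "\<exists>c. int p dvd c\<^sup>2 + int q"
  then obtain c where c: "int p dvd c\<^sup>2 + int q" by blast
  have c': "int p dvd (- c)\<^sup>2 + int q" using c by simp
  have pc: "\<not> int p dvd c" by (rule root_not_dvd[OF p(1,3) c])
  have "quad_int q (2 * c) (- 2) \<in> residue_ideal p c" by (simp add: residue_ideal_iff)
  moreover have "quad_int q (2 * c) (- 2) \<notin> residue_ideal p (- c)"
  proof
    assume "quad_int q (2 * c) (- 2) \<in> residue_ideal p (- c)"
    hence "int p dvd 2 * c + 2 * c" by (simp add: residue_ideal_iff)
    hence "int p dvd 2 * (2 * c)" by (simp only: mult_2)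
    moreover have "coprime (int p) 2" using p by simp
    ultimately show False using pc coprime_dvd_mult_right_iff by blast
  qed
  ultimately have "residue_ideal p c \<noteq> residue_ideal p (- c)" by blast
  thus "splits_in_quadratic_field p (imag_quadratic_field q)"
    unfolding splits_in_quadratic_field_def
    using residue_ideal_prime[OF p(1,2) c] residue_ideal_prime[OF p(1,2) c'] ideal_prod_residue_ideals[OF p c] by metis
next
  assume "splits_in_quadratic_field p (imag_quadratic_field q)"
  then obtain P1 P2 where P: "primeideal P1 R" "primeideal P2 R" "cgenideal R (of_nat p) = ideal_prod R P1 P2"
    unfolding splits_in_quadratic_field_def by blast
  have id: "ideal P1 R" "ideal P2 R" using P by (simp_all add: primeideal.axioms(1))
  have sub: "P1 \<subseteq> quad_ints q" "P2 \<subseteq> quad_ints q"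
    using additive_subgroup.a_subset[OF ideal.axioms(1)] id by (auto simp flip: R_sel(1))
  show "\<exists>c. int p dvd c\<^sup>2 + int q"
  proof (rule ccontr)
    assume nonres: "\<nexists>c. int p dvd c\<^sup>2 + int q"
    have pI: "of_nat p \<in> ideal_prod R P1 P2" unfolding P(3)[symmetric] principal_ideal_eq
      using quad_ints_of_int[of 1] by (auto intro!: exI[of _ 1])
    have p0: "(of_nat p :: complex) \<noteq> 0" using p prime_gt_0_nat[of p] by simp
    have "P1 \<subseteq> cgenideal R (of_nat p) \<or> P2 \<subseteq> cgenideal R (of_nat p)"
    proof (rule ccontr)
      assume "\<not> ?thesis"
      then obtain x y where xy: "x \<in> P1" "y \<in> P2" "x \<notin> cgenideal R (of_nat p)" "y \<notin> cgenideal R (of_nat p)" by blast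
      have "x * y \<in> cgenideal R (of_nat p)" using ideal_prod.prod[OF xy(1,2), of R] P(3) by (simp add: R_sel)
      thus False using inert_principal_prime[OF p(1,2) nonres, of x y] xy sub by blast
    qed
    thus False
    proof
      assume "P1 \<subseteq> cgenideal R (of_nat p)"
      hence "\<exists>w\<in>P2. (of_nat p :: complex) = w * of_nat p"
        using pI by (intro ideal_prod_subset_scaled[of P1 p, OF _ id(2)]) (auto simp: principal_ideal_eq)
      hence "1 \<in> P2" using p0 by simp
      thus False using one_in_ideal[OF id(2)] primeideal.I_notcarr[OF P(2)] by simp
    next
      assume "P2 \<subseteq> cgenideal R (of_nat p)"
      hence "\<exists>w\<in>P1. (of_nat p :: complex) = w * of_nat p"
        using pI R.ideal_prod_commute[OF id] by (intro ideal_prod_subset_scaled[of P2 p, OF _ id(1)]) (auto simp: principal_ideal_eq)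
      hence "1 \<in> P1" using p0 by simp
      thus False using one_in_ideal[OF id(1)] primeideal.I_notcarr[OF P(1)] by simp
    qed
  qed
qed

end

text \<open>As (q - 1) / 2 is odd, the sign in quadratic reciprocity is \<open>(-1) ^ m\<close>;
  Euler's criterion shows that replacing q by -q gives the same sign, and the two cancel. The
  congruence modulo p is an equality because the two sides differ by at most 2.\<close>

lemma Legendre_neg_reciprocity:
  fixes p q :: nat
  assumes p: "prime p" "p > 2" and q: "prime q" "q mod 4 = 3" and pq: "p \<noteq> q"
  shows "Legendre (- int q) (int p) = Legendre (int p) (int q)"
proof -
  have q2: "q > 2" using q by (cases "q \<le> 2") (auto simp: le_Suc_eq numeral_2_eq_2)
  define m where "m = (p - 1) div 2"
  have odd: "odd ((q - 1) div 2)" using q(2) by presburger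
  have rec: "Legendre (int p) (int q) * Legendre (int q) (int p) = (-1) ^ m"
  proof -
    have "(-1 :: int) ^ (m * ((q - 1) div 2)) = (-1) ^ m"
      using odd by (cases "even m") auto
    thus ?thesis using Quadratic_Reciprocity[OF p q(1) q2 pq] by (simp only: m_def)
  qed
  have unit: "Legendre a (int p) \<in> {-1, 0, 1}" for a by (auto simp: Legendre_def)
  have np: "\<not> int p dvd int q" using p q pq primes_dvd_imp_eq by auto
  have euler: "[Legendre a (int p) = a ^ m] (mod (int p))" for a
    using euler_criterion[OF p, of a] by (simp add: m_def)
  have "[Legendre (- int q) (int p) = (-1) ^ m * (int q) ^ m] (mod (int p))"
    using euler[of "- int q"] by (simp add: power_mult_distrib[symmetric])
  moreover have "[(-1) ^ m * (int q) ^ m = (-1) ^ m * Legendre (int q) (int p)] (mod (int p))"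
    using euler[of "int q"] by (intro cong_mult cong_refl) (simp add: cong_sym)
  ultimately have "[Legendre (- int q) (int p) = (-1) ^ m * Legendre (int q) (int p)] (mod (int p))"
    by (rule cong_trans)
  hence d: "int p dvd Legendre (- int q) (int p) - (-1) ^ m * Legendre (int q) (int p)"
    by (simp add: cong_iff_dvd_diff)
  have s: "(-1 :: int) ^ m \<in> {-1, 1}" by (cases "even m") auto
  have "\<bar>Legendre (- int q) (int p) - (-1) ^ m * Legendre (int q) (int p)\<bar> \<le> 2"
    using unit[of "- int q"] unit[of "int q"] s by auto
  hence "Legendre (- int q) (int p) = (-1) ^ m * Legendre (int q) (int p)"
    using d p(2) zdvd_imp_le[of "int p" "\<bar>Legendre (- int q) (int p) - (-1) ^ m * Legendre (int q) (int p)\<bar>"]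
    by (cases "Legendre (- int q) (int p) - (-1) ^ m * Legendre (int q) (int p) = 0") auto
  moreover have "Legendre (int q) (int p) * Legendre (int q) (int p) = 1"
    using np by (auto simp: Legendre_def cong_0_iff)
  hence "(-1) ^ m * Legendre (int q) (int p) = Legendre (int p) (int q)"
    unfolding rec[symmetric] by (simp add: mult.assoc)
  ultimately show ?thesis by simp
qed

lemma splits_iff_Legendre:
  fixes p q :: nat
  assumes p: "prime p" "p > 2" and q: "prime q" "q mod 4 = 3" and pq: "p \<noteq> q"
  shows "splits_in_quadratic_field p (imag_quadratic_field q) \<longleftrightarrow> Legendre (int p) (int q) = 1"
proof -
  interpret quad_ring q using q by unfold_locales
  have "odd p" using p prime_odd_nat by auto
  hence "splits_in_quadratic_field p (imag_quadratic_field q) \<longleftrightarrow> (\<exists>c. int p dvd c\<^sup>2 + int q)"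
    using splits_iff p pq by blast
  also have "\<dots> \<longleftrightarrow> QuadRes (int p) (- int q)"
    by (simp add: QuadRes_def cong_iff_dvd_diff)
  also have "\<dots> \<longleftrightarrow> Legendre (- int q) (int p) = 1"
  proof -
    have "\<not> int p dvd int q" using p q pq primes_dvd_imp_eq by auto
    thus ?thesis by (simp add: Legendre_def cong_0_iff)
  qed
  finally show ?thesis using Legendre_neg_reciprocity[OF p q pq] by simp
qed

section \<open>Split primes as a character sum\<close>

definition character_prime_sum :: "nat \<Rightarrow> real \<Rightarrow> int" where
  "character_prime_sum q x = (\<Sum>p | prime p \<and> real p \<le> x. Legendre (int p) (int q))"

text \<open>The indicator of splitting is (1 + chi(p)) / 2 except possibly at p = 2 and p = q, each
  of which costs at most 2 after doubling.\<close>

lemma split_prime_count_eq: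
  assumes q: "prime q" "q mod 4 = 3"
  shows "\<bar>2 * real (split_prime_count q x) - (real (prime_count x) + of_int (character_prime_sum q x))\<bar> \<le> 4"
proof -
  define P where "P = {p. prime p \<and> real p \<le> x}"
  define S where "S = {p\<in>P. splits_in_quadratic_field p (imag_quadratic_field q)}"
  have fin: "finite P" unfolding P_def by (rule finite_primes_le)
  let ?f = "\<lambda>p. 2 * (if p \<in> S then 1 else 0) - (1 + of_int (Legendre (int p) (int q))) :: real"
  have "real (split_prime_count q x) = (\<Sum>p\<in>P. if p \<in> S then 1 else 0)"
  proof -
    have "split_prime_count q x = card S" by (simp add: split_prime_count_def S_def P_def)
    also have "real (card S) = (\<Sum>p\<in>P. if p \<in> S then 1 else 0)"
      using fin by (simp add: sum.If_cases S_def Int_def)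
    finally show ?thesis .
  qed
  hence "2 * real (split_prime_count q x) - (real (prime_count x) + of_int (character_prime_sum q x)) = (\<Sum>p\<in>P. ?f p)"
    by (simp add: character_prime_sum_def P_def prime_count_def sum.distrib sum_subtractf sum_distrib_left)
  also have "\<dots> = (\<Sum>p\<in>P \<inter> {2, q}. ?f p)"
  proof (rule sum.mono_neutral_right[OF fin])
    show "\<forall>p\<in>P - P \<inter> {2, q}. ?f p = 0"
    proof
      fix p assume p: "p \<in> P - P \<inter> {2, q}"
      hence pp: "prime p" "p \<noteq> q" "p > 2" using prime_ge_2_nat[of p] by (auto simp: P_def)
      have "\<not> int q dvd int p" using pp q primes_dvd_imp_eq by auto
      hence "Legendre (int p) (int q) \<in> {-1, 1}" by (auto simp: Legendre_def cong_0_iff)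
      moreover have "p \<in> S \<longleftrightarrow> Legendre (int p) (int q) = 1"
        using splits_iff_Legendre[OF pp(1,3) q pp(2)] p by (auto simp: S_def)
      ultimately show "?f p = 0" by auto
    qed
  qed auto
  also have "\<bar>\<dots>\<bar> \<le> (\<Sum>p\<in>P \<inter> {2, q}. 2)"
  proof (rule order_trans[OF sum_abs sum_mono])
    fix p show "\<bar>?f p\<bar> \<le> 2" by (auto simp: Legendre_def)
  qed
  also have "\<dots> \<le> 4"
  proof -
    have "card (P \<inter> {2, q}) \<le> card {2, q}" by (intro card_mono) auto
    also have "\<dots> \<le> 2" by (simp add: card_insert_if)
    finally show ?thesis by simp
  qed
  finally show ?thesis by (simp add: P_def)
qed

section \<open>Selberg weights\<close>

definition moebius_mu :: "nat \<Rightarrow> real" where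
  "moebius_mu n = (if squarefree n then (-1) ^ card (prime_factors n) else 0)"

lemma moebius_mu_1: "moebius_mu (Suc 0) = 1"
  by (simp add: moebius_mu_def)

lemma abs_moebius_mu_le: "\<bar>moebius_mu n\<bar> \<le> 1"
  by (simp add: moebius_mu_def power_abs)

lemma moebius_mu_square: "moebius_mu n ^ 2 = (if squarefree n then 1 else 0)"
  by (simp add: moebius_mu_def flip: power_mult)

lemma moebius_mu_prime_mult:
  assumes p: "prime p" and e: "squarefree e" "\<not> p dvd e"
  shows "moebius_mu (p * e) = - moebius_mu e"
proof -
  have cop: "coprime p e" using p e by (simp add: prime_imp_coprime)
  have sq: "squarefree (p * e)" by (rule squarefree_mult_coprime[OF cop squarefree_prime[OF p] e(1)])
  have e0: "e \<noteq> 0" using e by (cases "e = 0") auto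
  have "prime_factors (p * e) = insert p (prime_factors e)"
    using p e0 by (simp add: prime_factors_product prime_prime_factors)
  moreover have "p \<notin> prime_factors e" using e by auto
  ultimately show ?thesis using sq e by (simp add: moebius_mu_def)
qed

text \<open>For a prime p dividing n, the squarefree divisors pair off as e and p e with p not
  dividing e, and the pairs cancel.\<close>

lemma sum_moebius_mu_divisors:
  assumes n: "n > 0"
  shows "(\<Sum>d | d dvd n. moebius_mu d) = (if n = 1 then 1 else 0)"
proof (cases "n = 1")
  case True
  thus ?thesis by (simp add: moebius_mu_1)
next
  case False
  then obtain p where p: "prime p" "p dvd n" using prime_factor_nat[of n] by blast
  define D where "D = {d. d dvd n \<and> squarefree d}"
  define D1 where "D1 = {d\<in>D. \<not> p dvd d}"
  define D2 where "D2 = {d\<in>D. p dvd d}"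
  have fin: "finite {d. d dvd n}" using n by simp
  have finD: "finite D" by (rule finite_subset[OF _ fin]) (auto simp: D_def)
  have "(\<Sum>d | d dvd n. moebius_mu d) = (\<Sum>d\<in>D. moebius_mu d)"
    using fin by (intro sum.mono_neutral_right) (auto simp: D_def moebius_mu_def)
  also have "\<dots> = (\<Sum>d\<in>D1. moebius_mu d) + (\<Sum>d\<in>D2. moebius_mu d)"
  proof -
    have "D = D1 \<union> D2" "D1 \<inter> D2 = {}" by (auto simp: D1_def D2_def)
    thus ?thesis using finD by (metis sum.union_disjoint finite_Un)
  qed
  also have "(\<Sum>d\<in>D2. moebius_mu d) = (\<Sum>e\<in>D1. moebius_mu (p * e))"
  proof (rule sum.reindex_bij_witness[of _ "\<lambda>e. p * e" "\<lambda>d. d div p"])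
    fix d assume d: "d \<in> D2"
    then obtain e where e: "d = p * e" by (auto simp: D2_def)
    have p0: "p > 0" using p prime_gt_0_nat by blast
    show "p * (d div p) = d" using d by (auto simp: D2_def)
    have de: "d div p = e" using e p0 by simp
    have "squarefree (p * e)" "p * e dvd n" using d e by (auto simp: D2_def D_def)
    moreover have "\<not> p dvd e"
    proof
      assume "p dvd e"
      then obtain f where "e = p * f" by blast
      hence "p ^ 2 dvd p * e" by (simp add: power2_eq_square)
      hence "p dvd 1" using \<open>squarefree (p * e)\<close> unfolding squarefree_def by blast
      thus False using p by simp
    qed
    ultimately show "d div p \<in> D1" unfolding de D1_def D_def
      using squarefree_mono[of e "p * e"] by (auto dest: dvd_mult_right)
    show "moebius_mu (p * (d div p)) = moebius_mu d" using d by (auto simp: D2_def)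
  next
    fix e assume e: "e \<in> D1"
    have p0: "p > 0" using p prime_gt_0_nat by blast
    show "p * e div p = e" using p0 by simp
    have "coprime p e" using p(1) e by (auto simp: D1_def intro: prime_imp_coprime)
    hence "p * e dvd n" "squarefree (p * e)"
      using e p by (auto simp: D1_def D_def intro: divides_mult squarefree_mult_coprime squarefree_prime)
    thus "p * e \<in> D2" by (simp add: D2_def D_def)
  qed
  also have "\<dots> = (\<Sum>e\<in>D1. - moebius_mu e)"
    using p by (intro sum.cong refl moebius_mu_prime_mult) (auto simp: D1_def D_def)
  finally show ?thesis using False by (simp add: sum_negf)
qed

text \<open>
  The weights minimise the quadratic form \<open>\<Sum> \<lambda>\<^sub>d \<lambda>\<^sub>e / lcm d e\<close> under \<open>\<lambda>\<^sub>1 = 1\<close>: the substitution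
  \<open>y\<^sub>l = \<Sum>\<^bsub>l | d\<^esub> \<lambda>\<^sub>d / d\<close> turns it into \<open>\<Sum> \<phi>(l) y\<^sub>l\<^sup>2\<close>, which is least for \<open>y\<^sub>l\<close> proportional to
  \<open>\<mu>(l) / \<phi>(l)\<close>.
\<close>

definition selberg_y :: "nat \<Rightarrow> real" where
  "selberg_y l = moebius_mu l / real (totient l)"

definition selberg_G :: "nat \<Rightarrow> real" where
  "selberg_G R = (\<Sum>l\<in>{1..R}. moebius_mu l * selberg_y l)"

text \<open>Moebius inversion of the substitution: the ratio of the weight at d to d, before it is
  normalised by \<open>selberg_G\<close>.\<close>

definition selberg_rho :: "nat \<Rightarrow> nat \<Rightarrow> real" where
  "selberg_rho R d = (\<Sum>l | l \<in> {1..R} \<and> d dvd l. moebius_mu (l div d) * selberg_y l)"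

definition selberg_lambda :: "nat \<Rightarrow> nat \<Rightarrow> real" where
  "selberg_lambda R d = real d * selberg_rho R d / selberg_G R"

lemma moebius_mult_selberg_y: "moebius_mu l * selberg_y l = moebius_mu l ^ 2 / real (totient l)"
  by (simp add: selberg_y_def power2_eq_square)

text \<open>Each n up to R is m^2 l with l squarefree, so the harmonic sum is at most the sum of 1 /
  m^2, which is below 2, times the sum of 1 / l over squarefree l; and 1 / l is at most 1 /
  phi(l).\<close>

lemma selberg_G_ge:
  assumes R: "R \<ge> 1"
  shows "selberg_G R \<ge> ln (real R) / 2"
proof -
  define B where "B = {l\<in>{1..R}. squarefree l}"
  have "harm R \<le> (\<Sum>(m, l)\<in>{1..R} \<times> B. 1 / (real m ^ 2 * real l))"
  proof -
    have "(harm R :: real) = (\<Sum>n\<in>{1..R}. 1 / (real (square_part n) ^ 2 * real (squarefree_part n)))"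
      unfolding harm_def
    proof (rule sum.cong[OF refl])
      fix n assume "n \<in> {1..R}"
      have "real n = real (squarefree_part n * square_part n ^ 2)"
        by (rule arg_cong[OF squarefree_decompose])
      also have "\<dots> = real (square_part n) ^ 2 * real (squarefree_part n)" by simp
      finally have rn: "real n = real (square_part n) ^ 2 * real (squarefree_part n)" .
      show "inverse (real n) = 1 / (real (square_part n) ^ 2 * real (squarefree_part n))"
        by (simp only: rn[symmetric] inverse_eq_divide)
    qed
    also have "\<dots> = (\<Sum>(m, l)\<in>(\<lambda>n. (square_part n, squarefree_part n)) ` {1..R}. 1 / (real m ^ 2 * real l))"
    proof (subst sum.reindex)
      show "inj_on (\<lambda>n. (square_part n, squarefree_part n)) {1..R}"
        by (rule inj_onI) (metis squarefree_decompose Pair_inject)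
    qed simp
    also have "\<dots> \<le> (\<Sum>(m, l)\<in>{1..R} \<times> B. 1 / (real m ^ 2 * real l))"
    proof (rule sum_mono2)
      show "(\<lambda>n. (square_part n, squarefree_part n)) ` {1..R} \<subseteq> {1..R} \<times> B"
      proof (clarify)
        fix n assume n: "n \<in> {1..R}"
        have nz: "n \<noteq> 0" using n by simp
        have "square_part n \<noteq> 0" "squarefree_part n \<noteq> 0" using nz by simp_all
        moreover have "square_part n dvd n"
          by (rule dvd_trans[OF _ square_part_square_dvd]) (simp add: power2_eq_square)
        moreover have "squarefree_part n dvd n" by (metis squarefree_decompose dvd_triv_left)
        ultimately show "square_part n \<in> {1..R} \<and> squarefree_part n \<in> B"
          using n dvd_imp_le[of "square_part n" n] dvd_imp_le[of "squarefree_part n" n]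
          by (auto simp: B_def Suc_le_eq intro: Nat.gr0I)
      qed
    qed (auto simp: B_def)
    finally show ?thesis .
  qed
  also have "\<dots> = (\<Sum>m\<in>{1..R}. 1 / real m ^ 2) * (\<Sum>l\<in>B. 1 / real l)"
    by (simp add: sum_product sum.cartesian_product)
  also have "\<dots> \<le> 2 * (\<Sum>l\<in>B. 1 / real l)"
  proof (rule mult_right_mono)
    have "(\<Sum>m\<in>{1..R}. 1 / real m ^ 2) \<le> 2 - 1 / real R"
      using R
    proof (induction R rule: dec_induct)
      case (step n)
      have "1 / real (Suc n) ^ 2 \<le> 1 / (real n * real (Suc n))"
        using step by (intro divide_left_mono) (auto simp: power2_eq_square)
      also have "\<dots> = 1 / real n - 1 / real (Suc n)" using step by (simp add: field_simps)
      finally show ?case using step by simp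
    qed simp
    thus "(\<Sum>m\<in>{1..R}. 1 / real m ^ 2) \<le> 2" using R by (smt (verit) divide_nonneg_nonneg of_nat_0_le_iff)
  qed (auto intro: sum_nonneg)
  also have "(\<Sum>l\<in>B. 1 / real l) \<le> selberg_G R"
  proof -
    have "(\<Sum>l\<in>B. 1 / real l) \<le> (\<Sum>l\<in>B. 1 / real (totient l))"
      by (intro sum_mono divide_left_mono) (auto simp: B_def totient_le)
    also have "\<dots> = selberg_G R"
      unfolding selberg_G_def moebius_mult_selberg_y moebius_mu_square
      by (intro sum.mono_neutral_cong_left) (auto simp: B_def)
    finally show ?thesis .
  qed
  finally have "harm R \<le> 2 * selberg_G R" by simp
  moreover have "ln (real R) \<le> harm R"
  proof -
    have "ln (real R) \<le> ln (real R + 1)" using R by simp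
    also have "\<dots> \<le> harm R" by (rule ln_le_harm)
    finally show ?thesis .
  qed
  ultimately show ?thesis by linarith
qed

lemma selberg_G_pos:
  assumes "R \<ge> 1"
  shows "selberg_G R > 0"
proof -
  have "selberg_G R \<ge> (\<Sum>l\<in>{1}. moebius_mu l * selberg_y l)"
    unfolding selberg_G_def using assms
    by (intro sum_mono2) (auto simp: moebius_mult_selberg_y)
  thus ?thesis by (simp add: selberg_y_def moebius_mu_1)
qed

lemma selberg_lambda_1:
  assumes "R \<ge> 1"
  shows "selberg_lambda R 1 = 1"
proof -
  have "{l. l \<in> {1..R} \<and> 1 dvd l} = {1..R}" by auto
  hence "selberg_rho R 1 = selberg_G R" by (simp only: selberg_rho_def selberg_G_def div_by_1)
  thus ?thesis using selberg_G_pos[OF assms] by (simp add: selberg_lambda_def)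
qed

text \<open>The sum defining \<open>selberg_rho\<close> is majorised termwise by that of
  \<open>selberg_G\<close>. Classically the weights are at most 1 in modulus; the cruder bound makes
  the error terms R^4 instead of R^2, which is harmless for R a small power of X.\<close>

lemma abs_selberg_lambda_le:
  assumes R: "R \<ge> 1"
  shows "\<bar>selberg_lambda R d\<bar> \<le> real d"
proof -
  have "\<bar>selberg_rho R d\<bar> \<le> (\<Sum>l | l \<in> {1..R} \<and> d dvd l. moebius_mu l * selberg_y l)"
    unfolding selberg_rho_def
  proof (rule order_trans[OF sum_abs sum_mono])
    fix l
    have "\<bar>moebius_mu (l div d) * selberg_y l\<bar> \<le> 1 * \<bar>selberg_y l\<bar>"
      unfolding abs_mult by (intro mult_right_mono abs_moebius_mu_le) simp
    also have "\<bar>selberg_y l\<bar> = moebius_mu l * selberg_y l"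
      unfolding moebius_mult_selberg_y moebius_mu_square by (simp add: selberg_y_def moebius_mu_def power_abs)
    finally show "\<bar>moebius_mu (l div d) * selberg_y l\<bar> \<le> moebius_mu l * selberg_y l" by simp
  qed
  also have "\<dots> \<le> selberg_G R"
    unfolding selberg_G_def by (intro sum_mono2) (auto simp: moebius_mult_selberg_y)
  finally have "\<bar>selberg_rho R d\<bar> \<le> selberg_G R" .
  hence "real d * \<bar>selberg_rho R d\<bar> / selberg_G R \<le> real d * selberg_G R / selberg_G R"
    using selberg_G_pos[OF R] by (intro divide_right_mono mult_left_mono) auto
  thus ?thesis using selberg_G_pos[OF R] by (simp add: selberg_lambda_def abs_mult)
qed

text \<open>Inverts the definition of \<open>selberg_rho\<close>: for fixed m the quotients m / d
  run through the divisors of m / l, and only m = l survives.\<close>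

lemma sum_selberg_rho_multiples:
  assumes l: "l \<in> {1..R}"
  shows "(\<Sum>d | d \<in> {1..R} \<and> l dvd d. selberg_rho R d) = selberg_y l"
proof -
  have "(\<Sum>d | d \<in> {1..R} \<and> l dvd d. selberg_rho R d)
      = (\<Sum>m\<in>{1..R}. \<Sum>d | d \<in> {d\<in>{1..R}. l dvd d} \<and> d dvd m. moebius_mu (m div d) * selberg_y m)"
    unfolding selberg_rho_def by (rule sum.swap_restrict) auto
  also have "\<dots> = (\<Sum>m\<in>{1..R}. if m = l then selberg_y m else 0)"
  proof (rule sum.cong[OF refl])
    fix m assume m: "m \<in> {1..R}"
    show "(\<Sum>d | d \<in> {d\<in>{1..R}. l dvd d} \<and> d dvd m. moebius_mu (m div d) * selberg_y m) = (if m = l then selberg_y m else 0)"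
    proof (cases "l dvd m")
      case False
      hence e: "{d. d \<in> {d\<in>{1..R}. l dvd d} \<and> d dvd m} = {}" by (auto dest: dvd_trans)
      show ?thesis unfolding e using False by auto
    next
      case True
      then obtain k where k: "m = l * k" by blast
      have lk: "l > 0" "k > 0" using m l k by auto
      have "(\<Sum>d | d \<in> {d\<in>{1..R}. l dvd d} \<and> d dvd m. moebius_mu (m div d)) = (\<Sum>e | e dvd k. moebius_mu e)"
      proof (rule sum.reindex_bij_witness[of _ "\<lambda>e. m div e" "\<lambda>d. m div d"])
        fix d assume "d \<in> {d. d \<in> {d\<in>{1..R}. l dvd d} \<and> d dvd m}"
        then obtain c where c: "d = l * c" "l * c dvd l * k" using k by auto
        then obtain f where f: "k = c * f" using lk by auto
        have "c > 0" "f > 0" using f lk by auto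
        hence md: "m div d = f" using k c f lk by simp
        show "m div (m div d) = d" unfolding md using k c f lk \<open>f > 0\<close> by simp
        show "m div d \<in> {e. e dvd k}" unfolding md using f by simp
        show "moebius_mu (m div d) = moebius_mu (m div d)" ..
      next
        fix e assume "e \<in> {e. e dvd k}"
        then obtain c where c: "k = e * c" by blast
        have ce: "c > 0" "e > 0" using c lk by auto
        have me: "m div e = l * c" using k c ce by (simp add: mult.left_commute)
        show "m div (m div e) = e" unfolding me using k c ce lk by simp
        have "l * c dvd m" using k c by simp
        moreover have "l * c \<le> m" using calculation m by (intro dvd_imp_le) auto
        ultimately show "m div e \<in> {d. d \<in> {d\<in>{1..R}. l dvd d} \<and> d dvd m}"
          unfolding me using m lk ce by auto
      qed
      also have "\<dots> = (if k = 1 then 1 else 0)" using lk by (intro sum_moebius_mu_divisors)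
      finally have "(\<Sum>d | d \<in> {d\<in>{1..R}. l dvd d} \<and> d dvd m. moebius_mu (m div d)) = (if m = l then 1 else 0)"
        using k lk by auto
      thus ?thesis by (simp flip: sum_distrib_right)
    qed
  qed
  also have "\<dots> = selberg_y l" using l by simp
  finally show ?thesis .
qed

text \<open>The form is diagonalised by d1 d2 / lcm = gcd and by writing the gcd as the sum of the
  totients of its divisors l, which are the common divisors of d1 and d2.\<close>

lemma selberg_quadratic_form:
  assumes R: "R \<ge> 1"
  shows "(\<Sum>d1\<in>{1..R}. \<Sum>d2\<in>{1..R}. selberg_lambda R d1 * selberg_lambda R d2 / real (lcm d1 d2)) = 1 / selberg_G R"
proof -
  let ?A = "{1..R}" and ?r = "selberg_rho R" and ?G = "selberg_G R"
  have G: "?G > 0" by (rule selberg_G_pos[OF R])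
  have trm: "selberg_lambda R d1 * selberg_lambda R d2 / real (lcm d1 d2)
      = (\<Sum>l | l \<in> ?A \<and> l dvd d1 \<and> l dvd d2. real (totient l) * ?r d1 * ?r d2) / ?G\<^sup>2"
    if d: "d1 \<in> ?A" "d2 \<in> ?A" for d1 d2
  proof -
    have pos: "real (lcm d1 d2) > 0" using d by (simp add: lcm_pos_nat)
    have "real d1 * real d2 = real (gcd d1 d2) * real (lcm d1 d2)"
      using prod_gcd_lcm_nat[of d1 d2] by (metis of_nat_mult)
    hence g: "real d1 * real d2 / real (lcm d1 d2) = real (gcd d1 d2)"
      using pos d by (simp add: divide_eq_eq)
    have "selberg_lambda R d1 * selberg_lambda R d2 / real (lcm d1 d2)
        = (real d1 * real d2 / real (lcm d1 d2)) * ?r d1 * ?r d2 / ?G\<^sup>2"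
      by (simp add: selberg_lambda_def power2_eq_square mult_ac)
    also have "\<dots> = real (gcd d1 d2) * ?r d1 * ?r d2 / ?G\<^sup>2" unfolding g ..
    also have "real (gcd d1 d2) = (\<Sum>l | l dvd gcd d1 d2. real (totient l))"
      using totient_divisor_sum[of "gcd d1 d2"] by (metis of_nat_sum)
    also have "{l. l dvd gcd d1 d2} = {l. l \<in> ?A \<and> l dvd d1 \<and> l dvd d2}"
    proof (rule subset_antisym; rule subsetI)
      fix l assume "l \<in> {l. l dvd gcd d1 d2}"
      hence l: "l dvd d1" "l dvd d2" by auto
      have "l > 0" "l \<le> d1" using l d dvd_pos_nat[of d1 l] dvd_imp_le[of l d1] by auto
      thus "l \<in> {l. l \<in> ?A \<and> l dvd d1 \<and> l dvd d2}" using l d by auto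
    qed auto
    finally show ?thesis by (simp add: sum_distrib_right)
  qed
  have "(\<Sum>d1\<in>?A. \<Sum>d2\<in>?A. selberg_lambda R d1 * selberg_lambda R d2 / real (lcm d1 d2))
      = (\<Sum>d1\<in>?A. \<Sum>d2\<in>?A. \<Sum>l | l \<in> ?A \<and> l dvd d1 \<and> l dvd d2. real (totient l) * ?r d1 * ?r d2) / ?G\<^sup>2"
    unfolding sum_divide_distrib[of _ ?A] by (intro sum.cong refl trm)
  also have "(\<Sum>d1\<in>?A. \<Sum>d2\<in>?A. \<Sum>l | l \<in> ?A \<and> l dvd d1 \<and> l dvd d2. real (totient l) * ?r d1 * ?r d2)
      = (\<Sum>l\<in>?A. real (totient l) * (\<Sum>d | d \<in> ?A \<and> l dvd d. ?r d)\<^sup>2)"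
  proof -
    have ind: "(\<Sum>l | l \<in> ?A \<and> l dvd d1 \<and> l dvd d2. real (totient l) * ?r d1 * ?r d2)
       = (\<Sum>l\<in>?A. real (totient l) * ((if l dvd d1 then ?r d1 else 0) * (if l dvd d2 then ?r d2 else 0)))" for d1 d2
      by (intro sum.mono_neutral_cong_left) auto
    have "(\<Sum>d1\<in>?A. \<Sum>d2\<in>?A. \<Sum>l | l \<in> ?A \<and> l dvd d1 \<and> l dvd d2. real (totient l) * ?r d1 * ?r d2)
      = (\<Sum>d1\<in>?A. \<Sum>l\<in>?A. \<Sum>d2\<in>?A. real (totient l) * ((if l dvd d1 then ?r d1 else 0) * (if l dvd d2 then ?r d2 else 0)))"
      unfolding ind by (intro sum.cong refl sum.swap)
    also have "\<dots> = (\<Sum>l\<in>?A. \<Sum>d1\<in>?A. \<Sum>d2\<in>?A. real (totient l) * ((if l dvd d1 then ?r d1 else 0) * (if l dvd d2 then ?r d2 else 0)))"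
      by (rule sum.swap)
    also have "\<dots> = (\<Sum>l\<in>?A. real (totient l) * (\<Sum>d\<in>?A. if l dvd d then ?r d else 0)\<^sup>2)"
    proof (rule sum.cong[OF refl])
      fix l
      let ?h = "\<lambda>d. if l dvd d then ?r d else 0"
      have "(\<Sum>d\<in>?A. ?h d)\<^sup>2 = (\<Sum>d1\<in>?A. \<Sum>d2\<in>?A. ?h d1 * ?h d2)"
        by (simp only: power2_eq_square sum_product)
      thus "(\<Sum>d1\<in>?A. \<Sum>d2\<in>?A. real (totient l) * (?h d1 * ?h d2)) = real (totient l) * (\<Sum>d\<in>?A. ?h d)\<^sup>2"
        by (simp only: sum_distrib_left)
    qed
    also have "\<dots> = (\<Sum>l\<in>?A. real (totient l) * (\<Sum>d | d \<in> ?A \<and> l dvd d. ?r d)\<^sup>2)"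
    proof -
      have "(\<Sum>d\<in>?A. if l dvd d then ?r d else 0) = (\<Sum>d | d \<in> ?A \<and> l dvd d. ?r d)" for l
        by (intro sum.mono_neutral_cong_right) auto
      thus ?thesis by simp
    qed
    finally show ?thesis .
  qed
  also have "\<dots> = ?G"
    unfolding selberg_G_def
  proof (rule sum.cong[OF refl])
    fix l assume l: "l \<in> ?A"
    have "real (totient l) > 0" using l by simp
    thus "real (totient l) * (\<Sum>d | d \<in> ?A \<and> l dvd d. ?r d)\<^sup>2 = moebius_mu l * selberg_y l"
      unfolding sum_selberg_rho_multiples[OF l] by (simp add: selberg_y_def power2_eq_square)
  qed
  also have "?G / ?G\<^sup>2 = 1 / ?G" using G by (simp add: power2_eq_square)
  finally show ?thesis .
qed

section \<open>Large sieve inequalities for quadratic characters\<close>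

definition legendre_char :: "nat \<Rightarrow> nat \<Rightarrow> real" where
  "legendre_char q n = real_of_int (Legendre (int n) (int q))"

lemma abs_legendre_char_le: "\<bar>legendre_char q n\<bar> \<le> 1"
  by (auto simp: legendre_char_def Legendre_def)

lemma legendre_char_cong:
  assumes "[n = m] (mod q)"
  shows "legendre_char q n = legendre_char q m"
proof -
  have c: "[int n = int m] (mod int q)" using assms by (simp add: cong_int_iff)
  have "[int n = 0] (mod int q) \<longleftrightarrow> [int m = 0] (mod int q)"
    using c cong_trans cong_sym by blast
  moreover have "QuadRes (int q) (int n) \<longleftrightarrow> QuadRes (int q) (int m)"
    unfolding QuadRes_def using c cong_trans cong_sym by blast
  ultimately show ?thesis by (simp add: legendre_char_def Legendre_def)
qed

lemma legendre_char_mult: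
  assumes q: "prime q" "q > 2"
  shows "legendre_char q (a * b) = legendre_char q a * legendre_char q b"
proof -
  let ?L = "\<lambda>n. Legendre (int n) (int q)"
  have unit: "?L n \<in> {-1, 0, 1}" for n by (auto simp: Legendre_def)
  have e: "[?L n = int n ^ ((q - 1) div 2)] (mod int q)" for n
    using euler_criterion[OF q, of "int n"] by simp
  have "[?L a * ?L b = int a ^ ((q - 1) div 2) * int b ^ ((q - 1) div 2)] (mod int q)"
    by (intro cong_mult e)
  hence "[?L a * ?L b = int (a * b) ^ ((q - 1) div 2)] (mod int q)"
    by (simp only: of_nat_mult power_mult_distrib)
  hence "[?L (a * b) = ?L a * ?L b] (mod int q)" using e[of "a * b"] cong_trans cong_sym by blast
  hence d: "int q dvd ?L (a * b) - ?L a * ?L b" by (simp add: cong_iff_dvd_diff)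
  have "\<bar>?L (a * b) - ?L a * ?L b\<bar> \<le> 2" using unit[of a] unit[of b] unit[of "a * b"] by auto
  moreover have "int q \<le> \<bar>?L (a * b) - ?L a * ?L b\<bar>" if "?L (a * b) - ?L a * ?L b \<noteq> 0"
    using dvd_imp_le_int[OF that d] by simp
  ultimately have "?L (a * b) = ?L a * ?L b" using q by linarith
  thus ?thesis unfolding legendre_char_def by (simp only: of_int_mult)
qed

lemma legendre_char_eq_0_iff:
  assumes "prime q"
  shows "legendre_char q n = 0 \<longleftrightarrow> q dvd n"
  by (auto simp: legendre_char_def Legendre_def cong_0_iff)

lemma legendre_char_1: "prime q \<Longrightarrow> legendre_char q 1 = 1"
  using not_prime_unit by (auto simp: legendre_char_def Legendre_def cong_0_iff QuadRes_def intro!: exI[of _ 1])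

text \<open>Squaring takes the same value at 1 and q - 1, so on the finite set of nonzero residues
  it is not injective and hence not surjective.\<close>

lemma legendre_char_nonresidue:
  assumes q: "prime q" "q > 2"
  obtains a where "legendre_char q a = -1"
proof -
  define f where "f = (\<lambda>x::nat. x\<^sup>2 mod q)"
  define A where "A = {1..<q}"
  have nd: "\<not> q dvd x" if "x \<in> A" for x using that by (auto simp: A_def dest: dvd_imp_le)
  have sub: "f ` A \<subseteq> A"
  proof
    fix y assume "y \<in> f ` A"
    then obtain x where x: "x \<in> A" "y = x\<^sup>2 mod q" by (auto simp: f_def)
    have "\<not> q dvd x\<^sup>2" using nd[OF x(1)] q(1) prime_dvd_power by blast
    thus "y \<in> A" using x q by (auto simp: A_def mod_greater_zero_iff_not_dvd Suc_le_eq)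
  qed
  have "\<not> inj_on f A"
  proof
    assume inj: "inj_on f A"
    have "(q - 1)\<^sup>2 mod q = 1"
    proof -
      have "(q - 1)\<^sup>2 = (q - 2) * q + 1"
      proof -
        obtain k where "q = k + 2" using q by (metis less_imp_add_positive add.commute)
        thus ?thesis by (simp add: power2_eq_square)
      qed
      moreover have "((q - 2) * q + 1) mod q = 1 mod q" by (rule mod_mult_self3)
      ultimately show ?thesis using q by (simp only: mod_less)
    qed
    hence "f (q - 1) = f 1" using q by (simp add: f_def)
    hence "q - 1 = 1" using inj q by (auto simp: inj_on_def A_def)
    thus False using q by simp
  qed
  hence "f ` A \<noteq> A" using finite_surj_inj[of A f] by (auto simp: A_def)
  then obtain a where a: "a \<in> A" "a \<notin> f ` A" using sub by blast
  have "\<not> QuadRes (int q) (int a)"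
  proof
    assume "QuadRes (int q) (int a)"
    then obtain y where y: "[y\<^sup>2 = int a] (mod int q)" by (auto simp: QuadRes_def)
    define x where "x = nat (y mod int q)"
    have q0: "int q > 0" using q by simp
    have x: "int x = y mod int q" using q0 by (simp add: x_def)
    have "[int (x\<^sup>2) = int a] (mod int q)"
      using y by (simp add: x Cong.cong_def power_mod)
    hence c: "[x\<^sup>2 = a] (mod q)" by (simp only: cong_int_iff)
    have "x < q" using q0 x pos_mod_bound[of "int q" y] by linarith
    moreover have "x \<noteq> 0"
    proof
      assume "x = 0"
      hence "q dvd a" using c by (auto simp: Cong.cong_def dvd_eq_mod_eq_0)
      thus False using nd[OF a(1)] by simp
    qed
    ultimately have "x \<in> A" by (simp add: A_def)
    moreover have "f x = a" using c a(1) by (simp add: f_def Cong.cong_def A_def)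
    ultimately show False using a(2) by blast
  qed
  moreover have "\<not> [int a = 0] (mod int q)" using nd[OF a(1)] by (simp add: cong_0_iff)
  ultimately have "legendre_char q a = -1" by (simp add: legendre_char_def Legendre_def)
  thus ?thesis by (rule that)
qed

lemma sum_periodic_shift:
  fixes f :: "nat \<Rightarrow> real"
  shows "sum f {..<m + j} = sum f {..<m} + (\<Sum>i<j. f (m + i))"
  by (induction j) simp_all

text \<open>Multiplying by a residue at which the product of the characters is -1 shows that a full period sums to 0.\<close>

lemma sum_legendre_pair_bound:
  assumes q1: "prime q1" "q1 > 2" and q2: "prime q2" "q2 > 2" and ne: "q1 \<noteq> q2"
  shows "\<bar>\<Sum>n<M. legendre_char q1 n * legendre_char q2 n\<bar> \<le> real (q1 * q2)"
proof -
  define f where "f = (\<lambda>n. legendre_char q1 n * legendre_char q2 n)"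
  define m where "m = q1 * q2"
  have m0: "m > 0" using q1 q2 by (simp add: m_def)
  have cop: "coprime q1 q2" using q1 q2 ne by (simp add: primes_coprime)
  have fm: "f a = f b" if "[a = b] (mod m)" for a b
  proof -
    have "[a = b] (mod q1)" "[a = b] (mod q2)"
      using that cong_modulus_mult_nat[of a b q1 q2] cong_modulus_mult_nat[of a b q2 q1] by (auto simp: m_def mult.commute)
    thus ?thesis unfolding f_def using legendre_char_cong by metis
  qed
  have fmult: "f (a * b) = f a * f b" for a b
    by (simp add: f_def legendre_char_mult q1 q2)
  obtain u where u: "legendre_char q1 u = -1" using legendre_char_nonresidue[OF q1] by blast
  \<comment> \<open>The Chinese remainder theorem joins a nonresidue modulo q1 with 1 modulo q2, so
    that the product of the characters is -1 at c.\<close>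
  obtain c where c: "[c = u] (mod q1)" "[c = 1] (mod q2)"
    using binary_chinese_remainder_nat[OF cop, of u 1] by blast
  have c1: "legendre_char q1 c = -1" using legendre_char_cong[OF c(1)] u by simp
  have c2: "legendre_char q2 c = 1" using legendre_char_cong[OF c(2)] legendre_char_1[OF q2(1)] by simp
  have fc: "f c = -1" by (simp add: f_def c1 c2)
  have "\<not> q1 dvd c" "\<not> q2 dvd c"
    using legendre_char_eq_0_iff[OF q1(1), of c] legendre_char_eq_0_iff[OF q2(1), of c] c1 c2 by auto
  hence "coprime q1 c" "coprime q2 c" using q1 q2 prime_imp_coprime by blast+
  hence cm: "coprime c m" by (simp add: m_def coprime_commute)
  have "inj_on (\<lambda>n. c * n mod m) {..<m}"
  proof (rule inj_onI)
    fix a b assume ab: "a \<in> {..<m}" "b \<in> {..<m}" "c * a mod m = c * b mod m"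
    hence "[c * a = c * b] (mod m)" by (simp only: Cong.cong_def)
    hence "[a = b] (mod m)" using cong_mult_lcancel_nat[OF cm, of a b] by blast
    thus "a = b" using ab by (simp add: Cong.cong_def)
  qed
  moreover have "(\<lambda>n. c * n mod m) ` {..<m} \<subseteq> {..<m}" using m0 by auto
  ultimately have bij: "bij_betw (\<lambda>n. c * n mod m) {..<m} {..<m}"
    unfolding bij_betw_def using endo_inj_surj[of "{..<m}"] by blast
  have "sum f {..<m} = (\<Sum>n<m. f (c * n mod m))" using sum.reindex_bij_betw[OF bij, of f] by simp
  also have "\<dots> = (\<Sum>n<m. - f n)"
  proof (rule sum.cong[OF refl])
    fix n
    have "f (c * n mod m) = f (c * n)" by (rule fm) (simp add: Cong.cong_def)
    thus "f (c * n mod m) = - f n" by (simp add: fmult fc)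
  qed
  finally have S0: "sum f {..<m} = 0" by (simp add: sum_negf)
  have red: "sum f {..<k * m + r} = sum f {..<r}" for k r
  proof (induction k)
    case (Suc k)
    have "sum f {..<Suc k * m + r} = sum f {..<m} + (\<Sum>i<k * m + r. f (m + i))"
      using sum_periodic_shift[of f m "k * m + r"] by (simp add: add.assoc)
    also have "(\<Sum>i<k * m + r. f (m + i)) = sum f {..<k * m + r}"
      by (intro sum.cong refl fm) (simp add: Cong.cong_def)
    finally show ?case using Suc S0 by simp
  qed simp
  have "sum f {..<M} = sum f {..<M mod m}"
    using red[of "M div m" "M mod m"] by (simp add: mult.commute)
  also have "\<bar>\<dots>\<bar> \<le> (\<Sum>n<M mod m. 1)"
  proof (rule order_trans[OF sum_abs sum_mono])
    fix n
    have "\<bar>legendre_char q1 n\<bar> * \<bar>legendre_char q2 n\<bar> \<le> 1 * 1"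
      by (intro mult_mono abs_legendre_char_le) auto
    thus "\<bar>f n\<bar> \<le> 1" by (simp add: f_def abs_mult)
  qed
  also have "\<dots> \<le> real m" using m0 by (simp add: less_imp_le)
  finally show ?thesis by (simp add: f_def m_def)
qed

text \<open>Expanding the square, a diagonal pair contributes at most the total weight and any other
  pair at most \<open>B\<close>. The weight is 1 for powers of prime sums and
  \<open>selberg_weight\<close> for the prime sums themselves.\<close>

lemma weighted_duality:
  fixes chi :: "'a \<Rightarrow> 'b \<Rightarrow> real" and w :: "'b \<Rightarrow> real"
  assumes E: "finite E" and w: "\<And>n. n \<in> A \<Longrightarrow> w n \<ge> 0"
    and c: "\<And>q. q \<in> E \<Longrightarrow> \<bar>c q\<bar> \<le> 1" and chi: "\<And>q n. q \<in> E \<Longrightarrow> \<bar>chi q n\<bar> \<le> 1"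
    and B: "\<And>q r. q \<in> E \<Longrightarrow> r \<in> E \<Longrightarrow> q \<noteq> r \<Longrightarrow> \<bar>\<Sum>n\<in>A. w n * (chi q n * chi r n)\<bar> \<le> B" "B \<ge> 0"
  shows "(\<Sum>n\<in>A. w n * (\<Sum>q\<in>E. c q * chi q n)\<^sup>2) \<le> real (card E) * (\<Sum>n\<in>A. w n) + (real (card E))\<^sup>2 * B"
proof -
  have "(\<Sum>n\<in>A. w n * (\<Sum>q\<in>E. c q * chi q n)\<^sup>2)
      = (\<Sum>n\<in>A. \<Sum>q\<in>E. \<Sum>r\<in>E. c q * c r * (w n * (chi q n * chi r n)))"
    by (simp add: power2_eq_square sum_product sum_distrib_left mult_ac)
  also have "\<dots> = (\<Sum>q\<in>E. \<Sum>n\<in>A. \<Sum>r\<in>E. c q * c r * (w n * (chi q n * chi r n)))"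
    by (rule sum.swap)
  also have "\<dots> = (\<Sum>q\<in>E. \<Sum>r\<in>E. c q * c r * (\<Sum>n\<in>A. w n * (chi q n * chi r n)))"
    by (intro sum.cong refl) (subst sum.swap, simp add: sum_distrib_left)
  also have "\<dots> \<le> (\<Sum>q\<in>E. \<Sum>r\<in>E. (if q = r then (\<Sum>n\<in>A. w n) else 0) + B)"
  proof (intro sum_mono)
    fix q r assume qr: "q \<in> E" "r \<in> E"
    have "\<bar>c q\<bar> * \<bar>c r\<bar> \<le> 1 * 1" using c qr by (intro mult_mono) auto
    hence cc: "\<bar>c q * c r\<bar> \<le> 1" by (simp add: abs_mult)
    let ?S = "\<Sum>n\<in>A. w n * (chi q n * chi r n)"
    have "c q * c r * ?S \<le> \<bar>c q * c r\<bar> * \<bar>?S\<bar>" using abs_ge_self[of "c q * c r * ?S"] by (simp add: abs_mult)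
    also have "\<dots> \<le> 1 * \<bar>?S\<bar>" by (rule mult_right_mono[OF cc]) simp
    also have "1 * \<bar>?S\<bar> \<le> (if q = r then (\<Sum>n\<in>A. w n) else 0) + B"
    proof (cases "q = r")
      case True
      have "\<bar>?S\<bar> \<le> (\<Sum>n\<in>A. w n)"
      proof (rule order_trans[OF sum_abs sum_mono])
        fix n assume n: "n \<in> A"
        have "\<bar>chi q n\<bar> * \<bar>chi r n\<bar> \<le> 1 * 1" using chi qr by (intro mult_mono) auto
        hence "w n * \<bar>chi q n * chi r n\<bar> \<le> w n * 1" using w[OF n] by (intro mult_left_mono) (auto simp: abs_mult)
        thus "\<bar>w n * (chi q n * chi r n)\<bar> \<le> w n" using w[OF n] by (simp add: abs_mult)
      qed
      thus ?thesis using True B(2) by simp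
    next
      case False
      thus ?thesis using B(1)[OF qr] by simp
    qed
    finally show "c q * c r * ?S \<le> (if q = r then (\<Sum>n\<in>A. w n) else 0) + B" .
  qed
  also have "\<dots> = real (card E) * (\<Sum>n\<in>A. w n) + (real (card E))\<^sup>2 * B"
    using E by (simp add: sum.distrib power2_eq_square algebra_simps)
  finally show ?thesis .
qed

text \<open>The number of \<open>k\<close>-tuples of elements of \<open>P\<close> with product \<open>n\<close>.\<close>

fun prime_tuple_count :: "nat set \<Rightarrow> nat \<Rightarrow> nat \<Rightarrow> nat" where
  "prime_tuple_count P 0 n = (if n = 1 then 1 else 0)"
| "prime_tuple_count P (Suc k) n = (\<Sum>p | p \<in> P \<and> p dvd n. prime_tuple_count P k (n div p))"

lemma prime_tuple_count_nonzero:
  assumes "finite P" "\<And>p. p \<in> P \<Longrightarrow> prime p \<and> p \<le> y" "prime_tuple_count P k n \<noteq> 0"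
  shows "n > 0 \<and> size (prime_factorization n) = k \<and> n \<le> y ^ k"
  using assms(3)
proof (induction k arbitrary: n)
  case 0
  thus ?case by (simp split: if_splits)
next
  case (Suc k)
  have "\<exists>p. p \<in> P \<and> p dvd n \<and> prime_tuple_count P k (n div p) \<noteq> 0"
  proof (rule ccontr)
    assume "\<not> ?thesis"
    hence "prime_tuple_count P (Suc k) n = 0" by (auto intro!: sum.neutral)
    thus False using Suc.prems by simp
  qed
  then obtain p where p: "p \<in> P" "p dvd n" "prime_tuple_count P k (n div p) \<noteq> 0" by blast
  obtain m where m: "n = p * m" using p(2) by blast
  have pp: "prime p" "p \<le> y" "p > 0" using assms(2)[OF p(1)] prime_gt_0_nat by auto
  have "n div p = m" using m pp by simp
  hence IH: "m > 0" "size (prime_factorization m) = k" "m \<le> y ^ k" using Suc.IH[of m] p(3) by auto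
  have "prime_factorization n = prime_factorization p + prime_factorization m"
    unfolding m using pp IH by (intro prime_factorization_mult) auto
  hence "size (prime_factorization n) = Suc k" using pp IH by (simp add: prime_factorization_prime)
  moreover have "n \<le> y ^ Suc k" unfolding m using mult_le_mono[OF pp(2) IH(3)] by simp
  ultimately show ?case using m pp IH by simp
qed

lemma card_set_mset_le_size: "card (set_mset M) \<le> size M"
  by (induction M) (auto simp: card_insert_if)

text \<open>The first prime of a tuple divides n, and n has \<open>Suc k\<close> prime factors with
  multiplicity, which leaves at most \<open>Suc k\<close> choices at this step.\<close>

lemma prime_tuple_count_le:
  assumes P: "finite P" "\<And>p. p \<in> P \<Longrightarrow> prime p"
  shows "prime_tuple_count P k n \<le> fact k"
proof (induction k arbitrary: n)
  case (Suc k)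
  show ?case
  proof (cases "prime_tuple_count P (Suc k) n = 0")
    case False
    have "\<And>p. p \<in> P \<Longrightarrow> prime p \<and> p \<le> Max P" using P by auto
    from prime_tuple_count_nonzero[OF P(1) this False]
    have n: "n > 0" "size (prime_factorization n) = Suc k" by auto
    have "card {p. p \<in> P \<and> p dvd n} \<le> card (prime_factors n)"
      using P n by (intro card_mono) (auto simp: prime_factors_dvd)
    also have "\<dots> \<le> Suc k" using card_set_mset_le_size[of "prime_factorization n"] n by simp
    finally have c: "card {p. p \<in> P \<and> p dvd n} \<le> Suc k" .
    have "prime_tuple_count P (Suc k) n \<le> (\<Sum>p | p \<in> P \<and> p dvd n. fact k)"
      unfolding prime_tuple_count.simps by (intro sum_mono Suc.IH)
    also have "\<dots> = card {p. p \<in> P \<and> p dvd n} * fact k" by simp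
    also have "\<dots> \<le> Suc k * fact k" by (rule mult_le_mono1[OF c])
    finally show ?thesis by simp
  qed simp
qed simp

text \<open>The k-th power of the prime sum is expanded by complete multiplicativity. Applied to a
  character and, with f = 1, to obtain the total number of tuples.\<close>

lemma sum_prime_tuple_count:
  fixes f :: "nat \<Rightarrow> real"
  assumes P: "finite P" "\<And>p. p \<in> P \<Longrightarrow> prime p \<and> p \<le> y"
    and f: "f 1 = 1" "\<And>a b. f (a * b) = f a * f b"
  shows "(\<Sum>n=1..y ^ k. real (prime_tuple_count P k n) * f n) = (\<Sum>p\<in>P. f p) ^ k"
proof (induction k)
  case 0
  show ?case using f by simp
next
  case (Suc k)
  let ?r = "prime_tuple_count P"
  have "(\<Sum>n=1..y ^ Suc k. real (?r (Suc k) n) * f n)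
      = (\<Sum>n\<in>{1..y ^ Suc k}. \<Sum>p | p \<in> P \<and> p dvd n. real (?r k (n div p)) * f n)"
    by (simp add: sum_distrib_right)
  also have "\<dots> = (\<Sum>p\<in>P. \<Sum>n | n \<in> {1..y ^ Suc k} \<and> p dvd n. real (?r k (n div p)) * f n)"
    using P by (intro sum.swap_restrict) auto
  also have "\<dots> = (\<Sum>p\<in>P. f p * (\<Sum>m=1..y ^ k. real (?r k m) * f m))"
  proof (rule sum.cong[OF refl])
    fix p assume p: "p \<in> P"
    have pp: "prime p" "p \<le> y" "p > 0" using P(2)[OF p] prime_gt_0_nat by auto
    have "(\<Sum>n | n \<in> {1..y ^ Suc k} \<and> p dvd n. real (?r k (n div p)) * f n)
        = (\<Sum>n\<in>(\<lambda>m. p * m) ` {1..y ^ k}. real (?r k (n div p)) * f n)"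
    proof (rule sum.mono_neutral_right)
      show "(\<lambda>m. p * m) ` {1..y ^ k} \<subseteq> {n. n \<in> {1..y ^ Suc k} \<and> p dvd n}"
        using pp mult_le_mono[OF pp(2)] by (auto simp: Suc_le_eq)
      show "\<forall>n\<in>{n. n \<in> {1..y ^ Suc k} \<and> p dvd n} - (\<lambda>m. p * m) ` {1..y ^ k}. real (?r k (n div p)) * f n = 0"
      proof
        fix n assume n: "n \<in> {n. n \<in> {1..y ^ Suc k} \<and> p dvd n} - (\<lambda>m. p * m) ` {1..y ^ k}"
        then obtain m where m: "n = p * m" by blast
        have "m \<notin> {1..y ^ k}" using n m by blast
        hence "?r k m = 0" using prime_tuple_count_nonzero[OF P, of k m] by (cases "?r k m = 0") auto
        thus "real (?r k (n div p)) * f n = 0" using m pp by simp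
      qed
    qed auto
    also have "\<dots> = (\<Sum>m=1..y ^ k. real (?r k m) * f (p * m))"
      using pp by (subst sum.reindex) (auto simp: inj_on_def)
    finally show "(\<Sum>n | n \<in> {1..y ^ Suc k} \<and> p dvd n. real (?r k (n div p)) * f n) = f p * (\<Sum>m=1..y ^ k. real (?r k m) * f m)"
      by (simp add: f sum_distrib_left mult_ac)
  qed
  finally show ?case unfolding Suc.IH by (simp add: sum_distrib_right)
qed

text \<open>The signs \<open>c\<close> remove the absolute values. Cauchy-Schwarz splits the
  multiplicity \<open>r\<close> into two square roots: one factor keeps the exact number
  \<open>card P ^ k\<close> of tuples, the other bounds \<open>r\<close> by k! and sums over all
  integers up to \<open>y ^ k\<close>, where duality applies.\<close>

lemma large_sieve_moment:
  assumes P: "finite P" "\<And>p. p \<in> P \<Longrightarrow> prime p \<and> p \<le> y"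
    and E: "finite E" "\<And>q. q \<in> E \<Longrightarrow> prime q \<and> q > 2 \<and> real q \<le> Z"
    and T: "T \<ge> 0" "\<And>q. q \<in> E \<Longrightarrow> T \<le> \<bar>\<Sum>p\<in>P. legendre_char q p\<bar>"
  shows "(real (card E) * T ^ k)\<^sup>2 \<le> real (card P) ^ k * (fact k * (real (card E) * (real y ^ k + 1) + (real (card E))\<^sup>2 * Z\<^sup>2))"
proof -
  define S where "S = (\<lambda>q. (\<Sum>p\<in>P. legendre_char q p) ^ k)"
  define c where "c = (\<lambda>q. sgn (S q))"
  define r where "r = (\<lambda>n. real (prime_tuple_count P k n))"
  define F where "F = (\<lambda>n. \<Sum>q\<in>E. c q * legendre_char q n)"
  let ?A = "{1..y ^ k}"
  have r0: "r n \<ge> 0" for n by (simp add: r_def)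
  have "real (card E) * T ^ k = (\<Sum>q\<in>E. T ^ k)" by simp
  also have "\<dots> \<le> (\<Sum>q\<in>E. c q * S q)"
  proof (rule sum_mono)
    fix q assume "q \<in> E"
    hence "T ^ k \<le> \<bar>\<Sum>p\<in>P. legendre_char q p\<bar> ^ k" using T by (intro power_mono)
    moreover have "c q * S q = \<bar>S q\<bar>" by (simp add: c_def abs_sgn mult.commute)
    moreover have "\<bar>S q\<bar> = \<bar>\<Sum>p\<in>P. legendre_char q p\<bar> ^ k" by (simp add: S_def power_abs)
    ultimately show "T ^ k \<le> c q * S q" by simp
  qed
  also have "\<dots> = (\<Sum>q\<in>E. c q * (\<Sum>n\<in>?A. r n * legendre_char q n))"
  proof (rule sum.cong[OF refl])
    fix q assume q: "q \<in> E"
    have "(\<Sum>n\<in>?A. r n * legendre_char q n) = S q" unfolding r_def S_def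
      using E(2)[OF q] by (intro sum_prime_tuple_count[OF P]) (auto intro: legendre_char_mult legendre_char_1[simplified])
    thus "c q * S q = c q * (\<Sum>n\<in>?A. r n * legendre_char q n)" by simp
  qed
  also have "\<dots> = (\<Sum>n\<in>?A. r n * F n)"
    unfolding F_def sum_distrib_left by (subst sum.swap) (simp add: mult_ac)
  also have "\<dots> = (\<Sum>n\<in>?A. sqrt (r n) * (sqrt (r n) * F n))"
    using r0 by (simp add: mult.assoc[symmetric])
  finally have "(real (card E) * T ^ k)\<^sup>2 \<le> (\<Sum>n\<in>?A. sqrt (r n) * (sqrt (r n) * F n))\<^sup>2"
    using T(1) by (intro power_mono) auto
  also have "\<dots> \<le> (\<Sum>n\<in>?A. (sqrt (r n))\<^sup>2) * (\<Sum>n\<in>?A. (sqrt (r n) * F n)\<^sup>2)"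
    by (rule Cauchy_Schwarz_ineq_sum)
  also have "\<dots> = (\<Sum>n\<in>?A. r n) * (\<Sum>n\<in>?A. r n * (F n)\<^sup>2)"
    using r0 by (simp add: power_mult_distrib)
  also have "(\<Sum>n\<in>?A. r n) = real (card P) ^ k"
    using sum_prime_tuple_count[OF P, of "\<lambda>_. 1" k] by (simp add: r_def)
  also have "real (card P) ^ k * (\<Sum>n\<in>?A. r n * (F n)\<^sup>2) \<le> real (card P) ^ k * (fact k * (real (card E) * (real y ^ k + 1) + (real (card E))\<^sup>2 * Z\<^sup>2))"
  proof (rule mult_left_mono)
    have "(\<Sum>n\<in>?A. r n * (F n)\<^sup>2) \<le> (\<Sum>n\<in>?A. fact k * (F n)\<^sup>2)"
    proof (intro sum_mono mult_right_mono)
      fix n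
      have "prime_tuple_count P k n \<le> fact k" using P by (intro prime_tuple_count_le) auto
      hence "real (prime_tuple_count P k n) \<le> real (fact k)" by (simp only: of_nat_le_iff)
      thus "r n \<le> fact k" by (simp add: r_def)
    qed simp
    also have "\<dots> = fact k * (\<Sum>n\<in>?A. (F n)\<^sup>2)" by (simp add: sum_distrib_left)
    \<comment> \<open>Index 0 is included to match \<open>sum_legendre_pair_bound\<close>; it
      accounts for the 1 in \<open>y ^ k + 1\<close>.\<close>
    also have "\<dots> \<le> fact k * (\<Sum>n<y ^ k + 1. (F n)\<^sup>2)"
      by (intro mult_left_mono sum_mono2) auto
    also have "(\<Sum>n<y ^ k + 1. (F n)\<^sup>2) = (\<Sum>n<y ^ k + 1. 1 * (F n)\<^sup>2)" by simp
    also have "\<dots> \<le> real (card E) * (\<Sum>n<y ^ k + 1. 1) + (real (card E))\<^sup>2 * Z\<^sup>2"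
      unfolding F_def
    proof (rule weighted_duality)
      fix q s assume qs: "q \<in> E" "s \<in> E" "q \<noteq> s"
      have "\<bar>\<Sum>n<y ^ k + 1. 1 * (legendre_char q n * legendre_char s n)\<bar> \<le> real (q * s)"
        using sum_legendre_pair_bound[of q s "y ^ k + 1"] E(2) qs by simp
      also have "\<dots> \<le> Z\<^sup>2"
        using E(2)[OF qs(1)] E(2)[OF qs(2)] unfolding of_nat_mult power2_eq_square
        by (intro mult_mono) (auto intro: order_trans[of 0 "real q"])
      finally show "\<bar>\<Sum>n<y ^ k + 1. 1 * (legendre_char q n * legendre_char s n)\<bar> \<le> Z\<^sup>2" .
    qed (use E abs_legendre_char_le in \<open>auto simp: c_def abs_sgn_eq\<close>)
    finally show "(\<Sum>n\<in>?A. r n * (F n)\<^sup>2) \<le> fact k * (real (card E) * (real y ^ k + 1) + (real (card E))\<^sup>2 * Z\<^sup>2)"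
      by (simp add: mult_left_mono add.commute[of 1])
  qed simp
  finally show ?thesis .
qed

section \<open>The large sieve with Selberg weights\<close>

definition selberg_weight :: "nat \<Rightarrow> nat \<Rightarrow> real" where
  "selberg_weight R n = (\<Sum>d | d \<in> {1..R} \<and> d dvd n. selberg_lambda R d)\<^sup>2"

lemma selberg_weight_prime:
  assumes "R \<ge> 1" "prime p" "p > R"
  shows "selberg_weight R p = 1"
proof -
  have "{d. d \<in> {1..R} \<and> d dvd p} = {1}"
    using assms prime_nat_iff[of p] by auto
  thus ?thesis using selberg_lambda_1[OF assms(1)] by (simp add: selberg_weight_def)
qed

lemma sum_multiples:
  fixes g :: "nat \<Rightarrow> real"
  assumes "D > 0"
  shows "(\<Sum>n | n \<in> {1..M} \<and> D dvd n. g n) = (\<Sum>m=1..M div D. g (D * m))"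
proof (rule sum.reindex_bij_witness[of _ "\<lambda>m. D * m" "\<lambda>n. n div D"])
  fix n assume "n \<in> {n. n \<in> {1..M} \<and> D dvd n}"
  then obtain m where m: "n = D * m" "1 \<le> D * m" "D * m \<le> M" by auto
  thus "n div D \<in> {1..M div D}" "D * (n div D) = n" "g (D * (n div D)) = g n"
    using assms by (auto simp: less_eq_div_iff_mult_less_eq mult.commute Suc_le_eq)
next
  fix m assume m: "m \<in> {1..M div D}"
  hence "m * D \<le> M" using assms by (simp add: less_eq_div_iff_mult_less_eq)
  thus "D * m \<in> {n. n \<in> {1..M} \<and> D dvd n}" using m assms by (auto simp: mult.commute Suc_le_eq)
  show "D * m div D = m" using assms by simp
qed

lemma sum_selberg_weight:
  fixes g :: "nat \<Rightarrow> real"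
  shows "(\<Sum>n=1..M. selberg_weight R n * g n) =
    (\<Sum>d1\<in>{1..R}. \<Sum>d2\<in>{1..R}. selberg_lambda R d1 * selberg_lambda R d2 * (\<Sum>m=1..M div lcm d1 d2. g (lcm d1 d2 * m)))"
proof -
  let ?l = "selberg_lambda R"
  have sq: "selberg_weight R n = (\<Sum>d1\<in>{1..R}. \<Sum>d2\<in>{1..R}. if lcm d1 d2 dvd n then ?l d1 * ?l d2 else 0)" for n
  proof -
    have "(\<Sum>d | d \<in> {1..R} \<and> d dvd n. ?l d) = (\<Sum>d\<in>{1..R}. if d dvd n then ?l d else 0)"
      by (intro sum.mono_neutral_cong_left) auto
    hence "selberg_weight R n = (\<Sum>d1\<in>{1..R}. \<Sum>d2\<in>{1..R}. (if d1 dvd n then ?l d1 else 0) * (if d2 dvd n then ?l d2 else 0))"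
      by (simp only: selberg_weight_def power2_eq_square sum_product)
    also have "\<dots> = (\<Sum>d1\<in>{1..R}. \<Sum>d2\<in>{1..R}. if lcm d1 d2 dvd n then ?l d1 * ?l d2 else 0)"
      by (intro sum.cong refl) auto
    finally show ?thesis .
  qed
  have "(\<Sum>n=1..M. selberg_weight R n * g n) =
     (\<Sum>n\<in>{1..M}. \<Sum>d1\<in>{1..R}. \<Sum>d2\<in>{1..R}. (if lcm d1 d2 dvd n then ?l d1 * ?l d2 else 0) * g n)"
    unfolding sq sum_distrib_right ..
  also have "\<dots> = (\<Sum>d1\<in>{1..R}. \<Sum>n\<in>{1..M}. \<Sum>d2\<in>{1..R}. (if lcm d1 d2 dvd n then ?l d1 * ?l d2 else 0) * g n)"
    by (rule sum.swap)
  also have "\<dots> = (\<Sum>d1\<in>{1..R}. \<Sum>d2\<in>{1..R}. \<Sum>n\<in>{1..M}. (if lcm d1 d2 dvd n then ?l d1 * ?l d2 else 0) * g n)"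
    by (intro sum.cong refl sum.swap)
  also have "\<dots> = (\<Sum>d1\<in>{1..R}. \<Sum>d2\<in>{1..R}. ?l d1 * ?l d2 * (\<Sum>m=1..M div lcm d1 d2. g (lcm d1 d2 * m)))"
  proof (intro sum.cong refl)
    fix d1 d2 assume d: "d1 \<in> {1..R}" "d2 \<in> {1..R}"
    have pos: "lcm d1 d2 > 0" using d by (simp add: lcm_pos_nat)
    have "(\<Sum>n\<in>{1..M}. (if lcm d1 d2 dvd n then ?l d1 * ?l d2 else 0) * g n)
        = (\<Sum>n | n \<in> {1..M} \<and> lcm d1 d2 dvd n. ?l d1 * ?l d2 * g n)"
      by (intro sum.mono_neutral_cong_right) auto
    also have "\<dots> = ?l d1 * ?l d2 * (\<Sum>n | n \<in> {1..M} \<and> lcm d1 d2 dvd n. g n)"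
      by (simp only: sum_distrib_left)
    finally show "(\<Sum>n\<in>{1..M}. (if lcm d1 d2 dvd n then ?l d1 * ?l d2 else 0) * g n)
        = ?l d1 * ?l d2 * (\<Sum>m=1..M div lcm d1 d2. g (lcm d1 d2 * m))"
      unfolding sum_multiples[OF pos] .
  qed
  finally show ?thesis .
qed

lemma sum_abs_selberg_lambda:
  assumes R: "R \<ge> 1"
  shows "(\<Sum>d1\<in>{1..R}. \<Sum>d2\<in>{1..R}. \<bar>selberg_lambda R d1\<bar> * \<bar>selberg_lambda R d2\<bar>) \<le> real R ^ 4"
proof -
  have "(\<Sum>d\<in>{1..R}. \<bar>selberg_lambda R d\<bar>) \<le> (\<Sum>d\<in>{1..R}. real R)"
    by (intro sum_mono order_trans[OF abs_selberg_lambda_le[OF R]]) auto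
  hence s: "(\<Sum>d\<in>{1..R}. \<bar>selberg_lambda R d\<bar>) \<le> real R * real R" by simp
  have "(\<Sum>d1\<in>{1..R}. \<Sum>d2\<in>{1..R}. \<bar>selberg_lambda R d1\<bar> * \<bar>selberg_lambda R d2\<bar>)
      = (\<Sum>d\<in>{1..R}. \<bar>selberg_lambda R d\<bar>) * (\<Sum>d\<in>{1..R}. \<bar>selberg_lambda R d\<bar>)"
    by (simp add: sum_product)
  also have "\<dots> \<le> (real R * real R) * (real R * real R)"
    using s by (intro mult_mono) (auto intro: sum_nonneg)
  also have "\<dots> = real R ^ 4" by (simp add: power4_eq_xxxx)
  finally show ?thesis .
qed

text \<open>The number of multiples of an lcm up to M differs from M / lcm by at most 1; the main
  terms form the quadratic form with value 1 / G.\<close>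

lemma sum_selberg_weight_le:
  assumes R: "R \<ge> 1"
  shows "(\<Sum>n=1..M. selberg_weight R n) \<le> real M / selberg_G R + real R ^ 4"
proof -
  let ?l = "selberg_lambda R"
  have "(\<Sum>n=1..M. selberg_weight R n) = (\<Sum>d1\<in>{1..R}. \<Sum>d2\<in>{1..R}. ?l d1 * ?l d2 * real (M div lcm d1 d2))"
    using sum_selberg_weight[where g = "\<lambda>_. 1" and M = M and R = R] by simp
  also have "\<dots> \<le> (\<Sum>d1\<in>{1..R}. \<Sum>d2\<in>{1..R}. real M * (?l d1 * ?l d2 / real (lcm d1 d2)) + \<bar>?l d1\<bar> * \<bar>?l d2\<bar>)"
  proof (intro sum_mono)
    fix d1 d2 assume d: "d1 \<in> {1..R}" "d2 \<in> {1..R}"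
    have "\<bar>real (M div lcm d1 d2) - real M / real (lcm d1 d2)\<bar> \<le> 1"
    proof -
      have "real (M div lcm d1 d2) = of_int \<lfloor>real M / real (lcm d1 d2)\<rfloor>"
        by (simp only: floor_divide_of_nat_eq of_int_of_nat_eq)
      thus ?thesis by linarith
    qed
    hence "\<bar>?l d1 * ?l d2\<bar> * \<bar>real (M div lcm d1 d2) - real M / real (lcm d1 d2)\<bar> \<le> \<bar>?l d1 * ?l d2\<bar> * 1"
      by (intro mult_left_mono) auto
    hence "?l d1 * ?l d2 * (real (M div lcm d1 d2) - real M / real (lcm d1 d2)) \<le> \<bar>?l d1\<bar> * \<bar>?l d2\<bar>"
      using abs_ge_self[of "?l d1 * ?l d2 * (real (M div lcm d1 d2) - real M / real (lcm d1 d2))"]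
      by (simp add: abs_mult)
    thus "?l d1 * ?l d2 * real (M div lcm d1 d2) \<le> real M * (?l d1 * ?l d2 / real (lcm d1 d2)) + \<bar>?l d1\<bar> * \<bar>?l d2\<bar>"
      by (simp add: algebra_simps)
  qed
  also have "\<dots> = real M * (\<Sum>d1\<in>{1..R}. \<Sum>d2\<in>{1..R}. ?l d1 * ?l d2 / real (lcm d1 d2))
      + (\<Sum>d1\<in>{1..R}. \<Sum>d2\<in>{1..R}. \<bar>?l d1\<bar> * \<bar>?l d2\<bar>)"
    by (simp only: sum.distrib sum_distrib_left)
  also have "\<dots> \<le> real M / selberg_G R + real R ^ 4"
    unfolding selberg_quadratic_form[OF R] using sum_abs_selberg_lambda[OF R] by simp
  finally show ?thesis .
qed

text \<open>On the multiples of D the value at D factors out, which leaves a character sum over an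
  initial interval. Extending that interval by 0 changes nothing, since the characters vanish
  there.\<close>

lemma sum_selberg_weight_pair_le:
  assumes R: "R \<ge> 1" and q1: "prime q1" "q1 > 2" and q2: "prime q2" "q2 > 2" and ne: "q1 \<noteq> q2"
  shows "\<bar>\<Sum>n=1..M. selberg_weight R n * (legendre_char q1 n * legendre_char q2 n)\<bar> \<le> real R ^ 4 * real (q1 * q2)"
proof -
  let ?l = "selberg_lambda R" and ?f = "\<lambda>n. legendre_char q1 n * legendre_char q2 n"
  have inner: "\<bar>\<Sum>m=1..K. ?f (D * m)\<bar> \<le> real (q1 * q2)" for K D
  proof -
    have "(\<Sum>m=1..K. ?f (D * m)) = ?f D * (\<Sum>m=1..K. ?f m)"
      by (simp add: legendre_char_mult q1 q2 sum_distrib_left mult_ac)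
    also have "(\<Sum>m=1..K. ?f m) = (\<Sum>m<Suc K. ?f m)"
      using legendre_char_eq_0_iff[OF q1(1), of 0]
      by (intro sum.mono_neutral_left) (auto simp: Suc_le_eq)
    finally have "\<bar>\<Sum>m=1..K. ?f (D * m)\<bar> = (\<bar>legendre_char q1 D\<bar> * \<bar>legendre_char q2 D\<bar>) * \<bar>\<Sum>m<Suc K. ?f m\<bar>"
      by (simp only: abs_mult)
    also have "\<dots> \<le> (1 * 1) * \<bar>\<Sum>m<Suc K. ?f m\<bar>"
      by (intro mult_right_mono mult_mono abs_legendre_char_le) auto
    also have "\<dots> \<le> real (q1 * q2)" using sum_legendre_pair_bound[OF q1 q2 ne, of "Suc K"] by simp
    finally show ?thesis .
  qed
  have "\<bar>\<Sum>n=1..M. selberg_weight R n * ?f n\<bar> \<le> (\<Sum>d1\<in>{1..R}. \<Sum>d2\<in>{1..R}. \<bar>?l d1\<bar> * \<bar>?l d2\<bar> * real (q1 * q2))"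
    unfolding sum_selberg_weight
  proof (intro order_trans[OF sum_abs] sum_mono)
    fix d1 d2
    show "\<bar>?l d1 * ?l d2 * (\<Sum>m=1..M div lcm d1 d2. ?f (lcm d1 d2 * m))\<bar> \<le> \<bar>?l d1\<bar> * \<bar>?l d2\<bar> * real (q1 * q2)"
      unfolding abs_mult[of "_ * _"] abs_mult[of "?l d1"] by (intro mult_left_mono inner) auto
  qed
  also have "\<dots> = (\<Sum>d1\<in>{1..R}. \<Sum>d2\<in>{1..R}. \<bar>?l d1\<bar> * \<bar>?l d2\<bar>) * real (q1 * q2)"
    by (simp only: sum_distrib_right)
  also have "\<dots> \<le> real R ^ 4 * real (q1 * q2)" using sum_abs_selberg_lambda[OF R] by (rule mult_right_mono) simp
  finally show ?thesis .
qed

text \<open>The first power of the prime sums, with the primes embedded in all integers by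
  nonnegative weights that are 1 on primes above R. The diagonal term is then about M / G rather
  than M.\<close>

lemma large_sieve_selberg:
  assumes R: "R \<ge> 1" and P: "\<And>p. p \<in> P \<Longrightarrow> prime p \<and> R < p \<and> p \<le> M"
    and E: "finite E" "\<And>q. q \<in> E \<Longrightarrow> prime q \<and> q > 2 \<and> real q \<le> Z"
    and T: "T \<ge> 0" "\<And>q. q \<in> E \<Longrightarrow> T \<le> \<bar>\<Sum>p\<in>P. legendre_char q p\<bar>"
  shows "(real (card E) * T)\<^sup>2 \<le> real (card P) *
     (real (card E) * (real M / selberg_G R + real R ^ 4) + (real (card E))\<^sup>2 * (real R ^ 4 * Z\<^sup>2))"
proof -
  define c where "c = (\<lambda>q. sgn (\<Sum>p\<in>P. legendre_char q p))"
  define F where "F = (\<lambda>n. \<Sum>q\<in>E. c q * legendre_char q n)"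
  have sub: "P \<subseteq> {1..M}" using P by fastforce
  have w0: "selberg_weight R n \<ge> 0" for n by (simp add: selberg_weight_def)
  have "real (card E) * T = (\<Sum>q\<in>E. T)" by simp
  also have "\<dots> \<le> (\<Sum>q\<in>E. c q * (\<Sum>p\<in>P. legendre_char q p))"
    using T(2) by (intro sum_mono) (simp add: c_def abs_sgn mult.commute)
  also have "\<dots> = (\<Sum>p\<in>P. 1 * F p)"
    unfolding F_def sum_distrib_left by (subst sum.swap) simp
  finally have "(real (card E) * T)\<^sup>2 \<le> (\<Sum>p\<in>P. 1 * F p)\<^sup>2"
    using T(1) by (intro power_mono) auto
  also have "\<dots> \<le> (\<Sum>p\<in>P. 1\<^sup>2) * (\<Sum>p\<in>P. (F p)\<^sup>2)" by (rule Cauchy_Schwarz_ineq_sum)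
  also have "\<dots> = real (card P) * (\<Sum>p\<in>P. (F p)\<^sup>2)" by simp
  also have "\<dots> \<le> real (card P) * (real (card E) * (real M / selberg_G R + real R ^ 4) + (real (card E))\<^sup>2 * (real R ^ 4 * Z\<^sup>2))"
  proof (rule mult_left_mono)
    have "(\<Sum>p\<in>P. (F p)\<^sup>2) = (\<Sum>p\<in>P. selberg_weight R p * (F p)\<^sup>2)"
      using P by (intro sum.cong refl) (simp add: selberg_weight_prime[OF R])
    also have "\<dots> \<le> (\<Sum>n=1..M. selberg_weight R n * (F n)\<^sup>2)"
      using sub w0 by (intro sum_mono2) auto
    also have "\<dots> \<le> real (card E) * (\<Sum>n=1..M. selberg_weight R n) + (real (card E))\<^sup>2 * (real R ^ 4 * Z\<^sup>2)"
      unfolding F_def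
    proof (rule weighted_duality)
      fix q s assume qs: "q \<in> E" "s \<in> E" "q \<noteq> s"
      have "\<bar>\<Sum>n=1..M. selberg_weight R n * (legendre_char q n * legendre_char s n)\<bar> \<le> real R ^ 4 * real (q * s)"
        using sum_selberg_weight_pair_le[OF R] E(2) qs by blast
      also have "\<dots> \<le> real R ^ 4 * Z\<^sup>2"
        using E(2)[OF qs(1)] E(2)[OF qs(2)] unfolding of_nat_mult power2_eq_square
        by (intro mult_left_mono mult_mono) (auto intro: order_trans[of 0 "real q"])
      finally show "\<bar>\<Sum>n=1..M. selberg_weight R n * (legendre_char q n * legendre_char s n)\<bar> \<le> real R ^ 4 * Z\<^sup>2" .
    qed (use E abs_legendre_char_le w0 in \<open>auto simp: c_def abs_sgn_eq\<close>)
    also have "\<dots> \<le> real (card E) * (real M / selberg_G R + real R ^ 4) + (real (card E))\<^sup>2 * (real R ^ 4 * Z\<^sup>2)"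
      by (intro add_right_mono mult_left_mono sum_selberg_weight_le[OF R]) auto
    finally show "(\<Sum>p\<in>P. (F p)\<^sup>2) \<le> real (card E) * (real M / selberg_G R + real R ^ 4) + (real (card E))\<^sup>2 * (real R ^ 4 * Z\<^sup>2)" .
  qed simp
  finally show ?thesis .
qed

section \<open>Counting exceptional moduli\<close>

lemma character_prime_sum_eq:
  "real_of_int (character_prime_sum q x) = (\<Sum>p | prime p \<and> real p \<le> x. legendre_char q p)"
  by (simp add: character_prime_sum_def legendre_char_def)

text \<open>With Y = x / ln x, a deviation above \<open>\<delta> * Y\<close> becomes 2 delta Y after
  doubling; the prime number theorem takes away delta Y / 4, and the exceptional primes 2 and q take
  away 4, at most delta Y / 4. The threshold for x is uniform in q.\<close>

lemma character_sum_large: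
  assumes d: "\<delta> > 0"
  shows "eventually (\<lambda>x. real (prime_count x) \<le> 2 * (x / ln x) \<and>
     (\<forall>q. prime q \<longrightarrow> q mod 4 = 3 \<longrightarrow> \<bar>real (split_prime_count q x) - 1 / 2 * (x / ln x)\<bar> > \<delta> * (x / ln x) \<longrightarrow>
       3 / 2 * \<delta> * (x / ln x) \<le> \<bar>\<Sum>p | prime p \<and> real p \<le> x. legendre_char q p\<bar>)) at_top"
proof -
  define e where "e = min (\<delta> / 4) 1"
  have e: "e > 0" "e \<le> \<delta> / 4" "e \<le> 1" using d by (auto simp: e_def)
  have 1: "eventually (\<lambda>x. \<bar>real (prime_count x) * ln x / x - 1\<bar> < e) at_top"
    using tendstoD[OF prime_number_theorem e(1)] by (simp add: dist_real_def)
  have "filterlim (\<lambda>x::real. x / ln x) at_top at_top" by real_asymp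
  hence 2: "eventually (\<lambda>x::real. x / ln x \<ge> 16 / \<delta>) at_top" by (simp add: filterlim_at_top)
  show ?thesis
    using 1 2 eventually_gt_at_top[of 1]
  proof eventually_elim
    case (elim x)
    define Y where "Y = x / ln x"
    have Y: "Y > 0" using elim(3) by (simp add: Y_def)
    have "real (prime_count x) * ln x / x = real (prime_count x) / Y" by (simp add: Y_def)
    hence "\<bar>real (prime_count x) / Y - 1\<bar> < e" using elim(1) by simp
    moreover have "real (prime_count x) - Y = (real (prime_count x) / Y - 1) * Y"
      using Y by (simp add: left_diff_distrib)
    ultimately have pc: "\<bar>real (prime_count x) - Y\<bar> \<le> e * Y"
      using Y by (simp add: abs_mult mult_right_mono less_imp_le)
    have eY: "e * Y \<le> \<delta> / 4 * Y" "e * Y \<le> 1 * Y" using e Y by (intro mult_right_mono; simp)+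
    have four: "4 \<le> \<delta> / 4 * Y" using elim(2) d by (simp add: Y_def[symmetric] pos_divide_le_eq mult.commute)
    show ?case unfolding Y_def[symmetric]
    proof (intro conjI allI impI)
      show "real (prime_count x) \<le> 2 * Y" using pc eY by linarith
      fix q assume q: "prime q" "q mod 4 = 3" "\<bar>real (split_prime_count q x) - 1 / 2 * Y\<bar> > \<delta> * Y"
      have "\<bar>2 * real (split_prime_count q x) - (real (prime_count x) + (\<Sum>p | prime p \<and> real p \<le> x. legendre_char q p))\<bar> \<le> 4"
        using split_prime_count_eq[OF q(1,2), of x] unfolding character_prime_sum_eq .
      thus "3 / 2 * \<delta> * Y \<le> \<bar>\<Sum>p | prime p \<and> real p \<le> x. legendre_char q p\<bar>"
        using q(3) pc eY four by linarith
    qed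
  qed
qed

lemma fact_le_self_power: "(fact k :: real) \<le> real k ^ k"
  using fact_le_power[of k, where 'a = real] by simp

text \<open>
  The exponent \<open>k\<close> is chosen with \<open>x ^ k \<ge> Q ^ 3\<close>, so that the diagonal terms dominate in the
  large sieve for products of \<open>k\<close> primes.
\<close>

lemma exceptional_bound_small:
  assumes d: "\<delta> > 0" and Q: "Q > 1" and x: "x > 1" "x \<le> Q ^ 8"
    and pc: "real (prime_count x) \<le> 2 * (x / ln x)"
    and E: "finite E" "real (card E) \<le> 2 * Q" "\<And>q. q \<in> E \<Longrightarrow> prime q \<and> q > 2 \<and> real q \<le> 2 * Q"
    and T: "\<And>q. q \<in> E \<Longrightarrow> \<delta> * (x / ln x) \<le> \<bar>\<Sum>p | prime p \<and> real p \<le> x. legendre_char q p\<bar>"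
    and k: "k = nat \<lceil>3 * ln Q / ln x\<rceil>"
  shows "real (card E) \<le> 10 * (22 * ln Q / \<delta>\<^sup>2) ^ k"
proof (cases "card E = 0")
  case True
  thus ?thesis using Q by simp
next
  case False
  define L where "L = ln x"
  define Y where "Y = x / L"
  define N where "N = real (card E)"
  have N: "N > 0" using False by (simp add: N_def)
  have L: "L > 0" using x by (simp add: L_def)
  have Y: "Y > 0" using x L by (simp add: Y_def)
  have lQ: "ln Q > 0" using Q by simp
  define P where "P = {p. prime p \<and> real p \<le> x}"
  \<comment> \<open>Rounding k up adds at most one L, and L is at most 8 ln Q since
    \<open>x \<le> Q ^ 8\<close>; thus 11 = 3 + 8.\<close>
  have kL: "real k * L \<ge> 3 * ln Q" "real k * L \<le> 11 * ln Q"
  proof -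
    have "3 * ln Q / L \<ge> 0" using lQ L by simp
    hence kk: "3 * ln Q / L \<le> real k" "real k \<le> 3 * ln Q / L + 1" unfolding k L_def by linarith+
    show "real k * L \<ge> 3 * ln Q" using kk(1) L by (simp add: pos_divide_le_eq)
    have "real k * L \<le> (3 * ln Q / L + 1) * L" using kk(2) L by (intro mult_right_mono) auto
    also have "\<dots> = 3 * ln Q + L" using L by (simp add: distrib_right)
    also have "L \<le> 8 * ln Q"
    proof -
      have "L \<le> ln (Q ^ 8)" unfolding L_def using x Q by (subst ln_le_cancel_iff) auto
      thus ?thesis using Q by (simp add: ln_realpow)
    qed
    finally show "real k * L \<le> 11 * ln Q" by simp
  qed
  have xk: "Q ^ 3 \<le> x ^ k"
  proof -
    have "ln (Q ^ 3) \<le> ln (x ^ k)" using kL(1) Q x by (simp add: ln_realpow L_def)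
    thus ?thesis using Q x by (subst (asm) ln_le_cancel_iff) auto
  qed
  have x1: "1 \<le> x ^ k" using x by (intro one_le_power) simp
  have "(N * (\<delta> * Y) ^ k)\<^sup>2 \<le> real (card P) ^ k * (fact k * (N * (real (nat \<lfloor>x\<rfloor>) ^ k + 1) + N\<^sup>2 * (2 * Q)\<^sup>2))"
    unfolding N_def
  proof (rule large_sieve_moment)
    show "finite P" unfolding P_def by (rule finite_primes_le)
    show "prime p \<and> p \<le> nat \<lfloor>x\<rfloor>" if "p \<in> P" for p using that by (auto simp: P_def le_nat_floor)
    show "\<delta> * Y \<ge> 0" using d Y by simp
    show "\<delta> * Y \<le> \<bar>\<Sum>p\<in>P. legendre_char q p\<bar>" if "q \<in> E" for q using T[OF that] by (simp add: P_def Y_def L_def)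
  qed (use E in auto)
  \<comment> \<open>The 10 collects \<open>x ^ k\<close> from the integers counted,
    \<open>x ^ k\<close> from the additional 1, and \<open>8 * Q ^ 3 \<le> 8 * x ^ k\<close> from
    the off-diagonal pairs.\<close>
  also have "\<dots> \<le> (2 * Y) ^ k * (real k ^ k * (N * (10 * x ^ k)))"
  proof (intro mult_mono power_mono fact_le_self_power)
    show "real (card P) \<le> 2 * Y" using pc by (simp add: prime_count_def P_def Y_def L_def)
    have "real (nat \<lfloor>x\<rfloor>) ^ k \<le> x ^ k" using x by (intro power_mono) auto
    moreover have "N * (2 * Q)\<^sup>2 \<le> (2 * Q) * (2 * Q)\<^sup>2" using E(2) by (intro mult_right_mono) (auto simp: N_def)
    moreover have "(2 * Q) * (2 * Q)\<^sup>2 = 8 * Q ^ 3" by (simp add: power2_eq_square power3_eq_cube)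
    ultimately have "(real (nat \<lfloor>x\<rfloor>) ^ k + 1) + N * (2 * Q)\<^sup>2 \<le> 10 * x ^ k" using xk x1 by linarith
    hence "N * ((real (nat \<lfloor>x\<rfloor>) ^ k + 1) + N * (2 * Q)\<^sup>2) \<le> N * (10 * x ^ k)" using N by (intro mult_left_mono) auto
    thus "N * (real (nat \<lfloor>x\<rfloor>) ^ k + 1) + N\<^sup>2 * (2 * Q)\<^sup>2 \<le> N * (10 * x ^ k)"
      by (simp add: power2_eq_square distrib_left mult.assoc)
  qed (use N Y in auto)
  finally have "N * (N * ((\<delta> * Y) ^ k)\<^sup>2) \<le> N * (10 * ((2 * Y) ^ k * (real k ^ k * x ^ k)))"
    by (simp add: power2_eq_square mult_ac)
  hence main: "N * ((\<delta> * Y) ^ k)\<^sup>2 \<le> 10 * ((2 * Y) ^ k * (real k ^ k * x ^ k))"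
    using N by (simp only: mult_le_cancel_left_pos)
  have "(2 * Y) ^ k * (real k ^ k * x ^ k) = (2 * Y * (real k * x)) ^ k" by (simp add: power_mult_distrib)
  \<comment> \<open>Here the factor k from k! meets the factor L lost through the density of the
    primes, and only their product k L remains, which is O(ln Q) whatever the size of k.\<close>
  also have "2 * Y * (real k * x) = (2 * (real k * L) / \<delta>\<^sup>2) * (\<delta> * Y)\<^sup>2"
    using d L by (simp add: Y_def power2_eq_square)
  also have "\<dots> ^ k = (2 * (real k * L) / \<delta>\<^sup>2) ^ k * ((\<delta> * Y) ^ k)\<^sup>2"
  proof -
    have "((\<delta> * Y)\<^sup>2) ^ k = ((\<delta> * Y) ^ k)\<^sup>2" by (simp only: power_mult[symmetric] mult.commute)
    thus ?thesis by (simp only: power_mult_distrib[of "2 * (real k * L) / \<delta>\<^sup>2"])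
  qed
  finally have "N * ((\<delta> * Y) ^ k)\<^sup>2 \<le> (10 * (2 * (real k * L) / \<delta>\<^sup>2) ^ k) * ((\<delta> * Y) ^ k)\<^sup>2"
    using main by simp
  hence "N \<le> 10 * (2 * (real k * L) / \<delta>\<^sup>2) ^ k"
    using d Y by (subst (asm) mult_le_cancel_right_pos) auto
  also have "\<dots> \<le> 10 * (22 * ln Q / \<delta>\<^sup>2) ^ k"
  proof -
    have "2 * (real k * L) \<le> 22 * ln Q" using kL(2) by linarith
    hence "2 * (real k * L) / \<delta>\<^sup>2 \<le> 22 * ln Q / \<delta>\<^sup>2" by (rule divide_right_mono) simp
    moreover have "0 \<le> 2 * (real k * L) / \<delta>\<^sup>2" using L by simp
    ultimately show ?thesis by (intro mult_left_mono power_mono) auto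
  qed
  finally show ?thesis by (simp add: N_def)
qed

text \<open>With R about x^(1/16): R^4 is at most x^(1/4) and Q^3 at most x^(3/8), so the
  off-diagonal part is at most 8 x^(5/8), hence below Y = x / ln x. From G at least ln x / 64 the
  sieve gives 64 Y, and the two error terms add Y each; with at most 2 Y primes this makes 2 * 66 =
  132. The primes up to R lower 3/2 delta to delta. The threshold for x is uniform in
  \<open>Q\<close> and \<open>E\<close>.\<close>

lemma exceptional_bound_large:
  assumes d: "\<delta> > 0"
  shows "eventually (\<lambda>x. \<forall>Q E. Q \<ge> 1 \<longrightarrow> Q ^ 8 \<le> x \<longrightarrow> real (prime_count x) \<le> 2 * (x / ln x) \<longrightarrow>
     finite E \<longrightarrow> real (card E) \<le> 2 * Q \<longrightarrow> (\<forall>q\<in>E. prime q \<and> q > 2 \<and> real q \<le> 2 * Q) \<longrightarrow>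
     (\<forall>q\<in>E. 3 / 2 * \<delta> * (x / ln x) \<le> \<bar>\<Sum>p | prime p \<and> real p \<le> x. legendre_char q p\<bar>) \<longrightarrow>
     real (card E) \<le> 132 / \<delta>\<^sup>2) at_top"
proof -
  have 1: "eventually (\<lambda>x::real. x powr (1/16) \<le> \<delta> / 2 * (x / ln x)) at_top" using d by real_asymp
  have 2: "eventually (\<lambda>x::real. ln x / 32 \<le> ln (real_of_int \<lfloor>x powr (1/16)\<rfloor>)) at_top" by real_asymp
  have 3: "eventually (\<lambda>x::real. 8 * x powr (5/8) \<le> x / ln x) at_top" by real_asymp
  have 4: "eventually (\<lambda>x::real. x powr (1/4) \<le> x / ln x) at_top" by real_asymp
  show ?thesis
    using 1 2 3 4 eventually_gt_at_top[of 1]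
  proof eventually_elim
    case (elim x)
    show ?case
    proof (intro allI impI)
      fix Q :: real and E :: "nat set"
      assume Q: "Q \<ge> 1" "Q ^ 8 \<le> x" and pc: "real (prime_count x) \<le> 2 * (x / ln x)"
        and E: "finite E" "real (card E) \<le> 2 * Q" "\<forall>q\<in>E. prime q \<and> q > 2 \<and> real q \<le> 2 * Q"
        and T: "\<forall>q\<in>E. 3 / 2 * \<delta> * (x / ln x) \<le> \<bar>\<Sum>p | prime p \<and> real p \<le> x. legendre_char q p\<bar>"
      define Y where "Y = x / ln x"
      define N where "N = real (card E)"
      define R where "R = nat \<lfloor>x powr (1/16)\<rfloor>"
      define M where "M = nat \<lfloor>x\<rfloor>"
      define P where "P = {p. prime p \<and> R < p \<and> p \<le> M}"
      have x: "x > 1" by fact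
      have L: "ln x > 0" using x by simp
      have Y: "Y > 0" using x L by (simp add: Y_def)
      have "x powr (1/16) \<ge> 1" using x by (intro ge_one_powr_ge_zero) auto
      hence R: "R \<ge> 1" "real R \<le> x powr (1/16)" "real R = real_of_int \<lfloor>x powr (1/16)\<rfloor>"
        by (auto simp: R_def le_nat_floor Suc_le_eq)
      have R4: "real R ^ 4 \<le> x powr (1/4)"
      proof -
        have "real R ^ 4 \<le> (x powr (1/16)) ^ 4" using R by (intro power_mono) auto
        also have "\<dots> = x powr (1/4)" using x by (simp add: powr_powr flip: powr_realpow)
        finally show ?thesis .
      qed
      have G: "selberg_G R \<ge> ln x / 64"
        using selberg_G_ge[OF R(1)] elim(2) unfolding R(3) by linarith
      have MG: "real M / selberg_G R \<le> 64 * Y"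
      proof -
        have "real M / selberg_G R \<le> x / (ln x / 64)"
          using G L x selberg_G_pos[OF R(1)] by (intro frac_le) (auto simp: M_def)
        thus ?thesis by (simp add: Y_def mult.commute)
      qed
      have split: "{p. prime p \<and> real p \<le> x} = P \<union> {p. prime p \<and> real p \<le> x \<and> p \<le> R}"
        using x by (auto simp: P_def M_def le_nat_floor)
          (metis floor_mono le_floor_iff le_nat_iff of_int_of_nat_eq of_nat_le_iff order_trans zero_le_floor less_imp_le zero_less_one le_less_trans nat_le_real_less)
      have finP: "finite P" by (rule finite_subset[of _ "{..M}"]) (auto simp: P_def)
      have TP: "\<delta> * Y \<le> \<bar>\<Sum>p\<in>P. legendre_char q p\<bar>" if q: "q \<in> E" for q
      proof -
        let ?S = "{p. prime p \<and> real p \<le> x \<and> p \<le> R}"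
        have "(\<Sum>p | prime p \<and> real p \<le> x. legendre_char q p) = (\<Sum>p\<in>P. legendre_char q p) + (\<Sum>p\<in>?S. legendre_char q p)"
          unfolding split using finP by (intro sum.union_disjoint) (auto simp: P_def)
        moreover have "\<bar>\<Sum>p\<in>?S. legendre_char q p\<bar> \<le> real R"
        proof -
          have "\<bar>\<Sum>p\<in>?S. legendre_char q p\<bar> \<le> (\<Sum>p\<in>?S. 1)"
            by (intro order_trans[OF sum_abs] sum_mono abs_legendre_char_le)
          also have "\<dots> = real (card ?S)" by simp
          also have "card ?S \<le> card {1..R}" by (intro card_mono) (auto simp: Suc_le_eq prime_gt_0_nat)
          finally show ?thesis by simp
        qed
        moreover have "3 / 2 * \<delta> * Y \<le> \<bar>\<Sum>p | prime p \<and> real p \<le> x. legendre_char q p\<bar>" using T q by (simp add: Y_def)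
        moreover have "real R \<le> \<delta> / 2 * Y" using R(2) elim(1) unfolding Y_def by linarith
        ultimately show ?thesis by linarith
      qed
      have "(N * (\<delta> * Y))\<^sup>2 \<le> real (card P) * (N * (real M / selberg_G R + real R ^ 4) + N\<^sup>2 * (real R ^ 4 * (2 * Q)\<^sup>2))"
        unfolding N_def
        by (rule large_sieve_selberg[OF R(1) _ E(1)]) (use E d Y TP in \<open>auto simp: P_def\<close>)
      also have "\<dots> \<le> (2 * Y) * (N * (66 * Y))"
      proof (intro mult_mono)
        have "card P \<le> prime_count x" unfolding prime_count_def
          by (rule card_mono[OF finite_primes_le]) (use split in auto)
        thus "real (card P) \<le> 2 * Y" using pc by (simp add: Y_def)
        have "N * (real R ^ 4 * (2 * Q)\<^sup>2) \<le> (2 * Q) * (x powr (1/4) * (2 * Q)\<^sup>2)"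
          using E(2) R4 Q by (intro mult_mono) (auto simp: N_def)
        also have "\<dots> = 8 * (Q ^ 3 * x powr (1/4))" by (simp add: power2_eq_square power3_eq_cube)
        also have "Q ^ 3 \<le> x powr (3/8)"
        proof -
          have "Q ^ 3 = Q powr (8 * (3/8))" using Q by simp
          also have "\<dots> = (Q powr 8) powr (3/8)" by (rule powr_powr[symmetric])
          also have "Q powr 8 = Q ^ 8" using Q by simp
          also have "(Q ^ 8) powr (3/8) \<le> x powr (3/8)" using Q by (intro powr_mono2) auto
          finally show ?thesis .
        qed
        hence "8 * (Q ^ 3 * x powr (1/4)) \<le> 8 * (x powr (3/8) * x powr (1/4))"
          by (intro mult_left_mono mult_right_mono) auto
        also have "x powr (3/8) * x powr (1/4) = x powr (5/8)" by (simp flip: powr_add)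
        also have "8 * x powr (5/8) \<le> Y" using elim(3) by (simp add: Y_def)
        finally have a: "N * (real R ^ 4 * (2 * Q)\<^sup>2) \<le> Y" .
        have b: "real R ^ 4 \<le> Y" using R4 elim(4) by (simp add: Y_def)
        have "(real M / selberg_G R + real R ^ 4) + N * (real R ^ 4 * (2 * Q)\<^sup>2) \<le> 66 * Y"
          using a b MG by linarith
        hence "N * ((real M / selberg_G R + real R ^ 4) + N * (real R ^ 4 * (2 * Q)\<^sup>2)) \<le> N * (66 * Y)"
          by (intro mult_left_mono) (auto simp: N_def)
        thus "N * (real M / selberg_G R + real R ^ 4) + N\<^sup>2 * (real R ^ 4 * (2 * Q)\<^sup>2) \<le> N * (66 * Y)"
          by (simp add: power2_eq_square distrib_left mult.assoc)
      qed (use Y selberg_G_pos[OF R(1)] in \<open>auto simp: N_def intro!: add_nonneg_nonneg mult_nonneg_nonneg\<close>)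
      finally have "N * (N * \<delta>\<^sup>2) * Y\<^sup>2 \<le> N * 132 * Y\<^sup>2"
        by (simp add: power2_eq_square mult_ac)
      hence "N * (N * \<delta>\<^sup>2) \<le> N * 132" using Y by (subst (asm) mult_le_cancel_right_pos) auto
      hence "N = 0 \<or> N * \<delta>\<^sup>2 \<le> 132" by (auto simp: mult_le_cancel_left N_def)
      thus "real (card E) \<le> 132 / \<delta>\<^sup>2"
        using d by (auto simp: N_def pos_le_divide_eq)
    qed
  qed
qed

lemma iterated_ln_4: "iterated_ln 4 x = ln (ln (ln (ln x)))"
  by (simp add: iterated_ln_def numeral_eq_Suc)

theorem corollary3:
  shows "\<exists>C K :: real. C > 0 \<and> K > 0 \<and>
    (\<forall>\<delta> > 0. \<exists>Q\<^sub>0 :: real. \<forall>Q \<ge> Q\<^sub>0. \<forall>x \<ge> exp (3 * C * ln Q / iterated_ln 4 Q).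
       real (card {q :: nat. prime q \<and> Q < real q \<and> real q \<le> 2 * Q \<and> [q = 3] (mod 4) \<and>
           \<bar>real (split_prime_count q x) - 1 / 2 * (x / ln x)\<bar> > \<delta> * (x / ln x)})
         \<le> K * Q * exp (- C * ln Q / iterated_ln 4 Q))"
proof (rule exI[of _ 1], rule exI[of _ 1], intro conjI allI impI)
  fix \<delta> :: real assume d: "\<delta> > 0"
  define c where "c = 22 / \<delta>\<^sup>2"
  have c: "c > 0" using d by (simp add: c_def)
  obtain X1 where X1: "\<And>x. x \<ge> X1 \<Longrightarrow> real (prime_count x) \<le> 2 * (x / ln x) \<and>
     (\<forall>q. prime q \<longrightarrow> q mod 4 = 3 \<longrightarrow> \<bar>real (split_prime_count q x) - 1 / 2 * (x / ln x)\<bar> > \<delta> * (x / ln x) \<longrightarrow>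
       3 / 2 * \<delta> * (x / ln x) \<le> \<bar>\<Sum>p | prime p \<and> real p \<le> x. legendre_char q p\<bar>)"
    using character_sum_large[OF d] unfolding eventually_at_top_linorder by blast
  obtain X2 where X2: "\<And>x Q E. x \<ge> X2 \<Longrightarrow> Q \<ge> 1 \<Longrightarrow> Q ^ 8 \<le> x \<Longrightarrow> real (prime_count x) \<le> 2 * (x / ln x) \<Longrightarrow>
     finite E \<Longrightarrow> real (card E) \<le> 2 * Q \<Longrightarrow> (\<forall>q\<in>E. prime q \<and> q > 2 \<and> real q \<le> 2 * Q) \<Longrightarrow>
     (\<forall>q\<in>E. 3 / 2 * \<delta> * (x / ln x) \<le> \<bar>\<Sum>p | prime p \<and> real p \<le> x. legendre_char q p\<bar>) \<Longrightarrow>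
     real (card E) \<le> 132 / \<delta>\<^sup>2"
    using exceptional_bound_large[OF d] unfolding eventually_at_top_linorder by blast
  \<comment> \<open>With l = ln ln ln ln Q the left side is exp of about l ln ln Q, while the right
    side is exp of (1 - 1 / l) ln Q.\<close>
  have "eventually (\<lambda>Q::real. 10 * (c * ln Q) powr (ln (ln (ln (ln Q))) + 1) \<le> Q * exp (- ln Q / ln (ln (ln (ln Q))))) at_top"
    using c by real_asymp
  moreover have "eventually (\<lambda>Q::real. 132 / \<delta>\<^sup>2 \<le> Q * exp (- ln Q / ln (ln (ln (ln Q))))) at_top"
    by real_asymp
  moreover have "filterlim (\<lambda>Q::real. exp (3 * ln Q / ln (ln (ln (ln Q))))) at_top at_top" by real_asymp
  hence "eventually (\<lambda>Q::real. exp (3 * ln Q / ln (ln (ln (ln Q)))) \<ge> max X1 (max X2 2)) at_top"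
    by (simp only: filterlim_at_top)
  moreover have "eventually (\<lambda>Q::real. ln (ln (ln (ln Q))) > 0) at_top" by real_asymp
  moreover have "eventually (\<lambda>Q::real. c * ln Q \<ge> 1) at_top" using c by real_asymp
  moreover have "eventually (\<lambda>Q::real. Q > 1) at_top" by (rule eventually_gt_at_top)
  ultimately have "eventually (\<lambda>Q::real. \<forall>x \<ge> exp (3 * 1 * ln Q / iterated_ln 4 Q).
       real (card {q :: nat. prime q \<and> Q < real q \<and> real q \<le> 2 * Q \<and> [q = 3] (mod 4) \<and>
           \<bar>real (split_prime_count q x) - 1 / 2 * (x / ln x)\<bar> > \<delta> * (x / ln x)})
         \<le> 1 * Q * exp (- 1 * ln Q / iterated_ln 4 Q)) at_top"
  proof eventually_elim
    case (elim Q)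
    define l where "l = ln (ln (ln (ln Q)))"
    show ?case unfolding iterated_ln_4 l_def[symmetric]
    proof (intro allI impI)
      fix x assume x: "x \<ge> exp (3 * 1 * ln Q / l)"
      have xX: "x \<ge> X1" "x \<ge> X2" "x \<ge> 2" using x elim(3) by (simp_all add: l_def)
      define E where "E = {q :: nat. prime q \<and> Q < real q \<and> real q \<le> 2 * Q \<and> [q = 3] (mod 4) \<and>
           \<bar>real (split_prime_count q x) - 1 / 2 * (x / ln x)\<bar> > \<delta> * (x / ln x)}"
      have mod4: "q mod 4 = 3" if "q \<in> E" for q using that by (simp add: E_def Cong.cong_def)
      have sub: "E \<subseteq> {1..nat \<lfloor>2 * Q\<rfloor>}"
        by (auto simp: E_def le_nat_floor Suc_le_eq prime_gt_0_nat)
      hence fin: "finite E" by (rule finite_subset) simp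
      have "card E \<le> card {1..nat \<lfloor>2 * Q\<rfloor>}" using sub by (intro card_mono) auto
      hence cE: "real (card E) \<le> 2 * Q" using elim(6) by simp linarith
      have pc: "real (prime_count x) \<le> 2 * (x / ln x)" using X1[OF xX(1)] by blast
      have q2: "prime q \<and> q > 2 \<and> real q \<le> 2 * Q" if "q \<in> E" for q
      proof -
        have "q \<ge> 3" using mod4[OF that] by (metis mod_less_eq_dividend)
        thus ?thesis using that by (auto simp: E_def)
      qed
      have T: "3 / 2 * \<delta> * (x / ln x) \<le> \<bar>\<Sum>p | prime p \<and> real p \<le> x. legendre_char q p\<bar>" if "q \<in> E" for q
        using X1[OF xX(1)] mod4[OF that] that by (auto simp: E_def)
      have "real (card E) \<le> Q * exp (- ln Q / l)"
      proof (cases "x \<le> Q ^ 8")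
        case True
        define k where "k = nat \<lceil>3 * ln Q / ln x\<rceil>"
        have lx: "ln x > 0" "x / ln x > 0" using xX(3) by auto
        have T': "\<delta> * (x / ln x) \<le> \<bar>\<Sum>p | prime p \<and> real p \<le> x. legendre_char q p\<bar>" if "q \<in> E" for q
        proof -
          have "\<delta> * (x / ln x) > 0" using d lx by (intro mult_pos_pos)
          thus ?thesis using T[OF that] by linarith
        qed
        have "real (card E) \<le> 10 * (22 * ln Q / \<delta>\<^sup>2) ^ k"
          using d elim(6) xX(3) True pc fin cE q2 T' k_def by (intro exceptional_bound_small) auto
        also have "22 * ln Q / \<delta>\<^sup>2 = c * ln Q" by (simp add: c_def)
        also have "(c * ln Q) ^ k = (c * ln Q) powr real k" using elim(5) by (simp add: powr_realpow)
        \<comment> \<open>The lower limit for x says exactly that 3 ln Q / ln x is at most l; the 1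
          in \<open>l + 1\<close> is for the ceiling in \<open>k\<close>.\<close>
        also have "10 * (c * ln Q) powr real k \<le> 10 * (c * ln Q) powr (l + 1)"
        proof (intro mult_left_mono powr_mono)
          have l0: "l > 0" using elim(4) by (simp add: l_def)
          have "ln (exp (3 * 1 * ln Q / l)) \<le> ln x" using x xX(3) by (subst ln_le_cancel_iff) auto
          hence "3 * ln Q \<le> l * ln x" using l0 by (simp add: pos_divide_le_eq mult.commute)
          hence "3 * ln Q / ln x \<le> l" using lx by (simp add: pos_divide_le_eq)
          moreover have "3 * ln Q / ln x \<ge> 0" using lx elim(6) by simp
          ultimately show "real k \<le> l + 1" unfolding k_def by linarith
        qed (use elim(5) in auto)
        also have "\<dots> \<le> Q * exp (- ln Q / l)" using elim(1) by (simp add: l_def)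
        finally show ?thesis .
      next
        case False
        have "real (card E) \<le> 132 / \<delta>\<^sup>2"
          using xX(2) elim(6) False pc fin cE q2 T by (intro X2) auto
        also have "\<dots> \<le> Q * exp (- ln Q / l)" using elim(2) by (simp add: l_def)
        finally show ?thesis .
      qed
      thus "real (card {q :: nat. prime q \<and> Q < real q \<and> real q \<le> 2 * Q \<and> [q = 3] (mod 4) \<and>
           \<bar>real (split_prime_count q x) - 1 / 2 * (x / ln x)\<bar> > \<delta> * (x / ln x)}) \<le> 1 * Q * exp (- 1 * ln Q / l)"
        by (simp add: E_def)
    qed
  qed
  thus "\<exists>Q\<^sub>0 :: real. \<forall>Q \<ge> Q\<^sub>0. \<forall>x \<ge> exp (3 * 1 * ln Q / iterated_ln 4 Q).
       real (card {q :: nat. prime q \<and> Q < real q \<and> real q \<le> 2 * Q \<and> [q = 3] (mod 4) \<and>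
           \<bar>real (split_prime_count q x) - 1 / 2 * (x / ln x)\<bar> > \<delta> * (x / ln x)})
         \<le> 1 * Q * exp (- 1 * ln Q / iterated_ln 4 Q)"
    unfolding eventually_at_top_linorder .
qed simp_all

end
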